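(* Let $\beta>0$ and $\sigma>0$. Every standing wave $\psi^\omega(t,\mathbf x)=e^{i\omega t}u^\omega(\mathbf x)$ of (NLS) is given by $$u^\omega(\mathbf x)=Q(\omega)\,e^{i\eta}\,G_\omega(\mathbf x),$$ where $\eta\in\mathbb R$ is a constant, $$Q(\omega):=\left(\frac{\log\frac{\sqrt\omega}{2}+\gamma}{2\pi\beta}\right)^{\frac1{2\sigma}},$$ and $\omega\in(4e^{-2\gamma},+\infty)$. In addition, $$\min_{\omega\in(4e^{-2\gamma},+\infty)}E(\psi^\omega)=\Lambda<0,\qquad \Lambda:=-\frac{\sigma}{4\pi(\sigma+1)(4\pi\sigma\beta)^{1/\sigma}} .$$
   Context: Notation. $\langle\cdot,\cdot\rangle$ is the hermitian product of $L^2(\mathbb R^2)$, antilinear in the first argument; $^*$ is complex conjugation; $\gamma$ is the Euler–Mascheroni constant. For $\lambda>0$, $G_\lambda(\mathbf x)=\frac1{2\pi}K_0(\sqrt\lambda|\mathbf x|)$ (with $K_0$ the Macdonald function) is the Green's function of $-\Delta+\lambda$ on $\mathbb R^2$. Energy space. $V:=\{\psi\in L^2(\mathbb R^2):\ \phi_\lambda:=\psi-qG_\lambda\in H^1(\mathbb R^2)\text{ for some } q\in\mathbb C\}$. $V$ and the charge $q$ of $\psi$ do not depend on $\lambda>0$; for each $\lambda$ the decomposition $\psi=\phi_\lambda+qG_\lambda$ is unique. For $\chi\in V$ write $\chi=\chi_\lambda+q_\chi G_\lambda$. Set $$\theta_\lambda(s):=\tfrac1{2\pi}\log\tfrac{\sqrt\lambda}{2}+\tfrac{\gamma}{2\pi}-\beta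 s^{2\sigma},\qquad s\ge0.$$ Equation (NLS). For $\psi_t=\phi_{\lambda,t}+q(t)G_\lambda\in V$: $$i\tfrac{d}{dt}\langle\chi,\psi_t\rangle=\langle\nabla\chi_\lambda,\nabla\phi_{\lambda,t}\rangle+\lambda\langle\chi_\lambda,\phi_{\lambda,t}\rangle-\lambda\langle\chi,\psi_t\rangle+\theta_\lambda(|q(t)|)\,q_\chi^*\,q(t)\quad\forall\chi\in V,\qquad \psi_{t=0}=\psi_0 .$$ (This does not depend on $\lambda>0$.) Standing wave. A standing wave is a nontrivial (not identically zero) solution of (NLS) of the form $\psi^\omega(t,\mathbf x)=e^{i\omega t}u^\omega(\mathbf x)$ with $\omega\in\mathbb R$, $u^\omega\in V$. Energy. For $\psi=\phi_\lambda+qG_\lambda\in V$ (the value is independent of $\lambda>0$) $$E(\psi):=\|\nabla\phi_\lambda\|_{L^2}^2+\lambda\big(\|\phi_\lambda\|_{L^2}^2-\|\psi\|_{L^2}^2\big)+\theta_\lambda(|q|)|q|^2+\frac{\sigma\beta}{\sigma+1}|q|^{2\sigma+2}.$$ For $\psi=\psi^\omega$ it does not depend on $t$ nor on the phase $\eta$. *)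

theory Defs
  imports "HOL-Analysis.Analysis"
begin

text \<open>
  Elements of the Lebesgue and Sobolev spaces are represented by Borel functions; identity of
  elements is equality almost everywhere. The letter lam stands for the spectral parameter.
\<close>

definition L2 :: "(real^2 \<Rightarrow> 'b::{banach, second_countable_topology}) set" where
  "L2 = {f \<in> borel_measurable lborel. integrable lborel (\<lambda>x. (norm (f x))\<^sup>2)}"

definition L2_norm :: "(real^2 \<Rightarrow> 'b::{banach, second_countable_topology}) \<Rightarrow> real" where
  "L2_norm f = sqrt (\<integral>x. (norm (f x))\<^sup>2 \<partial>lborel)"

definition herm :: "(real^2 \<Rightarrow> complex) \<Rightarrow> (real^2 \<Rightarrow> complex) \<Rightarrow> complex" where
  "herm f g = (\<integral>x. cnj (f x) * g x \<partial>lborel)"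

definition herm_vec :: "(real^2 \<Rightarrow> complex^2) \<Rightarrow> (real^2 \<Rightarrow> complex^2) \<Rightarrow> complex" where
  "herm_vec F G = (\<Sum>i\<in>UNIV. herm (\<lambda>x. F x $ i) (\<lambda>x. G x $ i))"

definition partial_deriv :: "2 \<Rightarrow> (real^2 \<Rightarrow> real) \<Rightarrow> real^2 \<Rightarrow> real" where
  "partial_deriv i f x = frechet_derivative f (at x) (axis i 1)"

primrec C_k :: "nat \<Rightarrow> (real^2 \<Rightarrow> real) \<Rightarrow> bool" where
  "C_k 0 f \<longleftrightarrow> continuous_on UNIV f"
| "C_k (Suc k) f \<longleftrightarrow> f differentiable_on UNIV \<and> (\<forall>i. C_k k (partial_deriv i f))"

definition test_function :: "(real^2 \<Rightarrow> real) \<Rightarrow> bool" where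
  "test_function \<phi> \<longleftrightarrow> (\<forall>k. C_k k \<phi>) \<and> compact (closure {x. \<phi> x \<noteq> 0})"

definition has_weak_grad :: "(real^2 \<Rightarrow> complex) \<Rightarrow> (real^2 \<Rightarrow> complex^2) \<Rightarrow> bool" where
  "has_weak_grad f F \<longleftrightarrow>
     (\<forall>\<phi> i. test_function \<phi> \<longrightarrow>
        (\<integral>x. partial_deriv i \<phi> x *\<^sub>R f x \<partial>lborel) = - (\<integral>x. \<phi> x *\<^sub>R (F x $ i) \<partial>lborel))"

definition H1 :: "(real^2 \<Rightarrow> complex) set" where
  "H1 = {f \<in> L2. \<exists>F \<in> L2. has_weak_grad f F}"

text \<open>The weak gradient is determined up to a null set only, hence the choice of a representative.\<close>

definition weak_grad :: "(real^2 \<Rightarrow> complex) \<Rightarrow> real^2 \<Rightarrow> complex^2" where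
  "weak_grad f = (SOME F. F \<in> L2 \<and> has_weak_grad f F)"

text \<open>
  Integral representation of the Macdonald function of order zero, valid for positive arguments.
  At the argument 0 the integral diverges and the Bochner integral returns 0; this affects
  Green's function only at the origin, a null set.
\<close>

definition macdonald_K0 :: "real \<Rightarrow> real" where
  "macdonald_K0 r = (LINT t:{0..}|lborel. exp (- r * cosh t))"

definition green :: "real \<Rightarrow> real^2 \<Rightarrow> complex" where
  "green lam x = complex_of_real (1 / (2 * pi) * macdonald_K0 (sqrt lam * norm x))"

definition energy_space :: "real \<Rightarrow> (real^2 \<Rightarrow> complex) set" where
  "energy_space lam = {\<psi> \<in> L2. \<exists>q. (\<lambda>x. \<psi> x - q * green lam x) \<in> H1}"

definition charge :: "real \<Rightarrow> (real^2 \<Rightarrow> complex) \<Rightarrow> complex" where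
  "charge lam \<psi> = (THE q. (\<lambda>x. \<psi> x - q * green lam x) \<in> H1)"

definition regular_part :: "real \<Rightarrow> (real^2 \<Rightarrow> complex) \<Rightarrow> real^2 \<Rightarrow> complex" where
  "regular_part lam \<psi> = (\<lambda>x. \<psi> x - charge lam \<psi> * green lam x)"

definition theta :: "real \<Rightarrow> real \<Rightarrow> real \<Rightarrow> real \<Rightarrow> real" where
  "theta \<beta> \<sigma> lam s =
     1 / (2 * pi) * ln (sqrt lam / 2) + euler_mascheroni / (2 * pi) - \<beta> * s powr (2 * \<sigma>)"

definition NLS_solution ::
    "real \<Rightarrow> real \<Rightarrow> real \<Rightarrow> (real^2 \<Rightarrow> complex) \<Rightarrow> (real \<Rightarrow> real^2 \<Rightarrow> complex) \<Rightarrow> bool" where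
  "NLS_solution \<beta> \<sigma> lam \<psi>\<^sub>0 \<psi> \<longleftrightarrow>
     (\<forall>t. \<psi> t \<in> energy_space lam) \<and>
     (AE x in lborel. \<psi> 0 x = \<psi>\<^sub>0 x) \<and>
     (\<forall>\<xi> \<in> energy_space lam. \<forall>t. \<exists>D.
        ((\<lambda>s. herm \<xi> (\<psi> s)) has_vector_derivative D) (at t) \<and>
        \<i> * D = herm_vec (weak_grad (regular_part lam \<xi>)) (weak_grad (regular_part lam (\<psi> t)))
              + lam * herm (regular_part lam \<xi>) (regular_part lam (\<psi> t))
              - lam * herm \<xi> (\<psi> t)
              + theta \<beta> \<sigma> lam (cmod (charge lam (\<psi> t))) * cnj (charge lam \<xi>) * charge lam (\<psi> t))"

definition rotating :: "real \<Rightarrow> (real^2 \<Rightarrow> complex) \<Rightarrow> real \<Rightarrow> real^2 \<Rightarrow> complex" where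
  "rotating \<omega> u t x = exp (\<i> * \<omega> * t) * u x"

definition standing_wave ::
    "real \<Rightarrow> real \<Rightarrow> real \<Rightarrow> real \<Rightarrow> (real^2 \<Rightarrow> complex) \<Rightarrow> bool" where
  "standing_wave \<beta> \<sigma> lam \<omega> u \<longleftrightarrow>
     u \<in> energy_space lam \<and> \<not> (AE x in lborel. u x = 0) \<and>
     NLS_solution \<beta> \<sigma> lam u (rotating \<omega> u)"

definition energy :: "real \<Rightarrow> real \<Rightarrow> real \<Rightarrow> (real^2 \<Rightarrow> complex) \<Rightarrow> real" where
  "energy \<beta> \<sigma> lam \<psi> =
     (let q = charge lam \<psi>; \<phi> = regular_part lam \<psi> in
        (L2_norm (weak_grad \<phi>))\<^sup>2 + lam * ((L2_norm \<phi>)\<^sup>2 - (L2_norm \<psi>)\<^sup>2)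
        + theta \<beta> \<sigma> lam (cmod q) * (cmod q)\<^sup>2
        + \<sigma> * \<beta> / (\<sigma> + 1) * cmod q powr (2 * \<sigma> + 2))"

definition Q :: "real \<Rightarrow> real \<Rightarrow> real \<Rightarrow> real" where
  "Q \<beta> \<sigma> \<omega> = ((ln (sqrt \<omega> / 2) + euler_mascheroni) / (2 * pi * \<beta>)) powr (1 / (2 * \<sigma>))"

definition profile :: "real \<Rightarrow> real \<Rightarrow> real \<Rightarrow> real \<Rightarrow> real^2 \<Rightarrow> complex" where
  "profile \<beta> \<sigma> \<omega> \<eta> x = Q \<beta> \<sigma> \<omega> * exp (\<i> * \<eta>) * green \<omega> x"

definition frequencies :: "real set" where
  "frequencies = {4 * exp (- 2 * euler_mascheroni) <..}"

definition min_energy :: "real \<Rightarrow> real \<Rightarrow> real" where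
  "min_energy \<beta> \<sigma> = - \<sigma> / (4 * pi * (\<sigma> + 1) * (4 * pi * \<sigma> * \<beta>) powr (1 / \<sigma>))"

end

theory Submission
  imports Defs "HOL-Probability.Distributions"
begin

text \<open>
  Inserting \<open>exp (i \<omega> t) u\<close> into the evolution equation gives a linear equation for the profile \<open>u\<close>,
  in which the nonlinearity appears only as a real coupling constant \<open>\<tau> = theta \<beta> \<sigma> lam \<bar>q\<bar>\<close>, where \<open>q\<close> is the
  charge of \<open>u\<close> (\<open>NLS_solution_rotating_iff\<close>). Informally, it states that \<open>(- \<Delta> + \<omega>) u\<close> is \<open>q\<close> times
  the delta distribution at the origin, together with a condition that links \<open>q\<close> to the value at the origin
  of the regular part.

  The spectral parameter \<open>lam\<close> is arbitrary. If it is replaced by another one, the sesquilinear form of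
  the equation changes by a multiple of the product of the charges, and this is compensated by
  the logarithm in \<open>theta\<close> (\<open>form_change\<close>). For \<open>\<omega> > 0\<close> the natural choice is \<open>\<omega>\<close> itself. Testing the equation
  with the regular part of \<open>u\<close> then shows that the regular part vanishes, so that \<open>u = q G\<^sub>\<omega>\<close>, and testing
  it with \<open>G\<^sub>\<omega>\<close> gives \<open>theta \<beta> \<sigma> \<omega> \<bar>q\<bar> = 0\<close> (\<open>stationary_positive\<close>). The last equation determines \<open>\<bar>q\<bar> = Q\<close>
  and has a positive solution exactly for the frequencies of the theorem. The converse uses the
  same computation.

  Frequencies \<open>\<omega> \<le> 0\<close> are excluded by scaling. The dilate \<open>u\<^sub>s (x) = u (s x)\<close> solves the equation with the
  frequency \<open>s\<^sup>2 \<omega>\<close> and with a shifted coupling constant. Comparing the two equations yields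
  \<open>\<omega> (s\<^sup>2 - 1) \<langle>u, u\<^sub>s\<rangle> = \<bar>q\<bar>\<^sup>2 ln s / (2 \<pi>)\<close> (\<open>stationary_dilate\<close>), a form of the virial
  identity \<open>\<omega> \<parallel>u\<parallel>\<^sup>2 = \<bar>q\<bar>\<^sup>2 / (4 \<pi>)\<close> that requires neither derivatives of \<open>u\<close> nor decay. For \<open>\<omega> = 0\<close> it forces
  \<open>q = 0\<close>, and then the gradient of \<open>u\<close> vanishes. For \<open>\<omega> < 0\<close> it makes the scalar products of distinct dilates
  nonpositive, which is impossible for many dilates that are all close to a nonzero function.

  The analysis of Green's function rests on its representation as a Laplace transform in time of the heat
  kernel (\<open>green_real_heat\<close>). It gives the scalar products of Green's functions, the
  \<open>H\<^sup>1\<close> regularity of \<open>G\<^sub>a - G\<^sub>b\<close>, and the weak equation for this difference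
  (\<open>green_diff_grad_weak_equation\<close>). The growth of its gradient as \<open>b\<close> tends to infinity shows that Green's
  functions are not in \<open>H\<^sup>1\<close> (\<open>green_not_H1\<close>), so that charges are well defined.

  At the spectral parameter \<open>\<omega>\<close> the energy of the standing wave reduces to
  \<open>\<sigma> \<beta> / (\<sigma> + 1) Q powr (2 \<sigma> + 2) - Q\<^sup>2 / (4 \<pi>)\<close> (\<open>energy_profile\<close>). Bernoulli's inequality gives the minimum
  of this function of \<open>Q > 0\<close>, and the minimum is attained because some admissible frequency realizes the
  optimal \<open>Q\<close>.
\<close>

section \<open>Smooth functions and test functions\<close>

definition smooth :: "(real^2 \<Rightarrow> real) \<Rightarrow> bool" where
  "smooth f \<longleftrightarrow> (\<forall>k. C_k k f)"

lemma partial_deriv_eqI: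
  "(f has_derivative D) (at x) \<Longrightarrow> partial_deriv i f x = D (axis i 1)"
  unfolding partial_deriv_def by (simp add: frechet_derivative_at[symmetric])

lemma C_k_SucI:
  assumes "\<And>x. (f has_derivative f' x) (at x)" "\<And>i. C_k k (\<lambda>x. f' x (axis i 1))"
  shows "C_k (Suc k) f"
proof -
  have "partial_deriv i f = (\<lambda>x. f' x (axis i 1))" for i
    using partial_deriv_eqI[OF assms(1)] by auto
  moreover have "f differentiable_on UNIV"
    using assms(1) by (auto simp: differentiable_on_def differentiable_def)
  ultimately show ?thesis
    using assms(2) by simp
qed

lemma C_k_Suc_has_derivative:
  assumes "C_k (Suc k) f"
  shows "(f has_derivative frechet_derivative f (at x)) (at x)"
  using assms by (auto simp: differentiable_on_def frechet_derivative_works)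

lemma C_k_Suc_imp: "C_k (Suc k) f \<Longrightarrow> C_k k f"
proof (induction k arbitrary: f)
  case 0
  then show ?case by (auto intro: differentiable_imp_continuous_on)
qed auto

lemma C_k_const: "C_k k (\<lambda>x. c)"
proof (induction k arbitrary: c)
  case (Suc k)
  show ?case by (rule C_k_SucI[where f'="\<lambda>x h. 0"]) (auto intro: Suc)
qed auto

lemma C_k_add: "C_k k f \<Longrightarrow> C_k k g \<Longrightarrow> C_k k (\<lambda>x. f x + g x)"
proof (induction k arbitrary: f g)
  case 0
  then show ?case by (auto intro!: continuous_intros)
next
  case (Suc k)
  show ?case
  proof (rule C_k_SucI)
    show "((\<lambda>x. f x + g x) has_derivative
        (\<lambda>h. frechet_derivative f (at x) h + frechet_derivative g (at x) h)) (at x)" for x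
      by (rule has_derivative_add[OF C_k_Suc_has_derivative[OF Suc.prems(1)] C_k_Suc_has_derivative[OF Suc.prems(2)]])
    show "C_k k (\<lambda>x. frechet_derivative f (at x) (axis i 1) + frechet_derivative g (at x) (axis i 1))" for i
      using Suc.IH[of "partial_deriv i f" "partial_deriv i g"] Suc.prems
      by (simp add: partial_deriv_def[abs_def])
  qed
qed

lemma C_k_mult: "C_k k f \<Longrightarrow> C_k k g \<Longrightarrow> C_k k (\<lambda>x. f x * g x)"
proof (induction k arbitrary: f g)
  case 0
  then show ?case by (auto intro!: continuous_intros)
next
  case (Suc k)
  show ?case
  proof (rule C_k_SucI)
    show "((\<lambda>x. f x * g x) has_derivative
        (\<lambda>h. f x * frechet_derivative g (at x) h + frechet_derivative f (at x) h * g x)) (at x)" for x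
      by (rule has_derivative_mult[OF C_k_Suc_has_derivative[OF Suc.prems(1)] C_k_Suc_has_derivative[OF Suc.prems(2)]])
    show "C_k k (\<lambda>x. f x * frechet_derivative g (at x) (axis i 1) + frechet_derivative f (at x) (axis i 1) * g x)" for i
      using Suc.IH[of f "partial_deriv i g"] Suc.IH[of "partial_deriv i f" g] Suc.prems
        C_k_Suc_imp[OF Suc.prems(1)] C_k_Suc_imp[OF Suc.prems(2)]
      by (intro C_k_add) (simp_all add: partial_deriv_def[abs_def])
  qed
qed

lemma C_k_prod: "finite I \<Longrightarrow> (\<And>i. i \<in> I \<Longrightarrow> C_k k (f i)) \<Longrightarrow> C_k k (\<lambda>x. \<Prod>i\<in>I. f i x)"
  by (induction I rule: finite_induct) (auto intro: C_k_const C_k_mult)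

lemma has_derivative_coordinate:
  assumes "\<And>t. (h has_real_derivative h' t) (at t)"
  shows "((\<lambda>x::real^2. h (x $ i)) has_derivative (\<lambda>v. h' (x $ i) * v $ i)) (at x)"
proof -
  have "((\<lambda>x::real^2. x $ i) has_derivative (\<lambda>v. v $ i)) (at x)"
    by (intro bounded_linear_imp_has_derivative bounded_linear_vec_nth)
  from has_derivative_compose[OF this assms[of "x $ i", unfolded has_field_derivative_def]]
  show ?thesis by simp
qed

text \<open>
  Bumps and their primitives are products of functions of a single coordinate. For such a function,
  membership in every \<open>C_k\<close> follows by induction on \<open>k\<close> from a family that is closed under the
  one-dimensional derivative.
\<close>

lemma C_k_coordinate:
  assumes "\<And>t. (h has_real_derivative h' t) (at t)" "C_k k (\<lambda>x. h' (x $ i))"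
  shows "C_k (Suc k) (\<lambda>x. h (x $ i))"
  by (rule C_k_SucI[OF has_derivative_coordinate[OF assms(1)]])
    (intro C_k_mult assms(2) C_k_const)

lemma smooth_const: "smooth (\<lambda>x. c)"
  by (simp add: smooth_def C_k_const)

lemma smooth_add: "smooth f \<Longrightarrow> smooth g \<Longrightarrow> smooth (\<lambda>x. f x + g x)"
  by (simp add: smooth_def C_k_add)

lemma smooth_mult: "smooth f \<Longrightarrow> smooth g \<Longrightarrow> smooth (\<lambda>x. f x * g x)"
  by (simp add: smooth_def C_k_mult)

lemma smooth_coordinate:
  assumes "\<And>t. (h has_real_derivative h' t) (at t)" "smooth (\<lambda>x. h' (x $ i))"
  shows "smooth (\<lambda>x. h (x $ i))"
proof -
  have "C_k (Suc k) (\<lambda>x. h (x $ i))" for k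
    using assms C_k_coordinate[of h h'] by (auto simp: smooth_def)
  then show ?thesis
    using C_k_Suc_imp by (auto simp: smooth_def)
qed

lemma smooth_nth: "smooth (\<lambda>x. x $ i)"
  by (rule smooth_coordinate[where h="\<lambda>t. t" and h'="\<lambda>t. 1"]) (auto intro: smooth_const)

lemma smooth_has_derivative:
  assumes "smooth f"
  shows "(f has_derivative frechet_derivative f (at x)) (at x)"
  using assms C_k_Suc_has_derivative unfolding smooth_def by blast

lemma smooth_continuous_on: "smooth f \<Longrightarrow> continuous_on S f"
  unfolding smooth_def by (metis C_k.simps(1) continuous_on_subset subset_UNIV)

lemma smooth_partial_deriv: "smooth f \<Longrightarrow> smooth (partial_deriv i f)"
  unfolding smooth_def by (metis C_k.simps(2))

lemma smooth_measurable [measurable (raw)]: "smooth f \<Longrightarrow> f \<in> borel_measurable borel"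
  by (intro borel_measurable_continuous_onI smooth_continuous_on)

lemma partial_deriv_mult:
  assumes "smooth f" "smooth g"
  shows "partial_deriv i (\<lambda>x. f x * g x) x = f x * partial_deriv i g x + partial_deriv i f x * g x"
  using partial_deriv_eqI[OF has_derivative_mult[OF smooth_has_derivative[OF assms(1)] smooth_has_derivative[OF assms(2)]]]
  by (simp add: partial_deriv_def)

lemma has_derivative_dilate:
  assumes "(f has_derivative D) (at (c *\<^sub>R x))"
  shows "((\<lambda>x. f (c *\<^sub>R x)) has_derivative (\<lambda>h. D (c *\<^sub>R h))) (at x)"
  by (rule has_derivative_compose[where f="\<lambda>x. c *\<^sub>R x" and g=f, OF _ assms])
    (auto intro!: derivative_eq_intros)

lemma partial_deriv_dilate:
  assumes "smooth f"
  shows "partial_deriv i (\<lambda>x. f (c *\<^sub>R x)) x = c * partial_deriv i f (c *\<^sub>R x)"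
proof -
  have "partial_deriv i (\<lambda>x. f (c *\<^sub>R x)) x = frechet_derivative f (at (c *\<^sub>R x)) (c *\<^sub>R axis i 1)"
    by (rule partial_deriv_eqI[OF has_derivative_dilate[OF smooth_has_derivative[OF assms]]])
  also have "\<dots> = c * partial_deriv i f (c *\<^sub>R x)"
    unfolding partial_deriv_def
    using linear_scale[OF has_derivative_linear[OF smooth_has_derivative[OF assms]]] by fastforce
  finally show ?thesis .
qed

lemma smooth_dilate:
  assumes "smooth f" shows "smooth (\<lambda>x. f (c *\<^sub>R x))"
proof -
  have "C_k k (\<lambda>x. f (c *\<^sub>R x))" for k
    using assms
  proof (induction k arbitrary: f)
    case 0
    then show ?case
      by (auto intro!: continuous_on_compose2[OF smooth_continuous_on] continuous_intros)
  next
    case (Suc k)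
    have "partial_deriv i (\<lambda>x. f (c *\<^sub>R x)) = (\<lambda>x. c * partial_deriv i f (c *\<^sub>R x))" for i
      using partial_deriv_dilate[OF Suc.prems] by auto
    moreover have "(\<lambda>x. f (c *\<^sub>R x)) differentiable_on UNIV"
      using has_derivative_dilate[OF smooth_has_derivative[OF Suc.prems]]
      by (auto simp: differentiable_on_def differentiable_def)
    ultimately show ?case
      using C_k_mult[OF C_k_const Suc.IH[OF smooth_partial_deriv[OF Suc.prems]]] by simp
  qed
  then show ?thesis by (simp add: smooth_def)
qed

lemma test_function_iff: "test_function \<phi> \<longleftrightarrow> smooth \<phi> \<and> bounded {x. \<phi> x \<noteq> 0}"
  by (simp add: test_function_def smooth_def)

lemma test_function_mult:
  assumes "test_function \<phi>" "smooth \<psi>" shows "test_function (\<lambda>x. \<phi> x * \<psi> x)"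
  using assms bounded_subset[of "{x. \<phi> x \<noteq> 0}" "{x. \<phi> x * \<psi> x \<noteq> 0}"]
  by (auto simp: test_function_iff smooth_mult)

lemma test_function_dilate:
  assumes "test_function \<phi>" "c \<noteq> 0" shows "test_function (\<lambda>x. \<phi> (c *\<^sub>R x))"
proof -
  have "bounded ((*\<^sub>R) (inverse c) ` {x. \<phi> x \<noteq> 0})"
    using assms by (intro bounded_scaling) (auto simp: test_function_iff)
  moreover have "{x. \<phi> (c *\<^sub>R x) \<noteq> 0} \<subseteq> (*\<^sub>R) (inverse c) ` {x. \<phi> x \<noteq> 0}"
    using assms(2) by (auto simp: image_iff intro!: exI[of _ "c *\<^sub>R _"])
  ultimately show ?thesis
    using assms by (auto simp: test_function_iff smooth_dilate intro: bounded_subset)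
qed

lemma bounded_support_partial_deriv:
  assumes "bounded {x. f x \<noteq> 0}"
  shows "bounded {x. partial_deriv i f x \<noteq> 0}"
proof (rule bounded_subset)
  show "bounded (closure {x. f x \<noteq> 0})" using assms by (rule bounded_closure)
  have "partial_deriv i f x = 0" if "x \<notin> closure {x. f x \<noteq> 0}" for x
  proof -
    have "(f has_derivative (\<lambda>h. 0)) (at x)"
    proof (rule has_derivative_transform_within_open[where f="\<lambda>x. 0" and s="- closure {x. f x \<noteq> 0}"])
      show "0 = f y" if "y \<in> - closure {x. f x \<noteq> 0}" for y
        using that closure_subset[of "{x. f x \<noteq> 0}"] by auto
    qed (use that in auto)
    then show ?thesis by (simp add: partial_deriv_eqI)
  qed
  then show "{x. partial_deriv i f x \<noteq> 0} \<subseteq> closure {x. f x \<noteq> 0}" by blast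
qed

lemma test_function_partial_deriv: "test_function \<phi> \<Longrightarrow> test_function (partial_deriv i \<phi>)"
  by (simp add: test_function_iff smooth_partial_deriv bounded_support_partial_deriv)

lemma test_function_bound:
  assumes "test_function \<phi>"
  obtains B R where "B > 0" "R > 0" "\<And>x. \<bar>\<phi> x\<bar> \<le> B" "\<And>x. norm x > R \<Longrightarrow> \<phi> x = 0"
proof -
  obtain R where R: "R > 0" "\<And>x. \<phi> x \<noteq> 0 \<Longrightarrow> norm x \<le> R"
    using assms by (auto simp: test_function_iff bounded_pos)
  have "compact (\<phi> ` cball 0 R)"
    using assms by (intro compact_continuous_image smooth_continuous_on) (auto simp: test_function_iff)
  then obtain B where B: "B > 0" "\<And>x. norm x \<le> R \<Longrightarrow> \<bar>\<phi> x\<bar> \<le> B"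
    using compact_imp_bounded[of "\<phi> ` cball 0 R"] by (auto simp: bounded_pos)
  show thesis
  proof
    show "\<bar>\<phi> x\<bar> \<le> B" for x
      using B R(2)[of x] by (cases "\<phi> x = 0") auto
  qed (use B R in force)+
qed

subsection \<open>Bump functions\<close>

text \<open>
  The function \<open>exp (- c / t) / t ^ m\<close>, continued by zero, vanishes to infinite order at the
  origin. The extra power \<open>m\<close> makes the family closed under differentiation, so that smoothness
  needs one derivative formula only.
\<close>

definition flat :: "real \<Rightarrow> nat \<Rightarrow> real \<Rightarrow> real" where
  "flat c m t = (if t > 0 then exp (- (c / t)) / t ^ m else 0)"

lemma power_le_fact_exp: "0 \<le> x \<Longrightarrow> x ^ n / fact n \<le> exp (x::real)"
  using sum_le_suminf[OF summable_exp_generic[of x], of "{n}"]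
  by (simp add: exp_def divide_inverse mult.commute)

text \<open>The quadratic bound yields the derivative zero at the origin.\<close>

lemma flat_bound:
  assumes "c > 0" shows "\<bar>flat c m t\<bar> \<le> fact (m + 2) / c ^ (m + 2) * t\<^sup>2"
proof (cases "t > 0")
  case True
  have "exp (- (c / t)) \<le> fact (m + 2) / (c / t) ^ (m + 2)"
    using power_le_fact_exp[of "c / t" "m + 2"] assms True
    by (simp add: exp_minus field_simps del: fact_Suc power_Suc)
  then have "exp (- (c / t)) / t ^ m \<le> fact (m + 2) / (c / t) ^ (m + 2) / t ^ m"
    using True by (intro divide_right_mono) auto
  also have "\<dots> = fact (m + 2) / c ^ (m + 2) * t\<^sup>2"
    using True assms by (simp add: power_divide power_add power2_eq_square field_simps)
  finally show ?thesis using True by (simp add: flat_def)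
qed (use assms in \<open>auto simp: flat_def\<close>)

lemma flat_has_derivative:
  assumes "c > 0"
  shows "(flat c m has_real_derivative (c * flat c (m + 2) t - m * flat c (m + 1) t)) (at t)"
proof -
  consider "t > 0" | "t < 0" | "t = 0" by linarith
  then show ?thesis
  proof cases
    case 1
    have eq: "real m * t ^ (m - Suc 0) = m * t ^ m / t"
      using 1 by (cases m) auto
    have "((\<lambda>t. exp (- (c / t)) / t ^ m) has_real_derivative
       ((exp (- (c / t)) * (c / t\<^sup>2)) * t ^ m - exp (- (c / t)) * (real m * t ^ (m - Suc 0))) / (t ^ m * t ^ m)) (at t)"
      using 1 by (auto intro!: derivative_eq_intros simp: power2_eq_square)
    also have "((exp (- (c / t)) * (c / t\<^sup>2)) * t ^ m - exp (- (c / t)) * (real m * t ^ (m - Suc 0))) / (t ^ m * t ^ m)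
       = c * flat c (m + 2) t - m * flat c (m + 1) t"
      unfolding eq using 1 by (simp add: flat_def field_simps power2_eq_square)
    finally have "((\<lambda>t. exp (- (c / t)) / t ^ m) has_real_derivative
       (c * flat c (m + 2) t - m * flat c (m + 1) t)) (at t)" .
    then show ?thesis
      by (rule has_field_derivative_transform_within_open[of _ _ _ "{0<..}"]) (use 1 in \<open>auto simp: flat_def\<close>)
  next
    case 2
    have "((\<lambda>t. 0) has_real_derivative (c * flat c (m + 2) t - m * flat c (m + 1) t)) (at t)"
      using 2 by (simp add: flat_def)
    then show ?thesis
      by (rule has_field_derivative_transform_within_open[of _ _ _ "{..<0}"]) (use 2 in \<open>auto simp: flat_def\<close>)
  next
    case 3
    define K where "K = fact (m + 2) / c ^ (m + 2)"
    have "((\<lambda>h. flat c m h / h) \<longlongrightarrow> 0) (at 0)"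
    proof (rule Lim_null_comparison)
      have "norm (flat c m h / h) \<le> K * \<bar>h\<bar>" if "h \<noteq> 0" for h
      proof -
        have "\<bar>flat c m h\<bar> \<le> K * \<bar>h\<bar> * \<bar>h\<bar>"
          using flat_bound[OF assms, of m h] unfolding K_def[symmetric] by (simp add: power2_eq_square)
        then show ?thesis using that by (simp add: abs_divide divide_le_eq)
      qed
      then show "\<forall>\<^sub>F h in at 0. norm (flat c m h / h) \<le> K * \<bar>h\<bar>"
        by (auto simp: eventually_at_filter)
      show "((\<lambda>h. K * \<bar>h\<bar>) \<longlongrightarrow> 0) (at 0)"
        by (auto intro!: tendsto_eq_intros)
    qed
    then show ?thesis
      using 3 by (simp add: has_field_derivative_iff flat_def)
  qed
qed

lemma smooth_flat: 
  assumes "c > 0" "b \<noteq> 0" shows "smooth (\<lambda>x. flat c m (a + b * x $ i))"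
proof -
  have "C_k k (\<lambda>x. flat c m (a + b * x $ i))" for k
  proof (induction k arbitrary: m)
    case 0
    have "continuous_on UNIV (flat c m)"
      using DERIV_isCont[OF flat_has_derivative[OF assms(1)]] by (simp add: continuous_at_imp_continuous_on)
    then have "continuous_on UNIV (\<lambda>x::real^2. flat c m (a + b * x $ i))"
      by (rule continuous_on_compose2) (intro continuous_intros, simp)
    then show ?case by simp
  next
    case (Suc k)
    have "((\<lambda>t. flat c m (a + b * t)) has_real_derivative
        b * (c * flat c (m + 2) (a + b * t)) + b * (- real m * flat c (m + 1) (a + b * t))) (at t)" for t
    proof -
      have "((\<lambda>t. a + b * t) has_real_derivative b) (at t)"
        by (auto intro!: derivative_eq_intros)
      from DERIV_chain2[OF flat_has_derivative[OF assms(1)] this] show ?thesis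
        by (rule DERIV_cong) (simp add: algebra_simps)
    qed
    then show ?case
      by (rule C_k_coordinate) (intro C_k_add C_k_mult C_k_const Suc.IH)
  qed
  then show ?thesis by (simp add: smooth_def)
qed

text \<open>
  The parameter \<open>c\<close> controls the steepness at the end points: for \<open>c\<close> tending to zero the bump
  converges boundedly to the indicator function of its interval, so no mollifier is necessary to
  approximate boxes by test functions.
\<close>

definition bump :: "real \<Rightarrow> real \<Rightarrow> real \<Rightarrow> real \<Rightarrow> real" where
  "bump c a b t = flat c 0 (t - a) * flat c 0 (b - t)"

definition box_bump :: "real \<Rightarrow> real^2 \<Rightarrow> real^2 \<Rightarrow> real^2 \<Rightarrow> real" where
  "box_bump c a b x = (\<Prod>i\<in>UNIV. bump c (a $ i) (b $ i) (x $ i))"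

lemma bump_nonneg: "0 \<le> bump c a b t"
  by (simp add: bump_def flat_def)

lemma bump_le_1: "c \<ge> 0 \<Longrightarrow> bump c a b t \<le> 1"
  unfolding bump_def by (rule mult_le_one) (auto simp: flat_def)

lemma bump_pos_iff: "bump c a b t > 0 \<longleftrightarrow> a < t \<and> t < b"
  by (auto simp: bump_def flat_def zero_less_mult_iff)

lemma bump_zero: "\<not> (a < t \<and> t < b) \<Longrightarrow> bump c a b t = 0"
  by (auto simp: bump_def flat_def)

lemma smooth_bump: "c > 0 \<Longrightarrow> smooth (\<lambda>x. bump c a b (x $ i))"
  unfolding bump_def using smooth_flat[of c 1 0 "-a" i] smooth_flat[of c "-1" 0 b i]
  by (intro smooth_mult) (simp_all add: algebra_simps)

lemma test_function_box_bump:
  assumes "c > 0" shows "test_function (box_bump c a b)"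
proof -
  have "smooth (box_bump c a b)"
    unfolding box_bump_def[abs_def] smooth_def
    using smooth_bump[OF assms] by (auto intro!: C_k_prod simp: smooth_def)
  moreover have "{x. box_bump c a b x \<noteq> 0} \<subseteq> box a b"
    using bump_zero by (fastforce simp: box_bump_def mem_box_cart)
  ultimately show ?thesis
    using bounded_subset[OF bounded_box] by (auto simp: test_function_iff)
qed

lemma box_bump_bounds: "c > 0 \<Longrightarrow> \<bar>box_bump c a b x\<bar> \<le> indicator (box a b) x"
proof -
  assume c: "c > 0"
  have "0 \<le> box_bump c a b x" "box_bump c a b x \<le> 1"
    using c by (auto simp: box_bump_def bump_nonneg bump_le_1 intro!: prod_nonneg prod_le_1)
  moreover have "box_bump c a b x = 0" if "x \<notin> box a b"
    using that bump_zero by (fastforce simp: box_bump_def mem_box_cart)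
  ultimately show ?thesis by (auto simp: indicator_def)
qed

lemma box_bump_tendsto:
  "(\<lambda>n. box_bump (inverse (Suc n)) a b x) \<longlonglongrightarrow> indicator (box a b) x"
proof (cases "x \<in> box a b")
  case True
  have *: "(\<lambda>n. inverse (Suc n) / t) \<longlonglongrightarrow> 0" if "t > 0" for t :: real
    using tendsto_mult[OF LIMSEQ_inverse_real_of_nat tendsto_const[of "1/t"]] by simp
  have "(\<lambda>n. bump (inverse (Suc n)) (a $ i) (b $ i) (x $ i)) \<longlonglongrightarrow> exp (- 0) * exp (- 0)" for i
    using True unfolding bump_def flat_def mem_box_cart
    by (auto intro!: tendsto_mult tendsto_exp tendsto_minus * simp del: minus_zero of_nat_Suc)
  then have "(\<lambda>n. box_bump (inverse (Suc n)) a b x) \<longlonglongrightarrow> (\<Prod>i\<in>(UNIV::2 set). 1)"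
    unfolding box_bump_def by (intro tendsto_prod) simp
  then show ?thesis using True by simp
next
  case False
  then have "box_bump c a b x = 0" for c
    using bump_zero by (fastforce simp: box_bump_def mem_box_cart)
  then show ?thesis using False by simp
qed

section \<open>Square integrable functions and weak gradients\<close>

lemma L2_measurable [measurable_dest]: "f \<in> L2 \<Longrightarrow> f \<in> borel_measurable borel"
  by (simp add: L2_def)

lemma L2_integrable: "f \<in> L2 \<Longrightarrow> integrable lborel (\<lambda>x. (norm (f x))\<^sup>2)"
  by (simp add: L2_def)

lemma L2_AE_bound:
  assumes "f \<in> L2" "g \<in> borel_measurable borel" "AE x in lborel. norm (g x) \<le> C * norm (f x)"
  shows "g \<in> L2"
proof -
  have "AE x in lborel. (norm (g x))\<^sup>2 \<le> C\<^sup>2 * (norm (f x))\<^sup>2"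
    using assms(3)
  proof eventually_elim
    case (elim x)
    show ?case
      using power_mono[OF elim, of 2] by (simp add: power_mult_distrib)
  qed
  then have "integrable lborel (\<lambda>x. (norm (g x))\<^sup>2)"
    using assms(1,2)
    by (intro Bochner_Integration.integrable_bound[where f="\<lambda>x. C\<^sup>2 * (norm (f x))\<^sup>2" and g="\<lambda>x. (norm (g x))\<^sup>2"])
      (auto simp: L2_def)
  then show ?thesis using assms(2) by (simp add: L2_def)
qed

lemma L2_bound:
  assumes "f \<in> L2" "g \<in> borel_measurable borel" "\<And>x. norm (g x) \<le> C * norm (f x)"
  shows "g \<in> L2"
  using assms by (intro L2_AE_bound[of f g C]) auto

lemma L2_of_real: "f \<in> L2 \<Longrightarrow> (\<lambda>x. complex_of_real (f x)) \<in> L2"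
  by (rule L2_bound[where f=f and C=1]) (auto dest: L2_measurable)

lemma L2_indicator:
  assumes "A \<in> sets borel" "emeasure lborel A < \<infinity>"
  shows "(\<lambda>x. indicator A x :: real) \<in> L2"
proof -
  have "(\<lambda>x. (norm (indicator A x :: real))\<^sup>2) = indicator A"
    by (auto simp: indicator_def)
  then show ?thesis
    using assms by (simp add: L2_def borel_measurable_indicator)
qed

lemma L2_add: 
  assumes "f \<in> L2" "g \<in> L2" shows "(\<lambda>x. f x + g x) \<in> L2"
proof -
  have "(norm (f x + g x))\<^sup>2 \<le> 2 * (norm (f x))\<^sup>2 + 2 * (norm (g x))\<^sup>2" for x
  proof -
    have "(norm (f x + g x))\<^sup>2 \<le> (norm (f x) + norm (g x))\<^sup>2"
      by (intro power_mono norm_triangle_ineq) simp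
    also have "\<dots> \<le> 2 * (norm (f x))\<^sup>2 + 2 * (norm (g x))\<^sup>2"
      using sum_squares_bound[of "norm (f x)" "norm (g x)"] by (simp add: power2_sum)
    finally show ?thesis .
  qed
  then have "integrable lborel (\<lambda>x. (norm (f x + g x))\<^sup>2)"
    using assms
    by (intro Bochner_Integration.integrable_bound[where g="\<lambda>x. (norm (f x + g x))\<^sup>2"
          and f="\<lambda>x. 2 * (norm (f x))\<^sup>2 + 2 * (norm (g x))\<^sup>2"])
      (auto simp: L2_def)
  then show ?thesis using assms by (auto simp: L2_def)
qed

lemma L2_zero: "(\<lambda>x. 0) \<in> L2"
  by (simp add: L2_def)

lemma L2_cmult: "f \<in> L2 \<Longrightarrow> (\<lambda>x. c * f x :: complex) \<in> L2"
  by (rule L2_bound[where f=f and C="norm c"])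
    (auto simp: norm_mult intro!: borel_measurable_times L2_measurable)

lemma L2_diff: "f \<in> L2 \<Longrightarrow> g \<in> L2 \<Longrightarrow> (\<lambda>x. f x - g x :: complex) \<in> L2"
  using L2_add[of f "\<lambda>x. - 1 * g x"] L2_cmult[of g "-1"] by simp

lemma L2_sum: "finite I \<Longrightarrow> (\<And>i. i \<in> I \<Longrightarrow> f i \<in> L2) \<Longrightarrow> (\<lambda>x. \<Sum>i\<in>I. f i x) \<in> L2"
  by (induction I rule: finite_induct) (auto intro: L2_zero L2_add)

lemma norm_vec_square: "(norm (v :: complex^2))\<^sup>2 = (\<Sum>i\<in>UNIV. (norm (v $ i))\<^sup>2)"
  by (simp add: norm_vec_def L2_set_def sum_nonneg)

lemma measurable_vec_nth_complex:
  "F \<in> borel_measurable M \<Longrightarrow> (\<lambda>x. F x $ i :: complex) \<in> borel_measurable M"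
  by (rule borel_measurable_continuous_on[of "\<lambda>v. v $ i"])
    (auto intro: linear_continuous_on bounded_linear_vec_nth)

lemma measurable_vec_lambda_complex:
  assumes "\<And>i. (\<lambda>x. f i x) \<in> borel_measurable M"
  shows "(\<lambda>x. (\<chi> i. f i x) :: complex^2) \<in> borel_measurable M"
  using assms by (subst borel_measurable_euclidean_space) (auto simp: Basis_vec_def inner_axis)

lemma L2_vec_iff: "(F :: real^2 \<Rightarrow> complex^2) \<in> L2 \<longleftrightarrow> (\<forall>i. (\<lambda>x. F x $ i :: complex) \<in> L2)"
proof
  assume F: "F \<in> L2"
  show "\<forall>i. (\<lambda>x. F x $ i) \<in> L2"
    using L2_measurable[OF F] 
    by (intro allI L2_bound[OF F, where C=1] measurable_vec_nth_complex) (auto simp: component_le_norm_cart Finite_Cartesian_Product.norm_nth_le)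
next
  assume *: "\<forall>i. (\<lambda>x. F x $ i) \<in> L2"
  have "(\<lambda>x. F x $ i) \<in> borel_measurable borel" for i
    using * by (intro L2_measurable) simp
  then have "(\<lambda>x. \<chi> i. F x $ i) \<in> borel_measurable borel"
    by (rule measurable_vec_lambda_complex)
  then have "F \<in> borel_measurable borel" by simp
  moreover have "integrable lborel (\<lambda>x. (norm (F x))\<^sup>2)"
    unfolding norm_vec_square using * by (intro Bochner_Integration.integrable_sum L2_integrable) auto
  ultimately show "F \<in> L2" by (simp add: L2_def)
qed

lemma L2_vec_nth: "(F :: real^2 \<Rightarrow> complex^2) \<in> L2 \<Longrightarrow> (\<lambda>x. F x $ i :: complex) \<in> L2"
  by (simp add: L2_vec_iff)

lemma integrable_L2:
  fixes h :: "real^2 \<Rightarrow> 'c :: {banach, second_countable_topology}"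
  assumes "f \<in> L2" "g \<in> L2" "h \<in> borel_measurable borel" "\<And>x. norm (h x) \<le> norm (f x) * norm (g x)"
  shows "integrable lborel h"
proof (rule Bochner_Integration.integrable_bound[where g=h])
  show "integrable lborel (\<lambda>x. (norm (f x))\<^sup>2 + (norm (g x))\<^sup>2)"
    using assms by (auto simp: L2_def)
  show "AE x in lborel. norm (h x) \<le> norm ((norm (f x))\<^sup>2 + (norm (g x))\<^sup>2)"
  proof (intro AE_I2)
    fix x
    have "norm (f x) * norm (g x) \<le> (norm (f x))\<^sup>2 + (norm (g x))\<^sup>2"
    proof -
      have "2 * (norm (f x) * norm (g x)) \<le> (norm (f x))\<^sup>2 + (norm (g x))\<^sup>2"
        using sum_squares_bound[of "norm (f x)" "norm (g x)"] by (simp add: mult.assoc)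
      then show ?thesis
        using mult_nonneg_nonneg[OF norm_ge_zero[of "f x"] norm_ge_zero[of "g x"]] by linarith
    qed
    then show "norm (h x) \<le> norm ((norm (f x))\<^sup>2 + (norm (g x))\<^sup>2)"
      using assms(4)[of x] by simp
  qed
qed (use assms(3) in simp)

lemma borel_measurable_cnj [measurable (raw)]:
  "f \<in> borel_measurable M \<Longrightarrow> (\<lambda>x. cnj (f x)) \<in> borel_measurable M"
  by (rule borel_measurable_continuous_on[of cnj]) (auto intro: continuous_intros)

lemma integrable_cnj_mult: "f \<in> L2 \<Longrightarrow> g \<in> L2 \<Longrightarrow> integrable lborel (\<lambda>x. cnj (f x) * g x)"
  by (rule integrable_L2[where f=f and g=g]) (auto simp: norm_mult intro!: borel_measurable_times borel_measurable_cnj L2_measurable)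

lemma integrable_scaleR_L2: "f \<in> L2 \<Longrightarrow> g \<in> L2 \<Longrightarrow> integrable lborel (\<lambda>x. f x *\<^sub>R g x)"
  by (rule integrable_L2[where f=f and g=g]) (auto intro!: borel_measurable_scaleR L2_measurable)

subsection \<open>Hermitian products\<close>

lemma herm_cnj: "cnj (herm f g) = herm g f"
proof -
  have "herm g f = (\<integral>x. cnj (cnj (f x) * g x) \<partial>lborel)"
    by (simp add: herm_def mult.commute del: Bochner_Integration.integral_cnj)
  then show ?thesis by (simp only: Bochner_Integration.integral_cnj herm_def)
qed

lemma herm_add_right: "f \<in> L2 \<Longrightarrow> g \<in> L2 \<Longrightarrow> h \<in> L2 \<Longrightarrow> herm f (\<lambda>x. g x + h x) = herm f g + herm f h"
  by (simp add: herm_def ring_distribs integrable_cnj_mult)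

lemma herm_add_left: "f \<in> L2 \<Longrightarrow> g \<in> L2 \<Longrightarrow> h \<in> L2 \<Longrightarrow> herm (\<lambda>x. f x + g x) h = herm f h + herm g h"
  by (simp add: herm_def ring_distribs integrable_cnj_mult)

lemma herm_cmult_right: "herm f (\<lambda>x. c * g x) = c * herm f g"
proof -
  have "(\<lambda>x. cnj (f x) * (c * g x)) = (\<lambda>x. c * (cnj (f x) * g x))" by (auto simp: mult_ac)
  then show ?thesis by (simp add: herm_def)
qed

lemma herm_cmult_left: "herm (\<lambda>x. c * f x) g = cnj c * herm f g"
  by (metis herm_cmult_right herm_cnj complex_cnj_mult)

lemma herm_diff_right: "f \<in> L2 \<Longrightarrow> g \<in> L2 \<Longrightarrow> h \<in> L2 \<Longrightarrow> herm f (\<lambda>x. g x - h x) = herm f g - herm f h"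
  by (simp add: herm_def ring_distribs integrable_cnj_mult)

lemma herm_sum_left: "finite I \<Longrightarrow> (\<And>i. i \<in> I \<Longrightarrow> f i \<in> L2) \<Longrightarrow> g \<in> L2 \<Longrightarrow>
  herm (\<lambda>x. \<Sum>i\<in>I. f i x) g = (\<Sum>i\<in>I. herm (f i) g)"
  by (induction I rule: finite_induct) (auto simp: herm_add_left L2_sum herm_def[of "\<lambda>x. 0"])

lemma herm_sum_right: "finite I \<Longrightarrow> (\<And>i. i \<in> I \<Longrightarrow> f i \<in> L2) \<Longrightarrow> g \<in> L2 \<Longrightarrow>
  herm g (\<lambda>x. \<Sum>i\<in>I. f i x) = (\<Sum>i\<in>I. herm g (f i))"
  by (induction I rule: finite_induct) (auto simp: herm_add_right L2_sum herm_def[of _ "\<lambda>x. 0"])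

lemma herm_zero_right [simp]: "herm g (\<lambda>x. 0) = 0"
  by (simp add: herm_def)

lemma herm_self: "herm f f = of_real (\<integral>x. (norm (f x))\<^sup>2 \<partial>lborel)"
proof -
  have "cnj (f x) * f x = of_real ((norm (f x))\<^sup>2)" for x
    using complex_norm_square[of "f x"] by (simp add: mult.commute)
  then show ?thesis by (simp only: herm_def integral_complex_of_real)
qed

lemma herm_cong_AE:
  assumes "AE x in lborel. f x = f' x" "AE x in lborel. g x = g' x"
    "f \<in> borel_measurable borel" "g \<in> borel_measurable borel" "f' \<in> borel_measurable borel" "g' \<in> borel_measurable borel"
  shows "herm f g = herm f' g'"
  unfolding herm_def using assms by (intro integral_cong_AE borel_measurable_times borel_measurable_cnj) auto

lemma herm_self_eq_0:
  assumes "f \<in> L2" "herm f f = 0" shows "AE x in lborel. f x = 0"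
proof -
  have "(\<integral>x. (norm (f x))\<^sup>2 \<partial>lborel) = 0"
    using assms(2) by (simp add: herm_self)
  then have "AE x in lborel. (norm (f x))\<^sup>2 = 0"
    using integral_nonneg_eq_0_iff_AE[OF L2_integrable[OF assms(1)]] by simp
  then show ?thesis by eventually_elim simp
qed

text \<open>
  The Cauchy-Schwarz inequality, in the form given by the weighted inequality between arithmetic and
  geometric mean. Every application chooses \<open>\<epsilon>\<close> explicitly.
\<close>

lemma herm_bound:
  assumes "f \<in> L2" "g \<in> L2" "\<epsilon> > 0"
  shows "cmod (herm f g) \<le> (\<epsilon> * Re (herm f f) + Re (herm g g) / \<epsilon>) / 2"
proof -
  have "cmod (herm f g) \<le> (\<integral>x. norm (cnj (f x) * g x) \<partial>lborel)"
    unfolding herm_def by (rule integral_norm_bound)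
  also have "\<dots> \<le> (\<integral>x. (\<epsilon> * (norm (f x))\<^sup>2 + (norm (g x))\<^sup>2 / \<epsilon>) / 2 \<partial>lborel)"
  proof (rule integral_mono)
    show "integrable lborel (\<lambda>x. norm (cnj (f x) * g x))"
      using integrable_cnj_mult[OF assms(1,2)] by (rule integrable_norm)
    show "integrable lborel (\<lambda>x. (\<epsilon> * (norm (f x))\<^sup>2 + (norm (g x))\<^sup>2 / \<epsilon>) / 2)"
      using L2_integrable[OF assms(1)] L2_integrable[OF assms(2)] by simp
    fix x
    have "0 \<le> (\<epsilon> * norm (f x) - norm (g x))\<^sup>2 / \<epsilon>"
      using assms by simp
    also have "\<dots> = \<epsilon> * (norm (f x))\<^sup>2 + (norm (g x))\<^sup>2 / \<epsilon> - 2 * (norm (f x) * norm (g x))"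
      using assms(3) by (simp add: power2_eq_square field_simps)
    finally show "norm (cnj (f x) * g x) \<le> (\<epsilon> * (norm (f x))\<^sup>2 + (norm (g x))\<^sup>2 / \<epsilon>) / 2"
      by (simp add: norm_mult)
  qed
  also have "\<dots> = (\<epsilon> * Re (herm f f) + Re (herm g g) / \<epsilon>) / 2"
    using assms by (simp add: herm_self L2_integrable)
  finally show ?thesis .
qed

lemma herm_vec_cnj: "cnj (herm_vec F G) = herm_vec G F"
  by (simp add: herm_vec_def herm_cnj)

lemma herm_vec_add_right: "F \<in> L2 \<Longrightarrow> G \<in> L2 \<Longrightarrow> H \<in> L2 \<Longrightarrow>
    herm_vec F (\<lambda>x. G x + H x) = herm_vec F G + herm_vec F H"
  by (simp add: herm_vec_def herm_add_right L2_vec_nth sum.distrib)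

lemma herm_vec_cmult_right: "herm_vec F (\<lambda>x. c *s G x) = c * herm_vec F G"
  by (simp add: herm_vec_def herm_cmult_right sum_distrib_left)

lemma herm_vec_zero_right [simp]: "herm_vec F (\<lambda>x. 0) = 0"
  by (simp add: herm_vec_def)

lemma herm_vec_add_left: "F \<in> L2 \<Longrightarrow> G \<in> L2 \<Longrightarrow> H \<in> L2 \<Longrightarrow>
    herm_vec (\<lambda>x. F x + G x) H = herm_vec F H + herm_vec G H"
  by (simp add: herm_vec_def herm_add_left L2_vec_nth sum.distrib)

lemma herm_vec_cmult_left: "herm_vec (\<lambda>x. c *s F x) G = cnj c * herm_vec F G"
  by (simp add: herm_vec_def herm_cmult_left sum_distrib_left)

lemma herm_vec_cong_AE:
  assumes "AE x in lborel. F x = F' x" "AE x in lborel. G x = G' x" "F \<in> L2" "G \<in> L2" "F' \<in> L2" "G' \<in> L2"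
  shows "herm_vec F G = herm_vec F' G'"
  unfolding herm_vec_def
proof (intro sum.cong refl herm_cong_AE)
  fix i
  show "AE x in lborel. F x $ i = F' x $ i" using assms(1) by eventually_elim simp
  show "AE x in lborel. G x $ i = G' x $ i" using assms(2) by eventually_elim simp
qed (use assms in \<open>auto intro!: measurable_vec_nth_complex dest: L2_measurable\<close>)

lemma herm_vec_self: 
  assumes "F \<in> L2" shows "herm_vec F F = of_real ((L2_norm F)\<^sup>2)"
proof -
  have "(L2_norm F)\<^sup>2 = (\<integral>x. (\<Sum>i\<in>UNIV. (norm (F x $ i))\<^sup>2) \<partial>lborel)"
    by (simp add: L2_norm_def norm_vec_square sum_nonneg)
  also have "\<dots> = (\<Sum>i\<in>UNIV. \<integral>x. (norm (F x $ i))\<^sup>2 \<partial>lborel)"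
    using assms by (intro Bochner_Integration.integral_sum L2_integrable L2_vec_nth)
  finally show ?thesis by (simp add: herm_vec_def herm_self)
qed

lemma herm_vec_bound:
  assumes "F \<in> L2" "G \<in> L2" "\<epsilon> > 0"
  shows "cmod (herm_vec F G) \<le> (\<epsilon> * Re (herm_vec F F) + Re (herm_vec G G) / \<epsilon>) / 2"
proof -
  have "cmod (herm_vec F G) \<le> (\<Sum>i\<in>UNIV. cmod (herm (\<lambda>x. F x $ i) (\<lambda>x. G x $ i)))"
    unfolding herm_vec_def by (rule norm_sum)
  also have "\<dots> \<le> (\<Sum>i\<in>UNIV. (\<epsilon> * Re (herm (\<lambda>x. F x $ i) (\<lambda>x. F x $ i)) + Re (herm (\<lambda>x. G x $ i) (\<lambda>x. G x $ i)) / \<epsilon>) / 2)"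
    using assms by (intro sum_mono herm_bound L2_vec_nth)
  also have "\<dots> = (\<epsilon> * Re (herm_vec F F) + Re (herm_vec G G) / \<epsilon>) / 2"
    by (simp add: herm_vec_def sum.distrib sum_distrib_left sum_divide_distrib add_divide_distrib)
  finally show ?thesis .
qed

subsection \<open>Integrals of test functions\<close>

lemma test_function_L2: 
  assumes "test_function \<phi>" shows "\<phi> \<in> L2"
proof -
  obtain B R where B: "B > 0" "R > 0" "\<And>x. \<bar>\<phi> x\<bar> \<le> B" "\<And>x. norm x > R \<Longrightarrow> \<phi> x = 0"
    using test_function_bound[OF assms] by blast
  have m: "\<phi> \<in> borel_measurable borel"
    using assms by (auto simp: test_function_iff intro: smooth_measurable)
  have "(\<lambda>x. indicator (cball 0 R) x :: real) \<in> L2"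
    by (intro L2_indicator emeasure_compact_finite) auto
  then show ?thesis
    by (rule L2_bound[where C=B]) (use B m in \<open>auto simp: indicator_def\<close>)
qed

lemma test_function_integrable:
  assumes "test_function \<phi>" shows "integrable lborel \<phi>"
proof -
  obtain B R where B: "B > 0" "R > 0" "\<And>x. \<bar>\<phi> x\<bar> \<le> B" "\<And>x. norm x > R \<Longrightarrow> \<phi> x = 0"
    using test_function_bound[OF assms] by blast
  have "integrable lborel (\<lambda>x. B * indicator (cball (0::real^2) R) x)"
    using emeasure_compact_finite[of "cball (0::real^2) R"] by (intro integrable_mult_right) simp
  then show ?thesis
    by (rule Bochner_Integration.integrable_bound)
      (use assms B in \<open>auto simp: test_function_iff indicator_def intro: smooth_measurable\<close>)
qed

lemma lborel_integral_translate:
  fixes f :: "real^2 \<Rightarrow> real"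
  assumes "f \<in> borel_measurable borel"
  shows "(\<integral>x. f (c + x) \<partial>lborel) = (\<integral>x. f x \<partial>lborel)"
proof -
  have "(\<integral>x. f x \<partial>lborel) = (\<integral>x. f x \<partial>(distr lborel borel ((+) c)))"
    by (simp add: lborel_distr_plus)
  also have "\<dots> = (\<integral>x. f (c + x) \<partial>lborel)"
    using assms by (intro integral_distr) auto
  finally show ?thesis by simp
qed

lemma line_derivative:
  assumes "smooth g"
  shows "((\<lambda>t. g (x + t *\<^sub>R axis i 1)) has_real_derivative partial_deriv i g (x + t *\<^sub>R axis i 1)) (at t)"
proof -
  define D where "D = frechet_derivative g (at (x + t *\<^sub>R axis i 1))"
  have *: "(g has_derivative D) (at (x + t *\<^sub>R axis i 1))"
    unfolding D_def by (rule smooth_has_derivative[OF assms])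
  have "((\<lambda>t. g (x + t *\<^sub>R axis i 1)) has_derivative (\<lambda>h. D (h *\<^sub>R axis i 1))) (at t)"
    by (rule has_derivative_compose[where f="\<lambda>t. x + t *\<^sub>R axis i 1" and g=g, OF _ *]) (auto intro!: derivative_eq_intros)
  moreover have "(\<lambda>h. D (h *\<^sub>R axis i 1)) = (*) (partial_deriv i g (x + t *\<^sub>R axis i 1))"
    using linear_scale[OF has_derivative_linear[OF *]] by (auto simp: partial_deriv_def D_def)
  ultimately show ?thesis by (simp add: has_field_derivative_def)
qed

text \<open>
  Difference quotients have integral zero by translation invariance, and they converge boundedly to
  the derivative; this avoids iterated integrals over the coordinates.
\<close>

lemma integral_partial_deriv_test:
  assumes "test_function g"
  shows "(\<integral>x. partial_deriv i g x \<partial>lborel) = 0"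
proof -
  have g: "smooth g" using assms by (simp add: test_function_iff)
  obtain B R where B: "B > 0" "R > 0" "\<And>x. \<bar>partial_deriv i g x\<bar> \<le> B" "\<And>x. norm x > R \<Longrightarrow> partial_deriv i g x = 0"
    using test_function_bound[OF test_function_partial_deriv[OF assms]] by blast
  define h :: "nat \<Rightarrow> real" where "h n = inverse (Suc n)" for n
  have h: "0 < h n" "h n \<le> 1" for n by (auto simp: h_def inverse_le_1_iff simp del: of_nat_Suc)
  define e :: "real^2" where "e = axis i 1"
  define d where "d n x = (g (h n *\<^sub>R e + x) - g x) / h n" for n x
  have gm: "g \<in> borel_measurable borel" using g by (rule smooth_measurable)
  have "(\<lambda>n. \<integral>x. d n x \<partial>lborel) \<longlonglongrightarrow> (\<integral>x. partial_deriv i g x \<partial>lborel)"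
  proof (rule integral_dominated_convergence)
    show "integrable lborel (\<lambda>x. B * indicator (cball (0::real^2) (R + 1)) x)"
      using emeasure_compact_finite[of "cball (0::real^2) (R + 1)"] by (intro integrable_mult_right) simp
    show "AE x in lborel. (\<lambda>n. d n x) \<longlonglongrightarrow> partial_deriv i g x"
    proof (intro AE_I2)
      fix x
      have "((\<lambda>t. (g (x + t *\<^sub>R e) - g (x + 0 *\<^sub>R e)) / (t - 0)) \<longlongrightarrow> partial_deriv i g (x + 0 *\<^sub>R e)) (at 0)"
        using line_derivative[OF g, of x i 0] unfolding has_field_derivative_iff e_def by simp
      moreover have "filterlim h (at 0) sequentially"
        unfolding filterlim_at using LIMSEQ_inverse_real_of_nat h(1)
        by (auto simp: h_def[abs_def] simp del: of_nat_Suc intro!: always_eventually)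
      ultimately have "(\<lambda>n. (g (x + h n *\<^sub>R e) - g (x + 0 *\<^sub>R e)) / (h n - 0)) \<longlonglongrightarrow> partial_deriv i g (x + 0 *\<^sub>R e)"
        by (rule filterlim_compose)
      then show "(\<lambda>n. d n x) \<longlonglongrightarrow> partial_deriv i g x"
        by (simp add: d_def add.commute)
    qed
    show "AE x in lborel. norm (d n x) \<le> B * indicator (cball 0 (R + 1)) x" for n
    proof (intro AE_I2)
      fix x
      obtain z where z: "0 < z" "z < h n"
        "g (x + h n *\<^sub>R e) - g (x + 0 *\<^sub>R e) = (h n - 0) * partial_deriv i g (x + z *\<^sub>R e)"
        using MVT2[of 0 "h n", OF h(1), of "\<lambda>t. g (x + t *\<^sub>R e)" "\<lambda>t. partial_deriv i g (x + t *\<^sub>R e)"]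
          line_derivative[OF g] unfolding e_def by blast
      then have d: "d n x = partial_deriv i g (x + z *\<^sub>R e)"
        using h(1)[of n] by (simp add: d_def add.commute)
      have "norm x \<le> norm (x + z *\<^sub>R e) + norm (- (z *\<^sub>R e))"
        using norm_triangle_ineq[of "x + z *\<^sub>R e" "- (z *\<^sub>R e)"] by simp
      also have "norm (- (z *\<^sub>R e)) \<le> 1"
        using z h(2)[of n] by (simp add: e_def)
      finally have "norm (x + z *\<^sub>R e) > R" if "norm x > R + 1"
        using that by simp
      then show "norm (d n x) \<le> B * indicator (cball 0 (R + 1)) x"
        unfolding d using B(3)[of "x + z *\<^sub>R e"] B(4)[of "x + z *\<^sub>R e"] by (auto simp: indicator_def)
    qed
    show "partial_deriv i g \<in> borel_measurable lborel"
      using smooth_measurable[OF smooth_partial_deriv[OF g]] by simp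
    show "d n \<in> borel_measurable lborel" for n
      unfolding d_def using gm by measurable
  qed
  moreover have "(\<integral>x. d n x \<partial>lborel) = 0" for n
  proof -
    have "integrable lborel (\<lambda>x. g (h n *\<^sub>R e + x))"
    proof -
      have "integrable (distr lborel borel ((+) (h n *\<^sub>R e))) g"
        using test_function_integrable[OF assms] by (simp add: lborel_distr_plus)
      then show ?thesis
        using gm by (subst (asm) integrable_distr_eq) auto
    qed
    then show ?thesis
      unfolding d_def using test_function_integrable[OF assms] lborel_integral_translate[OF gm] by simp
  qed
  ultimately show ?thesis
    by (simp add: LIMSEQ_const_iff)
qed

lemma integral_by_parts_test:
  assumes "test_function \<phi>" "smooth \<psi>"
  shows "(\<integral>x. partial_deriv i \<phi> x * \<psi> x \<partial>lborel) = - (\<integral>x. \<phi> x * partial_deriv i \<psi> x \<partial>lborel)"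
proof -
  have \<phi>: "smooth \<phi>" using assms by (simp add: test_function_iff)
  have "0 = (\<integral>x. partial_deriv i (\<lambda>x. \<phi> x * \<psi> x) x \<partial>lborel)"
    by (simp add: integral_partial_deriv_test test_function_mult assms)
  also have "\<dots> = (\<integral>x. \<phi> x * partial_deriv i \<psi> x + partial_deriv i \<phi> x * \<psi> x \<partial>lborel)"
    by (simp add: partial_deriv_mult \<phi> assms)
  also have "\<dots> = (\<integral>x. \<phi> x * partial_deriv i \<psi> x \<partial>lborel) + (\<integral>x. partial_deriv i \<phi> x * \<psi> x \<partial>lborel)"
    by (intro Bochner_Integration.integral_add test_function_integrable test_function_mult assms
        smooth_partial_deriv test_function_partial_deriv)
  finally show ?thesis by simp
qed

subsection \<open>Weak gradients\<close>

lemma has_weak_gradD: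
  "has_weak_grad f F \<Longrightarrow> test_function \<phi> \<Longrightarrow>
    (\<integral>x. partial_deriv i \<phi> x *\<^sub>R f x \<partial>lborel) = - (\<integral>x. \<phi> x *\<^sub>R (F x $ i) \<partial>lborel)"
  by (simp add: has_weak_grad_def)

lemma has_weak_grad_add:
  assumes "has_weak_grad f F" "has_weak_grad g G" "f \<in> L2" "g \<in> L2" "F \<in> L2" "G \<in> L2"
  shows "has_weak_grad (\<lambda>x. f x + g x) (\<lambda>x. F x + G x)"
  unfolding has_weak_grad_def
  using assms by (auto simp: scaleR_add_right integrable_scaleR_L2 test_function_L2 test_function_partial_deriv
      L2_vec_nth has_weak_gradD)

lemma has_weak_grad_cmult:
  assumes "has_weak_grad f F"
  shows "has_weak_grad (\<lambda>x. c * f x) (\<lambda>x. c *s F x)"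
  unfolding has_weak_grad_def
  using has_weak_gradD[OF assms] by (auto simp flip: mult_scaleR_right)

text \<open>
  The Gaussians used later do not have compact support. Multiplication with the cutoffs
  \<open>\<kappa> (h x)\<close>, whose gradients are of order \<open>h\<close>, extends the defining identity of the weak
  gradient to every smooth square integrable function with square integrable derivative.
\<close>

lemma weak_grad_square_integrable_test:
  assumes "has_weak_grad f F" "f \<in> L2" "F \<in> L2" "smooth \<psi>" "\<psi> \<in> L2" "partial_deriv i \<psi> \<in> L2"
  shows "(\<integral>x. partial_deriv i \<psi> x *\<^sub>R f x \<partial>lborel) = - (\<integral>x. \<psi> x *\<^sub>R (F x $ i) \<partial>lborel)"
proof -
  define \<kappa> where "\<kappa> = box_bump 1 (vec (-1)) (vec 1)"
  have \<kappa>: "test_function \<kappa>" unfolding \<kappa>_def by (rule test_function_box_bump) simp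
  have \<kappa>0: "\<kappa> 0 > 0"
    unfolding \<kappa>_def box_bump_def using bump_pos_iff[of 1 "-1" 1 0] by (simp add: prod_pos)
  obtain B where B: "B > 0" "\<And>x. \<bar>\<kappa> x\<bar> \<le> B"
    by (rule test_function_bound[OF \<kappa>]) auto
  obtain B' where B': "B' > 0" "\<And>x. \<bar>partial_deriv i \<kappa> x\<bar> \<le> B'"
    by (rule test_function_bound[OF test_function_partial_deriv[OF \<kappa>]]) auto
  define h :: "nat \<Rightarrow> real" where "h n = inverse (Suc n)" for n
  have h: "0 < h n" "h n \<le> 1" for n by (auto simp: h_def inverse_le_1_iff simp del: of_nat_Suc)
  have h0: "h \<longlonglongrightarrow> 0" using LIMSEQ_inverse_real_of_nat by (simp add: h_def[abs_def])
  have s\<kappa>: "smooth \<kappa>" using \<kappa> by (simp add: test_function_iff)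
  have m [measurable]: "f \<in> borel_measurable borel" "(\<lambda>x. F x $ i) \<in> borel_measurable borel"
    "\<psi> \<in> borel_measurable borel" "partial_deriv i \<psi> \<in> borel_measurable borel"
    "\<kappa> \<in> borel_measurable borel" "partial_deriv i \<kappa> \<in> borel_measurable borel"
    using assms s\<kappa> by (auto intro: L2_measurable measurable_vec_nth_complex smooth_measurable smooth_partial_deriv)
  have lim\<kappa>: "(\<lambda>n. \<kappa> (h n *\<^sub>R x)) \<longlonglongrightarrow> \<kappa> 0" for x
  proof -
    have "isCont \<kappa> 0" using smooth_continuous_on[OF s\<kappa>, of UNIV] by (simp add: continuous_on_eq_continuous_at)
    moreover have "(\<lambda>n. h n *\<^sub>R x) \<longlonglongrightarrow> 0 *\<^sub>R x" by (intro tendsto_intros h0)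
    ultimately show ?thesis using isCont_tendsto_compose by fastforce
  qed
  define d where
    "d n x = \<kappa> (h n *\<^sub>R x) * partial_deriv i \<psi> x + h n * partial_deriv i \<kappa> (h n *\<^sub>R x) * \<psi> x" for n x
  have dm [measurable]: "d n \<in> borel_measurable borel" for n unfolding d_def[abs_def] by measurable
  have pd: "partial_deriv i (\<lambda>x. \<kappa> (h n *\<^sub>R x) * \<psi> x) x = d n x" for n x
    unfolding d_def using partial_deriv_mult[OF smooth_dilate[OF s\<kappa>] assms(4)] partial_deriv_dilate[OF s\<kappa>] by simp
  have 1: "(\<lambda>n. \<integral>x. partial_deriv i (\<lambda>x. \<kappa> (h n *\<^sub>R x) * \<psi> x) x *\<^sub>R f x \<partial>lborel)
      \<longlonglongrightarrow> (\<integral>x. (\<kappa> 0 * partial_deriv i \<psi> x) *\<^sub>R f x \<partial>lborel)"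
    unfolding pd
  proof (rule integral_dominated_convergence)
    show "integrable lborel (\<lambda>x. B * norm (partial_deriv i \<psi> x *\<^sub>R f x) + B' * norm (\<psi> x *\<^sub>R f x))"
      using integrable_scaleR_L2[OF assms(6,2)] integrable_scaleR_L2[OF assms(5,2)]
      by (intro Bochner_Integration.integrable_add integrable_mult_right integrable_norm)
    show "AE x in lborel. (\<lambda>n. d n x *\<^sub>R f x) \<longlonglongrightarrow> (\<kappa> 0 * partial_deriv i \<psi> x) *\<^sub>R f x"
    proof (intro AE_I2)
      fix x
      have "(\<lambda>n. h n * partial_deriv i \<kappa> (h n *\<^sub>R x)) \<longlonglongrightarrow> 0"
      proof (rule Lim_null_comparison)
        show "\<forall>\<^sub>F n in sequentially. norm (h n * partial_deriv i \<kappa> (h n *\<^sub>R x)) \<le> B' * h n"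
          using B'(2) h(1) by (intro always_eventually) (auto simp: abs_mult less_imp_le mult.commute intro!: mult_left_mono)
        show "(\<lambda>n. B' * h n) \<longlonglongrightarrow> 0" using tendsto_mult_left[OF h0, of B'] by simp
      qed
      then have "(\<lambda>n. d n x *\<^sub>R f x) \<longlonglongrightarrow> (\<kappa> 0 * partial_deriv i \<psi> x + 0 * \<psi> x) *\<^sub>R f x"
        unfolding d_def by (intro tendsto_intros lim\<kappa>)
      then show "(\<lambda>n. d n x *\<^sub>R f x) \<longlonglongrightarrow> (\<kappa> 0 * partial_deriv i \<psi> x) *\<^sub>R f x"
        by simp
    qed
    show "AE x in lborel. norm (d n x *\<^sub>R f x)
        \<le> B * norm (partial_deriv i \<psi> x *\<^sub>R f x) + B' * norm (\<psi> x *\<^sub>R f x)" for n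
    proof (intro AE_I2)
      fix x
      have "\<bar>h n * partial_deriv i \<kappa> (h n *\<^sub>R x)\<bar> \<le> 1 * B'"
        unfolding abs_mult using h[of n] B' by (intro mult_mono) (auto simp: less_imp_le)
      then have "\<bar>d n x\<bar> \<le> B * \<bar>partial_deriv i \<psi> x\<bar> + B' * \<bar>\<psi> x\<bar>"
        unfolding d_def using B(2)
        by (intro order_trans[OF abs_triangle_ineq] add_mono) (auto simp: abs_mult intro!: mult_right_mono)
      from mult_right_mono[OF this, of "norm (f x)"]
      show "norm (d n x *\<^sub>R f x)
        \<le> B * norm (partial_deriv i \<psi> x *\<^sub>R f x) + B' * norm (\<psi> x *\<^sub>R f x)"
        by (simp only: norm_scaleR distrib_right mult.assoc real_norm_def norm_ge_zero simp_thms)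
    qed
  qed measurable
  have 2: "(\<lambda>n. \<integral>x. (\<kappa> (h n *\<^sub>R x) * \<psi> x) *\<^sub>R (F x $ i) \<partial>lborel)
      \<longlonglongrightarrow> (\<integral>x. (\<kappa> 0 * \<psi> x) *\<^sub>R (F x $ i) \<partial>lborel)"
  proof (rule integral_dominated_convergence)
    show "integrable lborel (\<lambda>x. B * norm (\<psi> x *\<^sub>R (F x $ i)))"
      using integrable_scaleR_L2[OF assms(5) L2_vec_nth[OF assms(3)]]
      by (intro integrable_mult_right integrable_norm)
    show "AE x in lborel. (\<lambda>n. (\<kappa> (h n *\<^sub>R x) * \<psi> x) *\<^sub>R (F x $ i)) \<longlonglongrightarrow> (\<kappa> 0 * \<psi> x) *\<^sub>R (F x $ i)"
      by (intro AE_I2 tendsto_intros lim\<kappa>)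
    show "AE x in lborel. norm ((\<kappa> (h n *\<^sub>R x) * \<psi> x) *\<^sub>R (F x $ i)) \<le> B * norm (\<psi> x *\<^sub>R (F x $ i))" for n
      using B(2) by (intro AE_I2) (auto simp: abs_mult mult.assoc intro!: mult_right_mono)
  qed measurable
  have "(\<integral>x. partial_deriv i (\<lambda>x. \<kappa> (h n *\<^sub>R x) * \<psi> x) x *\<^sub>R f x \<partial>lborel)
      = - (\<integral>x. (\<kappa> (h n *\<^sub>R x) * \<psi> x) *\<^sub>R (F x $ i) \<partial>lborel)" for n
    using h(1)[of n] by (intro has_weak_gradD assms(1) test_function_mult test_function_dilate \<kappa> assms(4)) simp
  then have "(\<integral>x. (\<kappa> 0 * partial_deriv i \<psi> x) *\<^sub>R f x \<partial>lborel) = - (\<integral>x. (\<kappa> 0 * \<psi> x) *\<^sub>R (F x $ i) \<partial>lborel)"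
    using LIMSEQ_unique[OF 1] tendsto_minus[OF 2] by simp
  then have "\<kappa> 0 *\<^sub>R (\<integral>x. partial_deriv i \<psi> x *\<^sub>R f x \<partial>lborel) = \<kappa> 0 *\<^sub>R (- (\<integral>x. \<psi> x *\<^sub>R (F x $ i) \<partial>lborel))"
    by (simp flip: scaleR_scaleR)
  then show ?thesis using \<kappa>0 by (simp add: scaleR_cancel_left del: scaleR_minus_right)
qed

subsection \<open>The fundamental lemma of the calculus of variations\<close>

lemma integral_box_zero:
  fixes f :: "real^2 \<Rightarrow> complex"
  assumes "f \<in> L2" "\<And>c. c > 0 \<Longrightarrow> (\<integral>x. box_bump c a b x *\<^sub>R f x \<partial>lborel) = 0"
  shows "(\<integral>x. indicator (box a b) x *\<^sub>R f x \<partial>lborel) = 0"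
proof -
  have [measurable]: "f \<in> borel_measurable borel" using assms by (simp add: L2_measurable)
  have [measurable]: "box_bump (inverse (Suc n)) a b \<in> borel_measurable borel" for n
    using L2_measurable[OF test_function_L2[OF test_function_box_bump]] by simp
  have ind: "(\<lambda>x. indicator (box a b) x :: real) \<in> L2"
    by (intro L2_indicator emeasure_lborel_box_finite) simp
  have "(\<lambda>n. \<integral>x. box_bump (inverse (Suc n)) a b x *\<^sub>R f x \<partial>lborel)
      \<longlonglongrightarrow> (\<integral>x. indicator (box a b) x *\<^sub>R f x \<partial>lborel)"
  proof (rule integral_dominated_convergence)
    show "integrable lborel (\<lambda>x. norm (indicator (box a b) x *\<^sub>R f x))"
      by (intro integrable_norm integrable_scaleR_L2 assms ind)
    show "AE x in lborel. (\<lambda>n. box_bump (inverse (Suc n)) a b x *\<^sub>R f x) \<longlonglongrightarrow> indicator (box a b) x *\<^sub>R f x"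
      by (intro AE_I2 tendsto_intros box_bump_tendsto)
    show "AE x in lborel. norm (box_bump (inverse (Suc n)) a b x *\<^sub>R f x) \<le> norm (indicator (box a b) x *\<^sub>R f x)" for n
      using box_bump_bounds[of "inverse (Suc n)" a b]
      by (intro AE_I2) (auto intro!: mult_right_mono)
  qed measurable
  then show ?thesis
    using assms(2) by (simp add: LIMSEQ_const_iff)
qed

text \<open>
  Boxes are stable under intersection and generate the Borel sets, and the sets over which a fixed
  integrable function has integral zero form a Dynkin system.
\<close>

lemma AE_zero_if_box_integrals_zero:
  fixes f :: "real^2 \<Rightarrow> complex"
  assumes "f \<in> L2" "\<And>a b. (\<integral>x. indicator (box a b) x *\<^sub>R f x \<partial>lborel) = 0"
  shows "AE x in lborel. f x = 0"
proof -
  have [measurable]: "f \<in> borel_measurable borel" using assms by (simp add: L2_measurable)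
  define B :: "nat \<Rightarrow> (real^2) set" where "B n = box (- (real n *\<^sub>R One)) (real n *\<^sub>R One)" for n
  have [measurable]: "B n \<in> sets borel" for n by (simp add: B_def)
  \<comment> \<open>A square integrable function need not be integrable, hence the truncation to bounded boxes.\<close>
  have int: "integrable lborel (\<lambda>x. indicator (B n) x *\<^sub>R f x)" for n
    unfolding B_def
    by (intro integrable_scaleR_L2[OF _ assms(1)] L2_indicator emeasure_lborel_box_finite) simp
  have "AE x in lborel. indicator (B n) x *\<^sub>R f x = 0" for n
  proof (rule sigma_finite_measure.density_unique_banach[OF lborel.sigma_finite_measure_axioms int])
    fix A :: "(real^2) set" assume "A \<in> sets lborel"
    then have A: "A \<in> sigma_sets UNIV (range (\<lambda>(a, b). box a b))"
      by (simp add: borel_eq_box)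
    have "Int_stable (range (\<lambda>(a, b). box a b :: (real^2) set))"
      by (auto simp: Int_stable_def box_Int_box)
    moreover have "range (\<lambda>(a, b). box a b :: (real^2) set) \<subseteq> Pow UNIV" by simp
    ultimately have "(\<integral>x. indicator A x *\<^sub>R (indicator (B n) x *\<^sub>R f x) \<partial>lborel) = 0"
      using A
    proof (induction A rule: sigma_sets_induct_disjoint)
      case (basic A)
      then obtain a b where A: "A = box a b" by auto
      obtain c d where "A \<inter> B n = box c d"
        unfolding A B_def box_Int_box by blast
      then have "(\<lambda>x. indicator A x *\<^sub>R (indicator (B n) x *\<^sub>R f x)) = (\<lambda>x. indicator (box c d) x *\<^sub>R f x)"
        by (auto simp: fun_eq_iff indicator_def)
      then show ?case using assms(2) by simp
    next
      case (compl A)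
      have A: "A \<in> sets borel" using compl by (simp add: borel_eq_box)
      have "(\<integral>x. indicator (UNIV - A) x *\<^sub>R (indicator (B n) x *\<^sub>R f x) \<partial>lborel)
        = (\<integral>x. indicator (B n) x *\<^sub>R f x - indicator A x *\<^sub>R (indicator (B n) x *\<^sub>R f x) \<partial>lborel)"
        by (intro Bochner_Integration.integral_cong) (auto simp: indicator_def)
      also have "\<dots> = (\<integral>x. indicator (B n) x *\<^sub>R f x \<partial>lborel) - (\<integral>x. indicator A x *\<^sub>R (indicator (B n) x *\<^sub>R f x) \<partial>lborel)"
        using A by (intro Bochner_Integration.integral_diff int integrable_mult_indicator) auto
      also have "\<dots> = 0" using compl assms(2) by (simp add: B_def)
      finally show ?case .
    next
      case (union A)
      have A: "A i \<in> sets lborel" for i using union by (auto simp: borel_eq_box)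
      have "(LINT x:(\<Union>i. A i)|lborel. indicator (B n) x *\<^sub>R f x) = (\<Sum>i. (LINT x:A i|lborel. indicator (B n) x *\<^sub>R f x))"
        using A union(1)
      proof (intro lebesgue_integral_countable_add)
        show "set_integrable lborel (\<Union> (range A)) (\<lambda>x. indicat_real (B n) x *\<^sub>R f x)"
          unfolding set_integrable_def using A by (intro integrable_mult_indicator int) auto
      qed (auto simp: disjoint_family_on_def)
      then show ?case using union(3) by (simp add: set_lebesgue_integral_def)
    qed auto
    then show "set_lebesgue_integral lborel A (\<lambda>x. indicator (B n) x *\<^sub>R f x) = set_lebesgue_integral lborel A (\<lambda>x. 0)"
      by (simp add: set_lebesgue_integral_def)
  qed simp
  then have "AE x in lborel. \<forall>n. indicator (B n) x *\<^sub>R f x = 0"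
    unfolding AE_all_countable by blast
  then show ?thesis
  proof eventually_elim
    case (elim x)
    have "(\<Union>n. B n) = UNIV" unfolding B_def by (rule UN_box_eq_UNIV)
    then obtain n where "x \<in> B n" by blast
    then show ?case using elim by (auto simp: indicator_def split: if_splits)
  qed
qed

text \<open>
  The hypothesis mentions bumps on boxes only: their bounded limits are the indicator functions of
  boxes, and the restriction shortens the verification of the hypothesis later.
\<close>

lemma fundamental_lemma:
  fixes f :: "real^2 \<Rightarrow> complex"
  assumes "f \<in> L2" "\<And>c a b. c > 0 \<Longrightarrow> (\<integral>x. box_bump c a b x *\<^sub>R f x \<partial>lborel) = 0"
  shows "AE x in lborel. f x = 0"
  using assms by (intro AE_zero_if_box_integrals_zero integral_box_zero) auto

lemma weak_grad_unique:
  assumes "has_weak_grad f F" "has_weak_grad f G" "F \<in> L2" "G \<in> L2"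
  shows "AE x in lborel. F x = G x"
proof -
  have "AE x in lborel. F x $ i - G x $ i = 0" for i
  proof (rule fundamental_lemma)
    show "(\<lambda>x. F x $ i - G x $ i) \<in> L2"
      using assms by (intro L2_diff L2_vec_nth)
    fix c a b assume "(c::real) > 0"
    then have t: "test_function (box_bump c a b)" by (rule test_function_box_bump)
    show "(\<integral>x. box_bump c a b x *\<^sub>R (F x $ i - G x $ i) \<partial>lborel) = 0"
      using has_weak_gradD[OF assms(1) t, of i] has_weak_gradD[OF assms(2) t, of i] assms(3,4) t
      by (simp add: scaleR_diff_right integrable_scaleR_L2 test_function_L2 L2_vec_nth)
  qed
  then have "AE x in lborel. \<forall>i. F x $ i - G x $ i = 0"
    by (simp add: AE_all_countable)
  then show ?thesis by eventually_elim (simp add: vec_eq_iff)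
qed

text \<open>Uniqueness makes the representative chosen by \<^const>\<open>weak_grad\<close> irrelevant.\<close>

lemma weak_grad_eq:
  assumes "has_weak_grad f F" "F \<in> L2"
  shows "weak_grad f \<in> L2" "has_weak_grad f (weak_grad f)" "AE x in lborel. weak_grad f x = F x"
proof -
  have "weak_grad f \<in> L2 \<and> has_weak_grad f (weak_grad f)"
    unfolding weak_grad_def by (rule someI[of _ F]) (use assms in simp)
  then show "weak_grad f \<in> L2" "has_weak_grad f (weak_grad f)" by auto
  then show "AE x in lborel. weak_grad f x = F x"
    using weak_grad_unique assms by blast
qed

section \<open>The heat kernel and Green's function\<close>

subsection \<open>One-dimensional integrals\<close>

lemma nn_integral_exp_half_line:
  assumes "c > 0"
  shows "(\<integral>\<^sup>+z. ennreal (indicator {0<..} z * exp (- (c * z))) \<partial>lborel) = ennreal (1 / c)"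
proof -
  have "(\<integral>\<^sup>+z. ennreal (indicator {0<..} z * exp (- (c * z))) \<partial>lborel)
    = (\<integral>\<^sup>+z. ennreal (exp (- (c * z))) * indicator {0..} z \<partial>lborel)"
    by (intro nn_integral_cong_AE eventually_mono[OF AE_lborel_singleton[of 0]]) (auto simp: indicator_def)
  also have "\<dots> = ennreal (0 - (- exp (- (c * 0)) / c))"
  proof (rule nn_integral_FTC_atLeast)
    show "((\<lambda>z. - exp (- (c * z)) / c) has_real_derivative exp (- (c * z))) (at z)" for z
      using assms by (auto intro!: derivative_eq_intros)
    have "((\<lambda>z. exp (- (c * z))) \<longlongrightarrow> 0) at_top"
      using assms by real_asymp
    from tendsto_divide[OF tendsto_minus[OF this] tendsto_const[of c]] assms
    show "((\<lambda>z. - exp (- (c * z)) / c) \<longlongrightarrow> 0) at_top" by simp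
  qed auto
  finally show ?thesis by simp
qed

text \<open>
  The scalar product of two Green's functions. As a function of the spectral parameters it is
  \<open>1 / (4 \<pi>)\<close> times the integral of \<open>1 / ((a + z) (b + z))\<close> over positive \<open>z\<close>.
\<close>

definition green_pairing :: "real \<Rightarrow> real \<Rightarrow> real" where
  "green_pairing a b = (if a = b then 1 / (4 * pi * a) else ln (a / b) / (4 * pi * (a - b)))"

lemma nn_integral_resolvents:
  assumes "a > 0" "b > 0"
  shows "(\<integral>\<^sup>+z. ennreal (indicator {0<..} z * (1 / ((a + z) * (b + z)))) \<partial>lborel) = ennreal (4 * pi * green_pairing a b)"
proof -
  define F where "F z = (if a = b then - 1 / (a + z) else ln ((b + z) / (a + z)) / (a - b))" for z
  define f where "f z = (if z \<ge> 0 then 1 / ((a + z) * (b + z)) else 0)" for z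
  have "(\<integral>\<^sup>+z. ennreal (indicator {0<..} z * (1 / ((a + z) * (b + z)))) \<partial>lborel)
    = (\<integral>\<^sup>+z. ennreal (f z) * indicator {0..} z \<partial>lborel)"
    by (intro nn_integral_cong_AE eventually_mono[OF AE_lborel_singleton[of 0]]) (auto simp: indicator_def f_def)
  also have "\<dots> = ennreal (0 - F 0)"
  proof (rule nn_integral_FTC_atLeast)
    show "(F has_real_derivative f z) (at z)" if "0 \<le> z" for z
    proof (cases "a = b")
      case True
      have "((\<lambda>z. - 1 / (a + z)) has_real_derivative f z) (at z)"
        using assms that True by (auto intro!: derivative_eq_intros simp: f_def power2_eq_square)
      then show ?thesis using True by (simp add: F_def[abs_def])
    next
      case False
      have pos: "a + z > 0" "b + z > 0" using assms that by auto
      have "((\<lambda>z. ln ((b + z) / (a + z)) / (a - b)) has_real_derivative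
          (1 / ((b + z) / (a + z)) * ((1 * (a + z) - (b + z) * 1) / ((a + z) * (a + z)))) / (a - b)) (at z)"
        using pos False by (auto intro!: derivative_eq_intros)
      also have "(1 / ((b + z) / (a + z)) * ((1 * (a + z) - (b + z) * 1) / ((a + z) * (a + z)))) / (a - b)
          = f z"
        using pos False that by (simp add: f_def divide_simps)
      finally show ?thesis using False by (simp add: F_def[abs_def])
    qed
    show "(F \<longlongrightarrow> 0) at_top"
    proof (cases "a = b")
      case True
      have "((\<lambda>z. - 1 / (a + z)) \<longlongrightarrow> 0) at_top" by real_asymp
      then show ?thesis using True by (simp add: F_def[abs_def])
    next
      case False
      have "((\<lambda>z. ln ((b + z) / (a + z))) \<longlongrightarrow> 0) at_top" by real_asymp
      from tendsto_divide[OF this tendsto_const[of "a - b"]] False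
      show ?thesis by (simp add: F_def[abs_def])
    qed
    show "f \<in> borel_measurable borel" unfolding f_def[abs_def] by measurable
  qed (use assms in \<open>auto simp: f_def\<close>)
  also have "0 - F 0 = 4 * pi * green_pairing a b"
    using assms by (auto simp: F_def green_pairing_def ln_div field_simps)
  finally show ?thesis .
qed

lemma green_pairing_pos:
  assumes "a > 0" "b > 0" shows "green_pairing a b > 0"
proof (cases a b rule: linorder_cases)
  case less
  then have "ln (a / b) < 0" using assms by (simp add: ln_less_zero_iff)
  then show ?thesis
    using less by (auto simp: green_pairing_def intro!: divide_neg_neg mult_pos_neg)
next
  case greater
  then show ?thesis using assms by (auto simp: green_pairing_def)
qed (use assms in \<open>auto simp: green_pairing_def\<close>)

lemma green_pairing_eq: "a > 0 \<Longrightarrow> b > 0 \<Longrightarrow> (a - b) * green_pairing a b = ln (a / b) / (4 * pi)"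
  by (auto simp: green_pairing_def)

subsection \<open>The heat kernel\<close>

definition heat :: "real \<Rightarrow> real^2 \<Rightarrow> real" where
  "heat s x = (if s > 0 then exp (- ((norm x)\<^sup>2 / (4 * s))) / (4 * pi * s) else 0)"

lemma heat_nonneg: "0 \<le> heat s x"
  by (simp add: heat_def)

lemma heat_measurable [measurable (raw)]:
  assumes [measurable]: "f \<in> borel_measurable M" "g \<in> borel_measurable M"
  shows "(\<lambda>y. heat (f y) (g y)) \<in> borel_measurable M"
  unfolding heat_def by measurable

lemma nn_integral_gauss_1:
  assumes "a > 0"
  shows "(\<integral>\<^sup>+t. ennreal (exp (- (a * t\<^sup>2))) \<partial>lborel) = ennreal (sqrt (pi / a))"
proof -
  define \<sigma> where "\<sigma> = sqrt (1 / (2 * a))"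
  have \<sigma>2: "\<sigma>\<^sup>2 = 1 / (2 * a)" using assms by (simp add: \<sigma>_def)
  have eq: "exp (- (a * t\<^sup>2)) = sqrt (pi / a) * normal_density 0 \<sigma> t" for t
    using assms by (simp add: normal_density_def \<sigma>2 field_simps real_sqrt_divide)
  have "(\<integral>\<^sup>+t. ennreal (exp (- (a * t\<^sup>2))) \<partial>lborel)
      = ennreal (\<integral>t. sqrt (pi / a) * normal_density 0 \<sigma> t \<partial>lborel)"
    unfolding eq using assms
    by (intro nn_integral_eq_integral integrable_mult_right) (auto simp: \<sigma>_def)
  also have "(\<integral>t. sqrt (pi / a) * normal_density 0 \<sigma> t \<partial>lborel) = sqrt (pi / a)"
    using assms by (simp add: \<sigma>_def)
  finally show ?thesis .
qed

lemma nn_integral_gauss_2: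
  assumes "a > 0"
  shows "(\<integral>\<^sup>+x. ennreal (exp (- (a * (norm (x::real^2))\<^sup>2))) \<partial>lborel) = ennreal (pi / a)"
proof -
  have eq: "ennreal (exp (- (a * (norm x)\<^sup>2))) = (\<Prod>b\<in>Basis. ennreal (exp (- (a * (x \<bullet> b)\<^sup>2))))" for x :: "real^2"
  proof -
    have "(norm x)\<^sup>2 = (\<Sum>b\<in>Basis. (x \<bullet> b)\<^sup>2)"
      unfolding power2_norm_eq_inner by (subst euclidean_inner) (simp add: power2_eq_square)
    then show ?thesis
      by (simp add: prod_ennreal sum_distrib_left sum_negf[symmetric] exp_sum)
  qed
  have "(\<integral>\<^sup>+x. ennreal (exp (- (a * (norm (x::real^2))\<^sup>2))) \<partial>lborel)
      = (\<Prod>b\<in>(Basis :: (real^2) set). ennreal (sqrt (pi / a)))"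
    unfolding eq by (subst nn_integral_lborel_prod) (auto simp: nn_integral_gauss_1[OF assms])
  also have "\<dots> = ennreal (pi / a)"
    using assms by (simp add: power2_eq_square flip: ennreal_mult)
  finally show ?thesis .
qed

lemma nn_integral_heat_heat:
  assumes "s > 0" "t > 0"
  shows "(\<integral>\<^sup>+x. ennreal (heat s x * heat t x) \<partial>lborel) = ennreal (1 / (4 * pi * (s + t)))"
proof -
  define a where "a = (s + t) / (4 * s * t)"
  have a: "a > 0" using assms by (simp add: a_def)
  have eq: "heat s x * heat t x = 1 / (16 * pi\<^sup>2 * s * t) * exp (- (a * (norm x)\<^sup>2))" for x
  proof -
    have "- (a * (norm x)\<^sup>2) = - ((norm x)\<^sup>2 / (4 * s)) + - ((norm x)\<^sup>2 / (4 * t))"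
      using assms by (simp add: a_def field_simps)
    then have "exp (- (a * (norm x)\<^sup>2)) = exp (- ((norm x)\<^sup>2 / (4 * s))) * exp (- ((norm x)\<^sup>2 / (4 * t)))"
      by (simp only: exp_add)
    then show ?thesis
      using assms by (simp add: heat_def power2_eq_square)
  qed
  have "(\<integral>\<^sup>+x. ennreal (heat s x * heat t x) \<partial>lborel)
     = ennreal (1 / (16 * pi\<^sup>2 * s * t)) * (\<integral>\<^sup>+x. ennreal (exp (- (a * (norm (x::real^2))\<^sup>2))) \<partial>lborel)"
    unfolding eq using assms
    by (subst nn_integral_cmult[symmetric]) (auto simp flip: ennreal_mult intro!: nn_integral_cong)
  also have "\<dots> = ennreal (1 / (16 * pi\<^sup>2 * s * t) * (pi / a))"
    unfolding nn_integral_gauss_2[OF a] using assms a by (subst ennreal_mult) auto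
  also have "1 / (16 * pi\<^sup>2 * s * t) * (pi / a) = 1 / (4 * pi * (s + t))"
  proof -
    have "s + t \<noteq> 0" using assms by simp
    then show ?thesis
      using assms by (simp add: a_def power2_eq_square divide_simps)
  qed
  finally show ?thesis .
qed

subsection \<open>Green's function as a superposition of heat kernels\<close>

lemma integrable_exp_cosh:
  assumes "r > 0"
  shows "integrable lborel (\<lambda>t. exp (- (r * cosh t)) :: real)"
proof -
  have "set_integrable lborel {0..} (\<lambda>t. exp (- (r * t)) :: real)"
  proof -
    have "(\<integral>\<^sup>+t. ennreal (indicator {0..} t * exp (- (r * t))) \<partial>lborel)
      = (\<integral>\<^sup>+z. ennreal (indicator {0<..} z * exp (- (r * z))) \<partial>lborel)"
      by (intro nn_integral_cong_AE eventually_mono[OF AE_lborel_singleton[of 0]]) (auto simp: indicator_def)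
    then show ?thesis
      unfolding set_integrable_def
      by (intro integrableI_nonneg) (auto simp: nn_integral_exp_half_line[OF assms])
  qed
  then have 1: "integrable lborel (\<lambda>t. indicator {0..} t *\<^sub>R exp (- (r * cosh t)) :: real)"
    unfolding set_integrable_def
  proof (rule Bochner_Integration.integrable_bound)
    show "AE t in lborel. norm (indicator {0..} t *\<^sub>R exp (- (r * cosh t)) :: real)
      \<le> norm (indicator {0..} t *\<^sub>R exp (- (r * t)) :: real)"
    proof (intro AE_I2)
      fix t :: real
      show "norm (indicator {0..} t *\<^sub>R exp (- (r * cosh t)) :: real)
        \<le> norm (indicator {0..} t *\<^sub>R exp (- (r * t)) :: real)"
      proof (cases "t \<ge> 0")
        case True
        have "t \<le> cosh t"
        proof -
          have "1 + t + t\<^sup>2 / 2 \<le> exp t"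
            using exp_lower_Taylor_quadratic[OF True] by simp
          moreover have "exp (- t) \<ge> 0" by simp
          moreover have "2 * t \<le> 1 + t\<^sup>2"
            using sum_squares_bound[of t 1] by simp
          ultimately have "2 * t \<le> exp t + exp (- t)" by linarith
          then show ?thesis
            by (simp add: cosh_field_def)
        qed
        then show ?thesis using assms True by (simp add: indicator_def)
      qed simp
    qed
    show "(\<lambda>t. indicator {0..} t *\<^sub>R exp (- (r * cosh t)) :: real) \<in> borel_measurable lborel"
      by (simp add: cosh_field_def)
  qed
  show ?thesis
    using has_bochner_integral_even_function[OF has_bochner_integral_integrable[OF 1]]
    by (simp add: has_bochner_integral_iff)
qed

lemma integral_exp_cosh:
  assumes "r > 0"
  shows "(\<integral>t. exp (- (r * cosh t)) \<partial>lborel) = 2 * macdonald_K0 r"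
proof -
  have 1: "integrable lborel (\<lambda>t. indicator {0..} t *\<^sub>R exp (- (r * cosh t)) :: real)"
    using integrable_mult_indicator[OF _ integrable_exp_cosh[OF assms], of "{0..}"] by simp
  show ?thesis
    using has_bochner_integral_even_function[OF has_bochner_integral_integrable[OF 1]]
    by (simp add: has_bochner_integral_iff macdonald_K0_def set_lebesgue_integral_def)
qed

definition green_real :: "real \<Rightarrow> real^2 \<Rightarrow> real" where
  "green_real a x = 1 / (2 * pi) * macdonald_K0 (sqrt a * norm x)"

lemma green_eq: "green a x = of_real (green_real a x)"
  by (simp add: green_def green_real_def)

text \<open>
  The substitution \<open>s = \<bar>x\<bar> exp t / (2 sqrt a)\<close> turns \<open>a s + \<bar>x\<bar>\<^sup>2 / (4 s)\<close> into
  \<open>sqrt a \<bar>x\<bar> cosh t\<close>, and \<open>ds / s\<close> into \<open>dt\<close>. Green's function is therefore the Laplace transform in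
  time of the heat kernel. All later computations with Green's functions are computations with
  Gaussians, integrated over time.
\<close>

lemma green_real_heat:
  assumes "a > 0" "x \<noteq> 0"
  shows "integrable lborel (\<lambda>s. exp (- (a * s)) * heat s x)" (is ?int)
    and "(\<integral>s. exp (- (a * s)) * heat s x \<partial>lborel) = green_real a x" (is ?eq)
proof -
  define k where "k = norm x / (2 * sqrt a)"
  define r where "r = sqrt a * norm x"
  define f where "f s = exp (- (a * s)) * heat s x" for s
  define g where "g t = k * exp t" for t
  have k: "k > 0" and r: "r > 0" using assms by (auto simp: k_def r_def)
  have img: "g ` UNIV = {0<..}"
  proof -
    have "s \<in> range g" if "s > 0" for s
      using that k by (intro image_eqI[of _ _ "ln (s / k)"]) (auto simp: g_def)
    then show ?thesis using k by (auto simp: g_def)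
  qed
  have fg: "\<bar>g t\<bar> * f (g t) = exp (- (r * cosh t)) / (4 * pi)" for t
  proof -
    have gp: "g t > 0" using k by (simp add: g_def)
    have "(norm x)\<^sup>2 / (4 * g t) = r / 2 * exp (- t)"
      using k assms by (simp add: g_def k_def r_def exp_minus field_simps power2_eq_square)
    moreover have "a * g t = r / 2 * exp t"
    proof -
      have "a * g t = (a / sqrt a) * norm x * exp t / 2"
        by (simp add: g_def k_def)
      also have "a / sqrt a = sqrt a" using assms by (simp add: real_div_sqrt)
      finally show ?thesis by (simp add: r_def)
    qed
    ultimately have "exp (- (a * g t)) * exp (- ((norm x)\<^sup>2 / (4 * g t))) = exp (- (r * cosh t))"
      by (simp add: cosh_field_def algebra_simps add_divide_distrib flip: exp_add)
    then show ?thesis using gp by (simp add: f_def heat_def)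
  qed
  have "integrable lborel (\<lambda>t. exp (- (r * cosh t)) / (4 * pi))"
    using integrable_exp_cosh[OF r] by simp
  then have i: "integrable lebesgue (\<lambda>t. exp (- (r * cosh t)) / (4 * pi))"
    by (subst integrable_completion) (auto dest: borel_measurable_integrable)
  have "(\<lambda>t. \<bar>g t\<bar> * f (g t)) absolutely_integrable_on UNIV \<and>
        integral UNIV (\<lambda>t. \<bar>g t\<bar> * f (g t)) = 2 * macdonald_K0 r / (4 * pi)"
  proof
    show abs: "(\<lambda>t. \<bar>g t\<bar> * f (g t)) absolutely_integrable_on UNIV"
      unfolding fg using i by (simp add: set_integrable_def)
    have "integral UNIV (\<lambda>t. \<bar>g t\<bar> * f (g t)) = integral\<^sup>L lebesgue (\<lambda>t. exp (- (r * cosh t)) / (4 * pi))"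
      using set_lebesgue_integral_eq_integral(2)[OF abs] unfolding fg by (simp add: set_lebesgue_integral_def)
    also have "\<dots> = (\<integral>t. exp (- (r * cosh t)) / (4 * pi) \<partial>lborel)"
      using integrable_exp_cosh[OF r] by (subst integral_completion) (auto dest: borel_measurable_integrable)
    also have "\<dots> = 2 * macdonald_K0 r / (4 * pi)"
      using integral_exp_cosh[OF r] by simp
    finally show "integral UNIV (\<lambda>t. \<bar>g t\<bar> * f (g t)) = 2 * macdonald_K0 r / (4 * pi)" .
  qed
  then have "f absolutely_integrable_on (g ` UNIV) \<and> integral (g ` UNIV) f = 2 * macdonald_K0 r / (4 * pi)"
  proof (rule iffD1[OF has_absolute_integral_change_of_variables_1', rotated -1])
    show "(g has_real_derivative g t) (at t within UNIV)" for t
      by (auto simp: g_def[abs_def] intro!: derivative_eq_intros)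
    show "inj_on g UNIV" using k by (auto simp: inj_on_def g_def)
  qed auto
  then have abs: "f absolutely_integrable_on {0<..}" and int: "integral {0<..} f = 2 * macdonald_K0 r / (4 * pi)"
    by (auto simp: img)
  have ind: "indicator {0<..} s *\<^sub>R f s = f s" for s
    by (auto simp: indicator_def f_def heat_def)
  have fm: "f \<in> borel_measurable lborel" unfolding f_def[abs_def] by measurable
  have il: "integrable lebesgue f"
    using abs unfolding set_integrable_def ind .
  then show ?int
    using integrable_completion[OF fm] by (simp add: f_def[abs_def])
  have "(\<integral>s. f s \<partial>lborel) = integral\<^sup>L lebesgue f"
    using integral_completion[OF fm] by simp
  also have "\<dots> = integral {0<..} f"
    using set_lebesgue_integral_eq_integral(2)[OF abs] unfolding set_lebesgue_integral_def ind .
  also have "\<dots> = green_real a x"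
    unfolding int by (simp add: green_real_def r_def)
  finally show ?eq by (simp add: f_def)
qed

lemma green_real_nonneg: "0 \<le> green_real a x"
  by (simp add: green_real_def macdonald_K0_def set_lebesgue_integral_def)

lemma green_real_measurable [measurable]: "green_real a \<in> borel_measurable borel"
proof -
  have "(\<lambda>x::real^2. \<integral>t. indicator {0..} t *\<^sub>R exp (- (sqrt a * norm x) * cosh t) \<partial>lborel) \<in> borel_measurable borel"
    unfolding cosh_field_def by measurable
  then show ?thesis
    unfolding green_real_def[abs_def] macdonald_K0_def set_lebesgue_integral_def by measurable
qed

lemma green_real_nn_integral:
  assumes "a > 0" "x \<noteq> 0"
  shows "(\<integral>\<^sup>+s. ennreal (exp (- (a * s)) * heat s x) \<partial>lborel) = ennreal (green_real a x)"
  using nn_integral_eq_integral[OF green_real_heat(1)[OF assms]] green_real_heat(2)[OF assms]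
  by (simp add: heat_nonneg)

text \<open>
  Two heat kernels at times \<open>s\<close> and \<open>t\<close> have the scalar product \<open>1 / (4 \<pi> (s + t))\<close>. Writing
  \<open>1 / (s + t)\<close> as an integral of exponentials separates the two time variables, and Tonelli's theorem
  leaves the integral of a product of two resolvents.
\<close>

lemma nn_integral_green_green:
  assumes "a > 0" "b > 0"
  shows "(\<integral>\<^sup>+x. ennreal (green_real a x * green_real b x) \<partial>lborel) = ennreal (green_pairing a b)"
proof -
  define E where "E c s = indicator {0<..} s * exp (- (c * s))" for c s :: real
  have [measurable]: "E c \<in> borel_measurable borel" for c unfolding E_def[abs_def] by measurable
  have E0: "0 \<le> E c s" for c s by (simp add: E_def)
  let ?H = "\<lambda>s t x. ennreal (exp (- (a * s)) * heat s x) * ennreal (exp (- (b * t)) * heat t x)"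
  let ?E = "\<lambda>s t z. ennreal (1 / (4 * pi)) * (ennreal (E 0 z) * (ennreal (E (a + z) s) * ennreal (E (b + z) t)))"
  have "(\<integral>\<^sup>+x. ennreal (green_real a x * green_real b x) \<partial>lborel)
      = (\<integral>\<^sup>+x. (\<integral>\<^sup>+s. ennreal (exp (- (a * s)) * heat s x) \<partial>lborel) * (\<integral>\<^sup>+t. ennreal (exp (- (b * t)) * heat t x) \<partial>lborel) \<partial>lborel)"
    by (intro nn_integral_cong_AE eventually_mono[OF AE_lborel_singleton[of 0]])
      (auto simp: green_real_nn_integral assms ennreal_mult green_real_nonneg)
  also have "\<dots> = (\<integral>\<^sup>+x. (\<integral>\<^sup>+s. (\<integral>\<^sup>+t. ?H s t x \<partial>lborel) \<partial>lborel) \<partial>lborel)"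
    by (simp add: nn_integral_cmult nn_integral_multc)
  also have "\<dots> = (\<integral>\<^sup>+s. (\<integral>\<^sup>+x. (\<integral>\<^sup>+t. ?H s t x \<partial>lborel) \<partial>lborel) \<partial>lborel)"
    by (rule lborel_pair.Fubini') measurable
  also have "\<dots> = (\<integral>\<^sup>+s. (\<integral>\<^sup>+t. (\<integral>\<^sup>+x. ?H s t x \<partial>lborel) \<partial>lborel) \<partial>lborel)"
    by (intro nn_integral_cong lborel_pair.Fubini') measurable
  also have "\<dots> = (\<integral>\<^sup>+s. (\<integral>\<^sup>+t. (\<integral>\<^sup>+z. ?E s t z \<partial>lborel) \<partial>lborel) \<partial>lborel)"
  proof (intro nn_integral_cong)
    fix s t :: real
    show "(\<integral>\<^sup>+x. ?H s t x \<partial>lborel)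
      = (\<integral>\<^sup>+z. ?E s t z \<partial>lborel)"
    proof (cases "s > 0 \<and> t > 0")
      case True
      have "(\<integral>\<^sup>+x. ?H s t x \<partial>lborel)
         = (\<integral>\<^sup>+x. ennreal (exp (- (a * s)) * exp (- (b * t))) * ennreal (heat s x * heat t x) \<partial>lborel)"
        by (intro nn_integral_cong) (simp add: heat_nonneg mult_ac flip: ennreal_mult)
      also have "\<dots> = ennreal (exp (- (a * s)) * exp (- (b * t))) * ennreal (1 / (4 * pi * (s + t)))"
        using True by (subst nn_integral_cmult) (auto simp: nn_integral_heat_heat)
      also have "\<dots> = ennreal (1 / (4 * pi) * (exp (- (a * s)) * exp (- (b * t)))) * ennreal (1 / (s + t))"
        using True by (simp flip: ennreal_mult)
      also have "\<dots> = (\<integral>\<^sup>+z. ennreal (1 / (4 * pi) * (exp (- (a * s)) * exp (- (b * t)))) *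
          ennreal (indicator {0<..} z * exp (- ((s + t) * z))) \<partial>lborel)"
        using True by (subst nn_integral_cmult) (auto simp: nn_integral_exp_half_line)
      also have "\<dots> = (\<integral>\<^sup>+z. ?E s t z \<partial>lborel)"
      proof (intro nn_integral_cong)
        fix z
        have "1 / (4 * pi) * (exp (- (a * s)) * exp (- (b * t))) * (indicator {0<..} z * exp (- ((s + t) * z)))
          = 1 / (4 * pi) * (E 0 z * (E (a + z) s * E (b + z) t))"
          using True by (simp add: E_def indicator_def ring_distribs mult.commute exp_add[symmetric])
        then show "ennreal (1 / (4 * pi) * (exp (- (a * s)) * exp (- (b * t)))) *
          ennreal (indicator {0<..} z * exp (- ((s + t) * z))) =
          ?E s t z"
          by (simp add: E0 flip: ennreal_mult)
      qed
      finally show ?thesis .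
    next
      case False
      then have "heat s x * heat t x = 0" "E (a + z) s * E (b + z) t = 0" for x z
        by (auto simp: heat_def E_def)
      then show ?thesis using False by (auto simp: heat_def E_def)
    qed
  qed
  also have "\<dots> = (\<integral>\<^sup>+s. (\<integral>\<^sup>+z. (\<integral>\<^sup>+t. ?E s t z \<partial>lborel) \<partial>lborel) \<partial>lborel)"
    unfolding E_def by (intro nn_integral_cong lborel_pair.Fubini') measurable
  also have "\<dots> = (\<integral>\<^sup>+z. (\<integral>\<^sup>+s. (\<integral>\<^sup>+t. ?E s t z \<partial>lborel) \<partial>lborel) \<partial>lborel)"
    unfolding E_def by (rule lborel_pair.Fubini') measurable
  also have "\<dots> = (\<integral>\<^sup>+z. ennreal (1 / (4 * pi)) * ennreal (indicator {0<..} z * (1 / ((a + z) * (b + z)))) \<partial>lborel)"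
  proof (intro nn_integral_cong)
    fix z :: real
    show "(\<integral>\<^sup>+s. (\<integral>\<^sup>+t. ?E s t z \<partial>lborel) \<partial>lborel)
      = ennreal (1 / (4 * pi)) * ennreal (indicator {0<..} z * (1 / ((a + z) * (b + z))))"
    proof (cases "z > 0")
      case True
      have I: "(\<integral>\<^sup>+s. ennreal (E (c + z) s) \<partial>lborel) = ennreal (1 / (c + z))" if "c > 0" for c
        unfolding E_def using that True by (intro nn_integral_exp_half_line) simp
      have "(\<integral>\<^sup>+s. (\<integral>\<^sup>+t. ?E s t z \<partial>lborel) \<partial>lborel)
         = ennreal (1 / (4 * pi)) * (ennreal (E 0 z) * (ennreal (1 / (a + z)) * ennreal (1 / (b + z))))"
        by (simp add: nn_integral_cmult nn_integral_multc I assms)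
      then show ?thesis using True assms by (simp add: E_def flip: ennreal_mult)
    qed (simp add: E_def)
  qed
  also have "\<dots> = ennreal (1 / (4 * pi)) * (\<integral>\<^sup>+z. ennreal (indicator {0<..} z * (1 / ((a + z) * (b + z)))) \<partial>lborel)"
    by (rule nn_integral_cmult) measurable
  also have "\<dots> = ennreal (1 / (4 * pi)) * ennreal (4 * pi * green_pairing a b)"
    unfolding nn_integral_resolvents[OF assms] ..
  also have "\<dots> = ennreal (green_pairing a b)"
    using green_pairing_pos[OF assms] by (simp flip: ennreal_mult)
  finally show ?thesis .
qed

lemma green_real_L2:
  assumes "a > 0" shows "green_real a \<in> L2"
  using nn_integral_green_green[OF assms assms]
  by (auto simp: L2_def power2_eq_square green_real_nonneg intro!: integrableI_nonneg)

lemma green_L2: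
  assumes "a > 0" shows "green a \<in> L2"
  using L2_of_real[OF green_real_L2[OF assms]] by (simp add: green_eq[abs_def])

lemma herm_green_green:
  assumes "a > 0" "b > 0"
  shows "herm (green a) (green b) = of_real (green_pairing a b)"
proof -
  have "(\<integral>x. green_real a x * green_real b x \<partial>lborel) = green_pairing a b"
    using nn_integral_green_green[OF assms] green_pairing_pos[OF assms]
    by (intro integral_eq_nn_integral[THEN trans]) (auto simp: green_real_nonneg)
  then show ?thesis
    by (simp add: herm_def green_eq flip: of_real_mult)
qed

subsection \<open>Superpositions dominated by the heat kernel\<close>

text \<open>
  The right-hand side, integrated over time, is again a multiple of a Green's function, hence square
  integrable in space. Thus one bound justifies at once the convergence of a superposition, its square
  integrability, and the exchange of the two integrals against any square integrable function.
  Doubling the time leaves room for the polynomial factors that derivatives of the heat kernel produce.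
  The bound is zero for nonpositive times, where \<^const>\<open>heat\<close> vanishes by definition.
\<close>

definition heat_dominated :: "real \<Rightarrow> real \<Rightarrow> (real \<Rightarrow> real^2 \<Rightarrow> real) \<Rightarrow> bool" where
  "heat_dominated C \<mu> K \<longleftrightarrow> C \<ge> 0 \<and> \<mu> > 0 \<and> case_prod K \<in> borel_measurable (borel \<Otimes>\<^sub>M borel) \<and>
     (\<forall>s x. \<bar>K s x\<bar> \<le> C * exp (- (\<mu> * s)) * heat (2 * s) x)"

lemma integral_dominating_heat:
  assumes "\<mu> > 0" "x \<noteq> 0"
  shows "integrable lborel (\<lambda>s. exp (- (\<mu> * s)) * heat (2 * s) x)"
    "(\<integral>s. exp (- (\<mu> * s)) * heat (2 * s) x \<partial>lborel) = green_real (\<mu> / 2) x / 2"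
proof -
  have eq: "exp (- (\<mu> * s)) * heat (2 * s) x = exp (- (\<mu> / 2 * (0 + 2 * s))) * heat (0 + 2 * s) x" for s
    by simp
  have i: "integrable lborel (\<lambda>s. exp (- (\<mu> / 2 * s)) * heat s x)"
    using green_real_heat(1)[of "\<mu> / 2" x] assms by simp
  show "integrable lborel (\<lambda>s. exp (- (\<mu> * s)) * heat (2 * s) x)"
    unfolding eq using lborel_integrable_real_affine[OF i, of 2 0] by simp
  show "(\<integral>s. exp (- (\<mu> * s)) * heat (2 * s) x \<partial>lborel) = green_real (\<mu> / 2) x / 2"
    using lborel_integral_real_affine[of 2 "\<lambda>s. exp (- (\<mu> / 2 * s)) * heat s x" 0]
      green_real_heat(2)[of "\<mu> / 2" x] assms by simp
qed

lemma heat_dominated_integrable: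
  assumes "heat_dominated C \<mu> K" "x \<noteq> 0"
  shows "integrable lborel (\<lambda>s. K s x)"
    "(\<integral>s. \<bar>K s x\<bar> \<partial>lborel) \<le> C / 2 * green_real (\<mu> / 2) x"
proof -
  have \<mu>: "\<mu> > 0" and C: "C \<ge> 0" and [measurable]: "case_prod K \<in> borel_measurable (borel \<Otimes>\<^sub>M borel)"
    and b: "\<bar>K s x\<bar> \<le> C * (exp (- (\<mu> * s)) * heat (2 * s) x)" for s
    using assms by (auto simp: heat_dominated_def mult.assoc)
  note d = integral_dominating_heat[OF \<mu> assms(2)]
  have [measurable]: "(\<lambda>s. K s x) \<in> borel_measurable borel" by measurable
  show i: "integrable lborel (\<lambda>s. K s x)"
    by (rule Bochner_Integration.integrable_bound[OF integrable_mult_right[OF d(1), of C]])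
      (use b C in \<open>auto simp: abs_mult heat_nonneg\<close>)
  have "(\<integral>s. \<bar>K s x\<bar> \<partial>lborel) \<le> (\<integral>s. C * (exp (- (\<mu> * s)) * heat (2 * s) x) \<partial>lborel)"
    by (intro integral_mono integrable_abs i integrable_mult_right d b)
  also have "\<dots> = C / 2 * green_real (\<mu> / 2) x"
    by (simp add: d(2))
  finally show "(\<integral>s. \<bar>K s x\<bar> \<partial>lborel) \<le> C / 2 * green_real (\<mu> / 2) x" .
qed

lemma superposition_L2:
  assumes "heat_dominated C \<mu> K"
  shows "(\<lambda>x. \<integral>s. K s x \<partial>lborel) \<in> L2"
proof (rule L2_AE_bound)
  show "green_real (\<mu> / 2) \<in> L2"
    using assms by (intro green_real_L2) (simp add: heat_dominated_def)
  have [measurable]: "case_prod K \<in> borel_measurable (borel \<Otimes>\<^sub>M borel)"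
    using assms by (simp add: heat_dominated_def)
  show "(\<lambda>x. \<integral>s. K s x \<partial>lborel) \<in> borel_measurable borel" by measurable
  show "AE x in lborel. norm (\<integral>s. K s x \<partial>lborel) \<le> C / 2 * norm (green_real (\<mu> / 2) x)"
  proof (rule eventually_mono[OF AE_lborel_singleton[of 0]])
    fix x :: "real^2" assume "x \<noteq> 0"
    then show "norm (\<integral>s. K s x \<partial>lborel) \<le> C / 2 * norm (green_real (\<mu> / 2) x)"
      using order_trans[OF integral_norm_bound[of lborel "\<lambda>s. K s x"], unfolded real_norm_def,
          OF heat_dominated_integrable(2)[OF assms, of x]]
      by (simp add: green_real_nonneg)
  qed
qed

lemma superposition_integral:
  fixes g :: "real^2 \<Rightarrow> complex"
  assumes K: "heat_dominated C \<mu> K" and g: "g \<in> L2"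
  shows "(\<integral>x. (\<integral>s. K s x \<partial>lborel) *\<^sub>R g x \<partial>lborel) = (\<integral>s. (\<integral>x. K s x *\<^sub>R g x \<partial>lborel) \<partial>lborel)"
    and "integrable lborel (\<lambda>s. \<integral>x. K s x *\<^sub>R g x \<partial>lborel)"
proof -
  have [measurable]: "case_prod K \<in> borel_measurable (borel \<Otimes>\<^sub>M borel)"
    using K by (simp add: heat_dominated_def)
  have gm [measurable]: "g \<in> borel_measurable borel" using g by (rule L2_measurable)
  have int: "integrable (lborel \<Otimes>\<^sub>M lborel) (\<lambda>(x, s). K s x *\<^sub>R g x)"
  proof (rule lborel_pair.Fubini_integrable)
    show "(\<lambda>(x, s). K s x *\<^sub>R g x) \<in> borel_measurable (lborel \<Otimes>\<^sub>M lborel)" by measurable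
    show "AE x in lborel. integrable lborel (\<lambda>s. case (x, s) of (x, s) \<Rightarrow> K s x *\<^sub>R g x)"
      by (rule eventually_mono[OF AE_lborel_singleton[of 0]])
        (auto intro!: integrable_scaleR_left heat_dominated_integrable[OF K])
    have "integrable lborel (\<lambda>x. (C / 2 * green_real (\<mu> / 2) x) * cmod (g x))"
    proof -
      have "integrable lborel (\<lambda>x. green_real (\<mu> / 2) x *\<^sub>R cmod (g x))"
        by (rule integrable_L2[OF green_real_L2[of "\<mu> / 2"] g])
          (use K in \<open>auto simp: heat_dominated_def abs_mult\<close>)
      then show ?thesis by (simp add: mult.assoc)
    qed
    then show "integrable lborel (\<lambda>x. \<integral>s. norm (case (x, s) of (x, s) \<Rightarrow> K s x *\<^sub>R g x) \<partial>lborel)"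
    proof (rule Bochner_Integration.integrable_bound)
      show "(\<lambda>x. \<integral>s. norm (case (x, s) of (x, s) \<Rightarrow> K s x *\<^sub>R g x) \<partial>lborel) \<in> borel_measurable lborel"
        by measurable
      show "AE x in lborel. norm (\<integral>s. norm (case (x, s) of (x, s) \<Rightarrow> K s x *\<^sub>R g x) \<partial>lborel)
          \<le> norm ((C / 2 * green_real (\<mu> / 2) x) * cmod (g x))"
      proof (rule eventually_mono[OF AE_lborel_singleton[of 0]])
        fix x :: "real^2" assume x: "x \<noteq> 0"
        have "norm (\<integral>s. norm (case (x, s) of (x, s) \<Rightarrow> K s x *\<^sub>R g x) \<partial>lborel) = (\<integral>s. \<bar>K s x\<bar> \<partial>lborel) * cmod (g x)"
          by (simp add: abs_mult)
        also have "\<dots> \<le> (C / 2 * green_real (\<mu> / 2) x) * cmod (g x)"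
          by (intro mult_right_mono heat_dominated_integrable(2)[OF K x]) simp
        finally show "norm (\<integral>s. norm (case (x, s) of (x, s) \<Rightarrow> K s x *\<^sub>R g x) \<partial>lborel)
          \<le> norm ((C / 2 * green_real (\<mu> / 2) x) * cmod (g x))" by simp
      qed
    qed
  qed
  have "(\<integral>x. (\<integral>s. K s x \<partial>lborel) *\<^sub>R g x \<partial>lborel) = (\<integral>x. (\<integral>s. K s x *\<^sub>R g x \<partial>lborel) \<partial>lborel)"
    by (intro integral_cong_AE eventually_mono[OF AE_lborel_singleton[of 0]])
      (auto simp: heat_dominated_integrable[OF K])
  also have "\<dots> = (\<integral>s. (\<integral>x. K s x *\<^sub>R g x \<partial>lborel) \<partial>lborel)"
    using lborel_pair.Fubini_integral[OF int] by simp
  finally show "(\<integral>x. (\<integral>s. K s x \<partial>lborel) *\<^sub>R g x \<partial>lborel) = (\<integral>s. (\<integral>x. K s x *\<^sub>R g x \<partial>lborel) \<partial>lborel)" .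
  show "integrable lborel (\<lambda>s. \<integral>x. K s x *\<^sub>R g x \<partial>lborel)"
    using lborel_pair.integrable_snd[OF int] by simp
qed

subsection \<open>Derivatives of the heat kernel\<close>

lemma heat_has_derivative:
  assumes "s > 0"
  shows "(heat s has_derivative (\<lambda>v. (- 1 / (2 * s)) * (x \<bullet> v) * heat s x)) (at x)"
proof -
  have "((\<lambda>x::real^2. exp (- ((norm x)\<^sup>2 / (4 * s))) / (4 * pi * s)) has_derivative
      (\<lambda>v. (- 1 / (2 * s)) * (x \<bullet> v) * heat s x)) (at x)"
    unfolding power2_norm_eq_inner using assms
    by (auto intro!: derivative_eq_intros simp: heat_def power2_norm_eq_inner inner_commute field_simps)
  then show ?thesis using assms by (simp add: heat_def[abs_def])
qed

lemma partial_deriv_heat: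
  assumes "s > 0"
  shows "partial_deriv i (heat s) = (\<lambda>x. (- 1 / (2 * s)) * (x $ i) * heat s x)"
  using partial_deriv_eqI[OF heat_has_derivative[OF assms]] by (auto simp: inner_axis)

lemma smooth_heat:
  assumes "s > 0" shows "smooth (heat s)"
proof -
  have "C_k k (heat s)" for k
  proof (induction k)
    case 0
    have "continuous_on UNIV (heat s)"
      by (rule has_derivative_continuous_on) (rule has_derivative_at_withinI[OF heat_has_derivative[OF assms]])
    then show ?case by simp
  next
    case (Suc k)
    show ?case
    proof (rule C_k_SucI[OF heat_has_derivative[OF assms]])
      fix i :: 2
      have eq: "x \<bullet> axis i 1 = x $ i" for x :: "real^2" by (simp add: inner_axis)
      have "C_k k (\<lambda>x. x $ i)" using smooth_nth[of i] by (simp add: smooth_def)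
      then show "C_k k (\<lambda>x. - 1 / (2 * s) * (x \<bullet> axis i 1) * heat s x)"
        unfolding eq by (intro C_k_mult C_k_const Suc)
    qed
  qed
  then show ?thesis by (simp add: smooth_def)
qed

lemma partial_deriv2_heat:
  assumes "s > 0"
  shows "partial_deriv i (partial_deriv i (heat s)) x = ((x $ i)\<^sup>2 / (4 * s\<^sup>2) - 1 / (2 * s)) * heat s x"
proof -
  have "(partial_deriv i (heat s) has_derivative
      (\<lambda>v. - 1 / (2 * s) * (x $ i) * ((- 1 / (2 * s)) * (x \<bullet> v) * heat s x) + (- 1 / (2 * s) * (v $ i)) * heat s x)) (at x)"
    unfolding partial_deriv_heat[OF assms]
    by (intro has_derivative_mult heat_has_derivative assms has_derivative_mult_right
        bounded_linear_imp_has_derivative bounded_linear_vec_nth)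
  from partial_deriv_eqI[OF this, of i] show ?thesis
    using assms by (simp add: inner_axis algebra_simps power2_eq_square divide_simps)
qed

definition heat_dt :: "real \<Rightarrow> real^2 \<Rightarrow> real" where
  "heat_dt s x = ((norm x)\<^sup>2 / (4 * s\<^sup>2) - 1 / s) * heat s x"

lemma laplace_heat:
  assumes "s > 0"
  shows "(\<Sum>i\<in>UNIV. partial_deriv i (partial_deriv i (heat s)) x) = heat_dt s x"
proof -
  have "(norm x)\<^sup>2 = (\<Sum>i\<in>UNIV. (x $ i)\<^sup>2)"
    by (simp add: norm_vec_def L2_set_def sum_nonneg)
  then show ?thesis
    using assms by (simp add: partial_deriv2_heat heat_dt_def sum_subtractf sum_divide_distrib flip: sum_distrib_right)
qed

lemma heat_has_time_derivative:
  assumes "s > 0"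
  shows "((\<lambda>s. heat s x) has_real_derivative heat_dt s x) (at s)"
proof -
  have "((\<lambda>s. exp (- ((norm x)\<^sup>2 / (4 * s))) / (4 * pi * s)) has_real_derivative heat_dt s x) (at s)"
    using assms
    by (auto intro!: derivative_eq_intros simp: heat_dt_def heat_def power2_eq_square divide_simps algebra_simps)
  then show ?thesis
    by (rule has_field_derivative_transform_within_open[of _ _ _ "{0<..}"])
      (use assms in \<open>auto simp: heat_def\<close>)
qed

lemma heat_double:
  assumes "s > 0"
  shows "heat s x = 2 * exp (- ((norm x)\<^sup>2 / (8 * s))) * heat (2 * s) x"
proof -
  have "exp (- ((norm x)\<^sup>2 / (4 * s))) = exp (- ((norm x)\<^sup>2 / (8 * s))) * exp (- ((norm x)\<^sup>2 / (8 * s)))"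
    using assms by (simp flip: exp_add add: divide_simps)
  then show ?thesis using assms by (simp add: heat_def)
qed

lemma heat_le_double: "heat s x \<le> 2 * heat (2 * s) x"
proof (cases "s > 0")
  case True
  have "exp (- ((norm x)\<^sup>2 / (8 * s))) \<le> 1" using True by simp
  from mult_right_mono[OF this heat_nonneg[of "2 * s" x]] show ?thesis
    by (subst heat_double[OF True]) simp
qed (simp add: heat_def)

text \<open>
  With \<open>z = \<bar>x\<bar>\<^sup>2 / (8 s)\<close> this is \<open>(z + 1) exp (- z) \<le> 1\<close>: passing from time \<open>s\<close> to time \<open>2 s\<close>
  gives up the factor \<open>exp (- z)\<close>.
\<close>

lemma heat_moment_bound:
  assumes "s > 0"
  shows "((norm x)\<^sup>2 / (8 * s) + 1) * heat s x \<le> 2 * heat (2 * s) x"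
proof -
  define z where "z = (norm x)\<^sup>2 / (8 * s)"
  have "(z + 1) * exp (- z) \<le> 1"
    using exp_ge_add_one_self[of z] by (simp add: exp_minus field_simps)
  from mult_right_mono[OF this heat_nonneg[of "2 * s" x]] show ?thesis
    unfolding heat_double[OF assms] z_def by (simp add: algebra_simps)
qed

lemma heat_dt_bound:
  assumes "s > 0" shows "\<bar>heat_dt s x\<bar> \<le> 4 / s * heat (2 * s) x"
proof -
  have "\<bar>(norm x)\<^sup>2 / (4 * s\<^sup>2) - 1 / s\<bar> \<le> 2 / s * ((norm x)\<^sup>2 / (8 * s) + 1)"
  proof -
    have "\<bar>(norm x)\<^sup>2 / (4 * s\<^sup>2) - 1 / s\<bar> \<le> (norm x)\<^sup>2 / (4 * s\<^sup>2) + 1 / s"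
      using assms by (intro abs_leI) (auto simp: add_increasing2)
    also have "\<dots> \<le> 2 / s * ((norm x)\<^sup>2 / (8 * s) + 1)"
      using assms by (simp add: field_simps power2_eq_square)
    finally show ?thesis .
  qed
  then have "\<bar>heat_dt s x\<bar> \<le> 2 / s * ((norm x)\<^sup>2 / (8 * s) + 1) * heat s x"
    unfolding heat_dt_def abs_mult using heat_nonneg[of s x] by (intro mult_mono) auto
  also have "\<dots> = 2 / s * (((norm x)\<^sup>2 / (8 * s) + 1) * heat s x)" by simp
  also have "\<dots> \<le> 2 / s * (2 * heat (2 * s) x)"
    using assms by (intro mult_left_mono heat_moment_bound) auto
  finally show ?thesis by simp
qed

lemma partial_deriv2_heat_bound:
  assumes "s > 0" shows "\<bar>partial_deriv i (partial_deriv i (heat s)) x\<bar> \<le> 4 / s * heat (2 * s) x"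
proof -
  have c: "(x $ i)\<^sup>2 \<le> (norm x)\<^sup>2"
    using component_le_norm_cart[of x i] by (simp add: abs_le_square_iff[symmetric])
  have "\<bar>(x $ i)\<^sup>2 / (4 * s\<^sup>2) - 1 / (2 * s)\<bar> \<le> 2 / s * ((norm x)\<^sup>2 / (8 * s) + 1)"
  proof -
    have "\<bar>(x $ i)\<^sup>2 / (4 * s\<^sup>2) - 1 / (2 * s)\<bar> \<le> (x $ i)\<^sup>2 / (4 * s\<^sup>2) + 1 / s"
      using assms by (intro abs_leI) (auto simp: add_increasing2 field_simps)
    also have "\<dots> \<le> (norm x)\<^sup>2 / (4 * s\<^sup>2) + 1 / s"
      using c by (intro add_right_mono divide_right_mono) auto
    also have "\<dots> \<le> 2 / s * ((norm x)\<^sup>2 / (8 * s) + 1)"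
      using assms by (simp add: field_simps power2_eq_square)
    finally show ?thesis .
  qed
  then have "\<bar>partial_deriv i (partial_deriv i (heat s)) x\<bar> \<le> 2 / s * ((norm x)\<^sup>2 / (8 * s) + 1) * heat s x"
    unfolding partial_deriv2_heat[OF assms] abs_mult using heat_nonneg[of s x] by (intro mult_mono) auto
  also have "\<dots> = 2 / s * (((norm x)\<^sup>2 / (8 * s) + 1) * heat s x)" by simp
  also have "\<dots> \<le> 2 / s * (2 * heat (2 * s) x)"
    using assms by (intro mult_left_mono heat_moment_bound) auto
  finally show ?thesis by simp
qed

lemma partial_deriv_heat_bound:
  assumes "s > 0" shows "\<bar>partial_deriv i (heat s) x\<bar> \<le> (1 + 1 / s) * 2 * heat (2 * s) x"
proof -
  have "\<bar>x $ i\<bar> / (2 * s) \<le> (1 + 1 / s) * ((norm x)\<^sup>2 / (8 * s) + 1)"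
  proof -
    have "\<bar>x $ i\<bar> \<le> (norm x)\<^sup>2 / 4 + 1"
      using component_le_norm_cart[of x i] sum_squares_bound[of "norm x / 2" 1] by (simp add: power_divide)
    then have "\<bar>x $ i\<bar> / (2 * s) \<le> ((norm x)\<^sup>2 / 4 + 1) / (2 * s)"
      using assms by (intro divide_right_mono) auto
    also have "\<dots> \<le> (1 + 1 / s) * ((norm x)\<^sup>2 / (8 * s) + 1)"
      using assms by (simp add: divide_simps) (simp add: algebra_simps power2_eq_square add_increasing)
    finally show ?thesis .
  qed
  from mult_right_mono[OF this heat_nonneg[of s x]]
  have "\<bar>partial_deriv i (heat s) x\<bar> \<le> (1 + 1 / s) * ((norm x)\<^sup>2 / (8 * s) + 1) * heat s x"
    using assms by (simp add: partial_deriv_heat[OF assms] abs_mult heat_nonneg)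
  also have "\<dots> = (1 + 1 / s) * (((norm x)\<^sup>2 / (8 * s) + 1) * heat s x)" by simp
  also have "\<dots> \<le> (1 + 1 / s) * (2 * heat (2 * s) x)"
    using assms by (intro mult_left_mono heat_moment_bound) auto
  finally show ?thesis by (simp only: mult.assoc)
qed

lemma heat_L2:
  assumes "s > 0" shows "heat s \<in> L2"
proof -
  have "(\<integral>\<^sup>+x. ennreal ((norm (heat s x))\<^sup>2) \<partial>lborel) = ennreal (1 / (4 * pi * (s + s)))"
    using nn_integral_heat_heat[OF assms assms] by (simp add: power2_eq_square)
  then show ?thesis
    by (auto simp: L2_def intro!: integrableI_nonneg)
qed

lemma partial_deriv_heat_L2:
  assumes "s > 0"
  shows "partial_deriv i (heat s) \<in> L2" "partial_deriv i (partial_deriv i (heat s)) \<in> L2"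
proof -
  have h: "heat (2 * s) \<in> L2" using assms by (intro heat_L2) simp
  show "partial_deriv i (heat s) \<in> L2"
    by (rule L2_bound[OF h, where C="(1 + 1 / s) * 2"])
      (use partial_deriv_heat_bound[OF assms] smooth_heat[OF assms] in
       \<open>auto simp: heat_nonneg intro!: smooth_measurable smooth_partial_deriv\<close>)
  show "partial_deriv i (partial_deriv i (heat s)) \<in> L2"
    by (rule L2_bound[OF h, where C="4 / s"])
      (use partial_deriv2_heat_bound[OF assms] smooth_heat[OF assms] in
       \<open>auto simp: heat_nonneg intro!: smooth_measurable smooth_partial_deriv\<close>)
qed


subsection \<open>Differences of Green's functions\<close>

definition exp_diff :: "real \<Rightarrow> real \<Rightarrow> real \<Rightarrow> real" where
  "exp_diff a b s = exp (- (a * s)) - exp (- (b * s))"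

text \<open>
  The second bound supplies the factor \<open>s\<close> that compensates the singularity of the derivatives of the
  heat kernel at time zero. It expresses that the singularities of the two Green's functions cancel.
\<close>

lemma exp_diff_bound:
  assumes "s > 0"
  shows "\<bar>exp_diff a b s\<bar> \<le> exp (- (min a b * s))"
    "\<bar>exp_diff a b s\<bar> \<le> \<bar>a - b\<bar> * s * exp (- (min a b * s))"
proof -
  have *: "\<bar>exp_diff a b s\<bar> \<le> exp (- (a * s)) \<and> \<bar>exp_diff a b s\<bar> \<le> (b - a) * s * exp (- (a * s))"
    if "a \<le> b" for a b
  proof -
    define y where "y = (b - a) * s"
    have y: "y \<ge> 0" using that assms by (simp add: y_def)
    have "- (b * s) = - (a * s) + - y" by (simp add: y_def algebra_simps)
    then have eq: "exp_diff a b s = (1 - exp (- y)) * exp (- (a * s))"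
      unfolding exp_diff_def by (simp only: exp_add) (simp add: algebra_simps)
    have "0 \<le> 1 - exp (- y)" "1 - exp (- y) \<le> 1" "1 - exp (- y) \<le> y"
      using y exp_ge_add_one_self[of "- y"] by auto
    then show ?thesis
      unfolding eq abs_mult y_def[symmetric] by (auto intro!: mult_right_mono)
  qed
  have "\<bar>exp_diff a b s\<bar> \<le> exp (- (min a b * s)) \<and> \<bar>exp_diff a b s\<bar> \<le> \<bar>a - b\<bar> * s * exp (- (min a b * s))"
  proof (cases "a \<le> b")
    case True
    then show ?thesis using *[of a b] by (simp add: min_def)
  next
    case False
    moreover have "\<bar>exp_diff a b s\<bar> = \<bar>exp_diff b a s\<bar>" by (simp add: exp_diff_def)
    ultimately show ?thesis using *[of b a] by (simp add: min_def)
  qed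
  then show "\<bar>exp_diff a b s\<bar> \<le> exp (- (min a b * s))"
    "\<bar>exp_diff a b s\<bar> \<le> \<bar>a - b\<bar> * s * exp (- (min a b * s))" by auto
qed

definition heat_dx :: "2 \<Rightarrow> real \<Rightarrow> real^2 \<Rightarrow> real" where
  "heat_dx i s x = (- 1 / (2 * s)) * (x $ i) * heat s x"

lemma heat_dominated_diff:
  assumes "a > 0" "b > 0"
  shows "heat_dominated 2 (min a b) (\<lambda>s x. exp_diff a b s * heat s x)"
  unfolding heat_dominated_def
proof (intro conjI allI)
  show "(\<lambda>(s, x). exp_diff a b s * heat s x) \<in> borel_measurable (borel \<Otimes>\<^sub>M borel)"
    unfolding exp_diff_def by measurable
  fix s :: real and x :: "real^2"
  show "\<bar>exp_diff a b s * heat s x\<bar> \<le> 2 * exp (- (min a b * s)) * heat (2 * s) x"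
  proof (cases "s > 0")
    case True
    have "\<bar>exp_diff a b s\<bar> * heat s x \<le> exp (- (min a b * s)) * (2 * heat (2 * s) x)"
      by (intro mult_mono exp_diff_bound True heat_le_double heat_nonneg) auto
    then show ?thesis by (simp add: abs_mult heat_nonneg mult_ac)
  qed (simp add: heat_def)
qed (use assms in auto)

lemma heat_dominated_diff_dx:
  assumes "a > 0" "b > 0"
  shows "heat_dominated (2 * (1 + \<bar>a - b\<bar>)) (min a b) (\<lambda>s x. exp_diff a b s * heat_dx i s x)"
  unfolding heat_dominated_def
proof (intro conjI allI)
  have [measurable]: "(\<lambda>p::real \<times> (real^2). snd p $ i) \<in> borel_measurable (borel \<Otimes>\<^sub>M borel)"
    by (rule measurable_compose[OF measurable_snd borel_measurable_nth])
  show "(\<lambda>(s, x). exp_diff a b s * heat_dx i s x) \<in> borel_measurable (borel \<Otimes>\<^sub>M borel)"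
    unfolding exp_diff_def heat_dx_def by measurable
  fix s :: real and x :: "real^2"
  show "\<bar>exp_diff a b s * heat_dx i s x\<bar> \<le> 2 * (1 + \<bar>a - b\<bar>) * exp (- (min a b * s)) * heat (2 * s) x"
  proof (cases "s > 0")
    case True
    have "\<bar>exp_diff a b s\<bar> * (1 + 1 / s) \<le> (1 + \<bar>a - b\<bar>) * exp (- (min a b * s))"
    proof -
      have "\<bar>exp_diff a b s\<bar> * (1 / s) \<le> \<bar>a - b\<bar> * s * exp (- (min a b * s)) * (1 / s)"
        using True by (intro mult_right_mono exp_diff_bound) auto
      then show ?thesis
        using exp_diff_bound(1)[OF True, of a b] True by (simp add: algebra_simps)
    qed
    then have "(\<bar>exp_diff a b s\<bar> * (1 + 1 / s)) * (2 * heat (2 * s) x)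
        \<le> ((1 + \<bar>a - b\<bar>) * exp (- (min a b * s))) * (2 * heat (2 * s) x)"
      by (rule mult_right_mono) (simp add: heat_nonneg)
    then have "\<bar>exp_diff a b s\<bar> * ((1 + 1 / s) * 2 * heat (2 * s) x)
        \<le> 2 * (1 + \<bar>a - b\<bar>) * exp (- (min a b * s)) * heat (2 * s) x"
      by (simp only: mult_ac)
    moreover have "\<bar>exp_diff a b s\<bar> * \<bar>heat_dx i s x\<bar> \<le> \<bar>exp_diff a b s\<bar> * ((1 + 1 / s) * 2 * heat (2 * s) x)"
      using partial_deriv_heat_bound[OF True, of i x] unfolding partial_deriv_heat[OF True] heat_dx_def
      by (intro mult_left_mono) auto
    ultimately show ?thesis by (simp add: abs_mult)
  qed (simp add: heat_def heat_dx_def)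
qed (use assms in auto)

lemma heat_dominated_diff_dt:
  assumes "a > 0" "b > 0"
  shows "heat_dominated (4 * \<bar>a - b\<bar>) (min a b) (\<lambda>s x. exp_diff a b s * heat_dt s x)"
  unfolding heat_dominated_def
proof (intro conjI allI)
  show "(\<lambda>(s, x). exp_diff a b s * heat_dt s x) \<in> borel_measurable (borel \<Otimes>\<^sub>M borel)"
    unfolding exp_diff_def heat_dt_def by measurable
  fix s :: real and x :: "real^2"
  show "\<bar>exp_diff a b s * heat_dt s x\<bar> \<le> 4 * \<bar>a - b\<bar> * exp (- (min a b * s)) * heat (2 * s) x"
  proof (cases "s > 0")
    case True
    have "\<bar>exp_diff a b s\<bar> * \<bar>heat_dt s x\<bar> \<le> (\<bar>a - b\<bar> * s * exp (- (min a b * s))) * (4 / s * heat (2 * s) x)"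
      using True by (intro mult_mono exp_diff_bound heat_dt_bound) auto
    then show ?thesis using True by (simp add: abs_mult mult_ac)
  qed (simp add: heat_def heat_dt_def)
qed (use assms in auto)

lemma green_real_diff:
  assumes "a > 0" "b > 0" "x \<noteq> 0"
  shows "(\<integral>s. exp_diff a b s * heat s x \<partial>lborel) = green_real a x - green_real b x"
  using Bochner_Integration.integral_diff[OF green_real_heat(1)[OF assms(1,3)] green_real_heat(1)[OF assms(2,3)]]
    green_real_heat(2)[OF assms(1,3)] green_real_heat(2)[OF assms(2,3)]
  by (simp add: exp_diff_def left_diff_distrib)

definition green_diff_grad :: "real \<Rightarrow> real \<Rightarrow> real^2 \<Rightarrow> complex^2" where
  "green_diff_grad a b x = (\<chi> i. of_real (\<integral>s. exp_diff a b s * heat_dx i s x \<partial>lborel))"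

lemma green_diff_grad_L2:
  assumes "a > 0" "b > 0" shows "green_diff_grad a b \<in> L2"
proof -
  have "(\<lambda>x. complex_of_real (\<integral>s. exp_diff a b s * heat_dx i s x \<partial>lborel)) \<in> L2" for i
    by (intro L2_of_real superposition_L2[OF heat_dominated_diff_dx[OF assms]])
  then show ?thesis
    by (simp add: L2_vec_iff green_diff_grad_def)
qed

lemma has_weak_grad_green_diff:
  assumes "a > 0" "b > 0"
  shows "has_weak_grad (\<lambda>x. green a x - green b x) (green_diff_grad a b)"
  unfolding has_weak_grad_def
proof (intro allI impI)
  fix \<phi> :: "real^2 \<Rightarrow> real" and i :: 2 assume \<phi>: "test_function \<phi>"
  let ?L = "\<lambda>x. partial_deriv i \<phi> x *\<^sub>R (green a x - green b x)"
  let ?D = "\<lambda>x. (\<integral>s. exp_diff a b s * heat s x \<partial>lborel) *\<^sub>R complex_of_real (partial_deriv i \<phi> x)"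
  let ?A = "\<lambda>s x. (exp_diff a b s * heat s x) *\<^sub>R complex_of_real (partial_deriv i \<phi> x)"
  let ?B = "\<lambda>s x. (exp_diff a b s * heat_dx i s x) *\<^sub>R complex_of_real (\<phi> x)"
  note c1 = L2_of_real[OF test_function_L2[OF test_function_partial_deriv[OF \<phi>, of i]]]
  note c2 = L2_of_real[OF test_function_L2[OF \<phi>]]
  have gm: "green a \<in> borel_measurable borel" "green b \<in> borel_measurable borel"
    using green_L2 assms by (auto intro: L2_measurable)
  have "(\<integral>x. ?L x \<partial>lborel)
      = (\<integral>x. ?D x \<partial>lborel)"
  proof (rule integral_cong_AE)
    show "(\<lambda>x. ?L x) \<in> borel_measurable lborel"
      using gm L2_measurable[OF test_function_L2[OF test_function_partial_deriv[OF \<phi>, of i]]] by simp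
    show "(\<lambda>x. ?D x) \<in> borel_measurable lborel"
      using L2_measurable[OF superposition_L2[OF heat_dominated_diff[OF assms]]] L2_measurable[OF c1] by simp
    show "AE x in lborel. ?L x =
       ?D x"
      by (rule eventually_mono[OF AE_lborel_singleton[of 0]])
        (simp add: green_real_diff[OF assms] green_eq scaleR_conv_of_real)
  qed
  also have "\<dots> = (\<integral>s. (\<integral>x. ?A s x \<partial>lborel) \<partial>lborel)"
    by (rule superposition_integral(1)[OF heat_dominated_diff[OF assms] c1])
  also have "\<dots> = (\<integral>s. - (\<integral>x. ?B s x \<partial>lborel) \<partial>lborel)"
  proof (rule Bochner_Integration.integral_cong[OF refl])
    fix s :: real
    show "(\<integral>x. ?A s x \<partial>lborel)
      = - (\<integral>x. ?B s x \<partial>lborel)"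
    proof (cases "s > 0")
      case True
      have "(\<integral>x. ?A s x \<partial>lborel)
          = (\<integral>x. of_real (exp_diff a b s * (partial_deriv i \<phi> x * heat s x)) \<partial>lborel)"
        by (simp add: scaleR_conv_of_real mult_ac)
      also have "\<dots> = of_real (exp_diff a b s * (\<integral>x. partial_deriv i \<phi> x * heat s x \<partial>lborel))"
        by (simp only: integral_complex_of_real integral_mult_right_zero)
      also have "(\<integral>x. partial_deriv i \<phi> x * heat s x \<partial>lborel) = - (\<integral>x. \<phi> x * heat_dx i s x \<partial>lborel)"
        using integral_by_parts_test[OF \<phi> smooth_heat[OF True], of i]
        by (simp add: partial_deriv_heat[OF True] heat_dx_def)
      also have "of_real (exp_diff a b s * - (\<integral>x. \<phi> x * heat_dx i s x \<partial>lborel))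
          = - complex_of_real (\<integral>x. exp_diff a b s * (\<phi> x * heat_dx i s x) \<partial>lborel)"
        by (simp only: integral_mult_right_zero mult_minus_right of_real_minus)
      also have "complex_of_real (\<integral>x. exp_diff a b s * (\<phi> x * heat_dx i s x) \<partial>lborel)
          = (\<integral>x. ?B s x \<partial>lborel)"
        unfolding integral_complex_of_real[symmetric] by (simp add: scaleR_conv_of_real mult_ac)
      finally show ?thesis .
    qed (simp add: heat_def heat_dx_def)
  qed
  also have "\<dots> = - (\<integral>x. (\<integral>s. exp_diff a b s * heat_dx i s x \<partial>lborel) *\<^sub>R complex_of_real (\<phi> x) \<partial>lborel)"
    using superposition_integral(1)[OF heat_dominated_diff_dx[OF assms] c2] by simp
  also have "\<dots> = - (\<integral>x. \<phi> x *\<^sub>R (green_diff_grad a b x $ i) \<partial>lborel)"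
    by (simp add: green_diff_grad_def scaleR_conv_of_real mult.commute)
  finally show "(\<integral>x. ?L x \<partial>lborel)
    = - (\<integral>x. \<phi> x *\<^sub>R (green_diff_grad a b x $ i) \<partial>lborel)" .
qed

text \<open>
  Integration by parts in time; the boundary terms vanish because the heat kernel is flat at time zero
  away from the origin and decays for large times.
\<close>

lemma time_integral_heat_dt:
  assumes "a > 0" "b > 0" "x \<noteq> 0"
  shows "(\<integral>s. exp_diff a b s * heat_dt s x \<partial>lborel) = a * green_real a x - b * green_real b x"
proof -
  define F where "F s = exp_diff a b s * heat s x" for s
  define f1 where "f1 s = a * (exp (- (a * s)) * heat s x) - b * (exp (- (b * s)) * heat s x)" for s
  define f2 where "f2 s = exp_diff a b s * heat_dt s x" for s
  have i1: "integrable lborel f1"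
    unfolding f1_def[abs_def] using green_real_heat(1) assms
    by (intro Bochner_Integration.integrable_diff integrable_mult_right)
  have I1: "(\<integral>s. f1 s \<partial>lborel) = a * green_real a x - b * green_real b x"
    unfolding f1_def using assms
    by (simp add: green_real_heat Bochner_Integration.integral_diff)
  have i2: "integrable lborel f2"
    unfolding f2_def[abs_def] by (rule heat_dominated_integrable(1)[OF heat_dominated_diff_dt[OF assms(1,2)] assms(3)])
  have ein: "einterval 0 \<infinity> = {0<..}"
    by (auto simp: einterval_def)
  have ind: "indicator {0<..} s *\<^sub>R (f2 s - f1 s) = f2 s - f1 s" for s
    by (auto simp: indicator_def f1_def f2_def heat_def heat_dt_def)
  have bnd: "\<bar>F s\<bar> \<le> heat s x" if "s > 0" for s
  proof -
    have "\<bar>exp_diff a b s\<bar> \<le> 1"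
      using exp_diff_bound(1)[OF that, of a b] assms that by (smt (verit) exp_le_one_iff mult_pos_pos)
    then show ?thesis
      unfolding F_def abs_mult using heat_nonneg[of s x] mult_right_mono[of "\<bar>exp_diff a b s\<bar>" 1 "heat s x"] by simp
  qed
  have flat: "heat s x = flat ((norm x)\<^sup>2 / 4) 1 s / (4 * pi)" for s
    by (simp add: heat_def flat_def)
  have c: "(norm x)\<^sup>2 / 4 > 0" using assms by simp
  define K where "K = (fact (1 + 2) / ((norm x)\<^sup>2 / 4) ^ (1 + 2) :: real)"
  have "(LBINT s=0..\<infinity>. f2 s - f1 s) = 0 - 0"
  proof (rule interval_integral_FTC_integrable[where F=F])
    fix s :: real assume "(0::ereal) < ereal s"
    then have s: "s > 0" by (simp add: zero_ereal_def)
    have "(F has_real_derivative f2 s - f1 s) (at s)"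
      unfolding F_def[abs_def] exp_diff_def
      by (rule derivative_eq_intros heat_has_time_derivative s refl)+
        (simp add: f1_def f2_def exp_diff_def algebra_simps)
    then show "(F has_vector_derivative f2 s - f1 s) (at s)"
      by (simp add: has_real_derivative_iff_has_vector_derivative)
    have hc: "isCont (\<lambda>s. heat s x) s"
      using DERIV_isCont[OF heat_has_time_derivative[OF s]] .
    show "isCont (\<lambda>s. f2 s - f1 s) s"
      unfolding f1_def f2_def exp_diff_def heat_dt_def
      using s by (intro continuous_intros hc) auto
  next
    show "set_integrable lborel (einterval 0 \<infinity>) (\<lambda>s. f2 s - f1 s)"
      unfolding set_integrable_def ein ind by (intro Bochner_Integration.integrable_diff i1 i2)
    have "(F \<longlongrightarrow> 0) (at_right 0)"
    proof (rule Lim_null_comparison)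
      show "\<forall>\<^sub>F s in at_right 0. norm (F s) \<le> K * s\<^sup>2 / (4 * pi)"
      proof (rule eventually_at_rightI[of 0 1])
        fix s :: real assume "s \<in> {0<..<1}"
        then have "\<bar>F s\<bar> \<le> heat s x" by (intro bnd) simp
        also have "\<dots> \<le> K * s\<^sup>2 / (4 * pi)"
          unfolding flat K_def using flat_bound[OF c, of 1 s] by (intro divide_right_mono) auto
        finally show "norm (F s) \<le> K * s\<^sup>2 / (4 * pi)" by simp
      qed simp
      show "((\<lambda>s. K * s\<^sup>2 / (4 * pi)) \<longlongrightarrow> 0) (at_right 0)"
        by (auto intro!: tendsto_eq_intros)
    qed
    then show "((F \<circ> real_of_ereal) \<longlongrightarrow> 0) (at_right 0)"
      by (simp add: ereal_tendsto_simps zero_ereal_def)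
    have "(F \<longlongrightarrow> 0) at_top"
    proof (rule Lim_null_comparison)
      show "\<forall>\<^sub>F s in at_top. norm (F s) \<le> 1 / (4 * pi * s)"
      proof (rule eventually_mono[OF eventually_gt_at_top[of 0]])
        fix s :: real assume s: "0 < s"
        then have "\<bar>F s\<bar> \<le> heat s x" by (intro bnd) simp
        also have "\<dots> \<le> 1 / (4 * pi * s)"
          using s by (simp add: heat_def divide_right_mono)
        finally show "norm (F s) \<le> 1 / (4 * pi * s)" by simp
      qed
      show "((\<lambda>s. 1 / (4 * pi * s)) \<longlongrightarrow> 0) at_top" by real_asymp
    qed
    then show "((F \<circ> real_of_ereal) \<longlongrightarrow> 0) (at_left \<infinity>)"
      by (simp add: ereal_tendsto_simps)
  qed auto
  then have "(\<integral>s. f2 s - f1 s \<partial>lborel) = 0"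
    by (simp add: interval_lebesgue_integral_def set_lebesgue_integral_def ein ind del: real_scaleR_def)
  then have "(\<integral>s. f2 s \<partial>lborel) = a * green_real a x - b * green_real b x"
    using I1 Bochner_Integration.integral_diff[OF i2 i1] by simp
  then show ?thesis unfolding f2_def .
qed

text \<open>
  The weak form of \<open>- \<Delta> (G\<^sub>a - G\<^sub>b) = b G\<^sub>b - a G\<^sub>a\<close>, tested with functions of the Sobolev
  space. For a fixed time the derivatives of the heat kernel may be used as test functions. Then
  \<open>\<Delta>\<close> is replaced by the time derivative through the heat equation, and the integral over time is
  evaluated by parts.
\<close>

lemma green_diff_grad_weak_equation:
  assumes "a > 0" "b > 0" "f \<in> L2" "F \<in> L2" "has_weak_grad f F"
  shows "herm_vec (green_diff_grad a b) F = b * herm (green b) f - a * herm (green a) f"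
proof -
  let ?P = "\<lambda>s i. \<integral>x. (exp_diff a b s * heat_dx i s x) *\<^sub>R (F x $ i) \<partial>lborel"
  let ?S = "\<lambda>s i. \<integral>x. partial_deriv i (partial_deriv i (heat s)) x *\<^sub>R f x \<partial>lborel"
  let ?T = "\<lambda>x. (\<integral>s. exp_diff a b s * heat_dt s x \<partial>lborel) *\<^sub>R f x"
  let ?R = "\<lambda>x. a * (cnj (green a x) * f x) - b * (cnj (green b x) * f x)"
  have c1: "(\<lambda>x. F x $ i) \<in> L2" for i using assms by (simp add: L2_vec_nth)
  have "herm_vec (green_diff_grad a b) F
     = (\<Sum>i\<in>UNIV. (\<integral>x. (\<integral>s. exp_diff a b s * heat_dx i s x \<partial>lborel) *\<^sub>R (F x $ i) \<partial>lborel))"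
    by (simp add: herm_vec_def herm_def green_diff_grad_def scaleR_conv_of_real)
  also have "\<dots> = (\<Sum>i\<in>UNIV. (\<integral>s. ?P s i \<partial>lborel))"
    by (intro sum.cong refl superposition_integral(1)[OF heat_dominated_diff_dx[OF assms(1,2)] c1])
  also have "\<dots> = (\<integral>s. (\<Sum>i\<in>UNIV. ?P s i) \<partial>lborel)"
    by (intro Bochner_Integration.integral_sum[symmetric] superposition_integral(2)[OF heat_dominated_diff_dx[OF assms(1,2)] c1])
  also have "\<dots> = (\<integral>s. - (\<integral>x. (exp_diff a b s * heat_dt s x) *\<^sub>R f x \<partial>lborel) \<partial>lborel)"
  proof (rule Bochner_Integration.integral_cong[OF refl])
    fix s :: real
    show "(\<Sum>i\<in>UNIV. ?P s i)
        = - (\<integral>x. (exp_diff a b s * heat_dt s x) *\<^sub>R f x \<partial>lborel)"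
    proof (cases "s > 0")
      case True
      have "(\<Sum>i\<in>UNIV. ?P s i)
         = (\<Sum>i\<in>UNIV. exp_diff a b s *\<^sub>R (\<integral>x. partial_deriv i (heat s) x *\<^sub>R (F x $ i) \<partial>lborel))"
      proof -
        have "(exp_diff a b s * heat_dx i s x) *\<^sub>R z = exp_diff a b s *\<^sub>R (partial_deriv i (heat s) x *\<^sub>R z)"
          for x i and z :: complex
          by (simp add: partial_deriv_heat[OF True] heat_dx_def)
        then show ?thesis by (simp only: integral_scaleR_right)
      qed
      also have "\<dots> = (\<Sum>i\<in>UNIV. exp_diff a b s *\<^sub>R (- ?S s i))"
        using weak_grad_square_integrable_test[OF assms(5,3,4) smooth_partial_deriv[OF smooth_heat[OF True]]
            partial_deriv_heat_L2[OF True]] by simp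
      also have "\<dots> = - exp_diff a b s *\<^sub>R (\<Sum>i\<in>UNIV. ?S s i)"
        by (simp add: scaleR_sum_right sum_negf)
      also have "(\<Sum>i\<in>UNIV. ?S s i)
         = (\<integral>x. heat_dt s x *\<^sub>R f x \<partial>lborel)"
        unfolding laplace_heat[OF True, symmetric] scaleR_sum_left
        by (intro Bochner_Integration.integral_sum[symmetric] integrable_scaleR_L2 partial_deriv_heat_L2 True assms)
      finally show ?thesis
        by (simp flip: scaleR_scaleR)
    qed (simp add: heat_def heat_dx_def heat_dt_def)
  qed
  also have "\<dots> = - (\<integral>x. ?T x \<partial>lborel)"
    using superposition_integral(1)[OF heat_dominated_diff_dt[OF assms(1,2)] assms(3)] by simp
  also have "(\<integral>x. ?T x \<partial>lborel)
      = (\<integral>x. ?R x \<partial>lborel)"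
  proof (rule integral_cong_AE)
    show "(\<lambda>x. ?T x) \<in> borel_measurable lborel"
      using L2_measurable[OF superposition_L2[OF heat_dominated_diff_dt[OF assms(1,2)]]] L2_measurable[OF assms(3)] by simp
    show "(\<lambda>x. ?R x) \<in> borel_measurable lborel"
      using L2_measurable[OF green_L2[OF assms(1)]] L2_measurable[OF green_L2[OF assms(2)]] L2_measurable[OF assms(3)]
      by measurable
    show "AE x in lborel. ?T x
       = ?R x"
      by (rule eventually_mono[OF AE_lborel_singleton[of 0]])
        (simp add: time_integral_heat_dt[OF assms(1,2)] green_eq scaleR_conv_of_real left_diff_distrib mult.assoc)
  qed
  also have "\<dots> = a * herm (green a) f - b * herm (green b) f"
    using integrable_cnj_mult[OF green_L2[OF assms(1)] assms(3)] integrable_cnj_mult[OF green_L2[OF assms(2)] assms(3)]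
    by (simp add: herm_def)
  finally show ?thesis by simp
qed

section \<open>The quadratic form of the point interaction\<close>

text \<open>
  The charge is an explicit argument of the form, since its uniqueness is itself a consequence of the
  theory below. The form belongs to the linear part of the equation; the nonlinearity enters through the
  value of a real coupling constant only.
\<close>

definition has_charge :: "real \<Rightarrow> (real^2 \<Rightarrow> complex) \<Rightarrow> complex \<Rightarrow> bool" where
  "has_charge a \<psi> q \<longleftrightarrow> (\<lambda>x. \<psi> x - q * green a x) \<in> H1"

definition form :: "real \<Rightarrow> (real^2 \<Rightarrow> complex) \<Rightarrow> complex \<Rightarrow> (real^2 \<Rightarrow> complex) \<Rightarrow> complex \<Rightarrow> complex" where
  "form a \<psi> q \<psi>' q' =
     herm_vec (weak_grad (\<lambda>x. \<psi> x - q * green a x)) (weak_grad (\<lambda>x. \<psi>' x - q' * green a x))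
     + a * herm (\<lambda>x. \<psi> x - q * green a x) (\<lambda>x. \<psi>' x - q' * green a x) - a * herm \<psi> \<psi>'"

lemma herm_diff_left: "f \<in> L2 \<Longrightarrow> g \<in> L2 \<Longrightarrow> h \<in> L2 \<Longrightarrow> herm (\<lambda>x. f x - g x) h = herm f h - herm g h"
  by (simp add: herm_def ring_distribs integrable_cnj_mult)

lemma H1_weak_grad:
  assumes "f \<in> H1"
  shows "f \<in> L2" "weak_grad f \<in> L2" "has_weak_grad f (weak_grad f)"
  using assms weak_grad_eq unfolding H1_def by blast+

lemma H1_I: "f \<in> L2 \<Longrightarrow> F \<in> L2 \<Longrightarrow> has_weak_grad f F \<Longrightarrow> f \<in> H1"
  by (auto simp: H1_def)

lemma L2_cmult_vec: "F \<in> L2 \<Longrightarrow> (\<lambda>x. c *s F x :: complex^2) \<in> L2"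
  by (simp add: L2_vec_iff L2_cmult)

lemma H1_add: "f \<in> H1 \<Longrightarrow> g \<in> H1 \<Longrightarrow> (\<lambda>x. f x + g x) \<in> H1"
  by (rule H1_I[where F="\<lambda>x. weak_grad f x + weak_grad g x"])
    (auto intro!: L2_add has_weak_grad_add intro: H1_weak_grad)

lemma H1_cmult: "f \<in> H1 \<Longrightarrow> (\<lambda>x. c * f x) \<in> H1"
  by (rule H1_I[where F="\<lambda>x. c *s weak_grad f x"])
    (auto intro!: L2_cmult L2_cmult_vec has_weak_grad_cmult intro: H1_weak_grad)

lemma H1_diff: "f \<in> H1 \<Longrightarrow> g \<in> H1 \<Longrightarrow> (\<lambda>x. f x - g x) \<in> H1"
  using H1_add[of f "\<lambda>x. - 1 * g x"] H1_cmult[of g "- 1"] by simp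

lemma H1_zero: "(\<lambda>x. 0) \<in> H1"
  by (rule H1_I[of _ "\<lambda>x. 0"]) (auto simp: L2_zero has_weak_grad_def)

lemma H1_green_diff: "a > 0 \<Longrightarrow> b > 0 \<Longrightarrow> (\<lambda>x. green a x - green b x) \<in> H1"
  by (rule H1_I[OF L2_diff green_diff_grad_L2 has_weak_grad_green_diff])
    (auto intro: green_L2)

lemma has_charge_change:
  assumes "has_charge a \<psi> q" "a > 0" "b > 0"
  shows "has_charge b \<psi> q"
proof -
  have "(\<lambda>x. (\<psi> x - q * green a x) + q * (green a x - green b x)) \<in> H1"
    using assms by (intro H1_add H1_cmult H1_green_diff) (auto simp: has_charge_def)
  then show ?thesis by (simp add: has_charge_def algebra_simps)
qed

lemma has_charge_L2:
  assumes "has_charge a \<psi> q" "a > 0" shows "\<psi> \<in> L2"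
proof -
  have "(\<lambda>x. (\<psi> x - q * green a x) + q * green a x) \<in> L2"
    using assms by (intro L2_add L2_cmult green_L2 H1_weak_grad(1)) (auto simp: has_charge_def)
  then show ?thesis by simp
qed

lemma has_charge_cmult: "has_charge a \<psi> q \<Longrightarrow> has_charge a (\<lambda>x. c * \<psi> x) (c * q)"
  using H1_cmult[of "\<lambda>x. \<psi> x - q * green a x" c] by (simp add: has_charge_def algebra_simps)

lemma has_charge_green: "has_charge a (\<lambda>x. q * green a x) q"
  by (simp add: has_charge_def H1_zero)

lemma has_charge_H1: "f \<in> H1 \<Longrightarrow> has_charge a f 0"
  by (simp add: has_charge_def)

text \<open>
  If \<open>G\<^sub>a\<close> had a square integrable gradient \<open>F\<close>, the weak equation for \<open>G\<^sub>a - G\<^sub>b\<close>, whose gradient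
  is \<open>P\<close>, could be tested with \<open>G\<^sub>a\<close> itself. Let \<open>L = ln (b / a) / (4 \<pi>)\<close>. Then \<open>\<langle>P, F\<rangle>\<close> is
  at least of size \<open>L\<close>, up to a constant, while the square of the norm of \<open>P\<close> is at most \<open>3 L\<close>. For
  large \<open>b\<close> this contradicts the Cauchy-Schwarz inequality. With \<open>K\<close> the square of the norm of \<open>F\<close>,
  the choice \<open>L = 3 K + 1\<close> suffices.
\<close>

lemma green_not_H1:
  assumes a: "a > 0" shows "green a \<notin> H1"
proof
  assume "green a \<in> H1"
  note G = H1_weak_grad[OF this]
  define F where "F = weak_grad (green a)"
  define K where "K = Re (herm_vec F F)"
  have F: "F \<in> L2" "has_weak_grad (green a) F" using G by (auto simp: F_def)
  have K: "K \<ge> 0" using herm_vec_self[OF F(1)] by (simp add: K_def)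
  define L where "L = 3 * K + 1"
  define b where "b = a * exp (4 * pi * L)"
  have "L \<ge> 1" using K by (simp add: L_def)
  have "1 \<le> 4 * pi * L"
    using mult_mono[of 1 "4 * pi" 1 L] \<open>L \<ge> 1\<close> pi_ge_two by simp
  then have "2 \<le> exp (4 * pi * L)"
    using exp_ge_add_one_self[of "4 * pi * L"] by linarith
  then have b: "2 * a \<le> b" "b > 0" using a by (auto simp: b_def)
  define P where "P = green_diff_grad a b"
  define p where "p = green_pairing b a"
  have PL: "P \<in> L2" unfolding P_def by (rule green_diff_grad_L2[OF a b(2)])
  have p: "p > 0" unfolding p_def by (rule green_pairing_pos[OF b(2) a])
  have L: "(b - a) * p = L"
    unfolding p_def green_pairing_eq[OF b(2) a] using a by (simp add: b_def)
  have aa: "a * green_pairing a a = 1 / (4 * pi)" and bb: "b * green_pairing b b = 1 / (4 * pi)"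
    using a b by (auto simp: green_pairing_def)
  have hab: "herm (green a) (green b) = of_real p"
    using herm_cnj[of "green b" "green a"] by (simp add: herm_green_green a b p_def)
  have hba: "herm (green b) (green a) = of_real p"
    by (simp add: herm_green_green a b p_def)
  have PF: "herm_vec P F = of_real (b * p - 1 / (4 * pi))"
  proof -
    have "complex_of_real a * of_real (green_pairing a a) = of_real (1 / (4 * pi))"
      by (simp only: of_real_mult[symmetric] aa)
    then show ?thesis
      using green_diff_grad_weak_equation[OF a b(2) G(1) F]
      by (simp add: P_def hba herm_green_green a)
  qed
  have "herm_vec P P = b * herm (green b) (\<lambda>x. green a x - green b x) - a * herm (green a) (\<lambda>x. green a x - green b x)"
    unfolding P_def
    by (rule green_diff_grad_weak_equation[OF a b(2) _ green_diff_grad_L2[OF a b(2)] has_weak_grad_green_diff[OF a b(2)]])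
      (intro L2_diff green_L2 a b)
  also have "\<dots> = of_real (b * (p - green_pairing b b) - a * (green_pairing a a - p))"
    using a b by (simp add: herm_diff_right green_L2 hab hba herm_green_green)
  finally have "Re (herm_vec P P) = b * (p - green_pairing b b) - a * (green_pairing a a - p)"
    by (simp only: Re_complex_of_real)
  also have "\<dots> = (a + b) * p - 1 / (2 * pi)"
    using aa bb by (simp add: algebra_simps)
  also have "\<dots> \<le> (a + b) * p" by simp
  \<comment> \<open>This is where \<open>b \<ge> 2 a\<close> enters.\<close>
  also have "\<dots> \<le> (3 * (b - a)) * p"
    using b p by (intro mult_right_mono) auto
  also have "\<dots> = 3 * L" using L by (simp only: mult.assoc)
  finally have PP: "Re (herm_vec P P) \<le> 3 * L" .
  have "L \<le> b * p" using L a p by (simp add: algebra_simps)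
  have "b * p - 1 / (4 * pi) \<le> cmod (herm_vec P F)"
    unfolding PF by (simp only: norm_of_real abs_ge_self)
  also have "\<dots> \<le> (1 / 3 * Re (herm_vec P P) + Re (herm_vec F F) / (1 / 3)) / 2"
    by (rule herm_vec_bound[OF PL F(1)]) simp
  also have "\<dots> \<le> (L + 3 * K) / 2"
    using PP by (simp add: K_def)
  finally have "L - 1 / (4 * pi) \<le> (L + 3 * K) / 2"
    using \<open>L \<le> b * p\<close> by simp
  then have "1 \<le> 1 / (2 * pi)" by (simp add: L_def)
  moreover have "1 / (2 * pi) \<le> 1 / 4" using pi_ge_two by (intro divide_left_mono) auto
  ultimately show False by simp
qed

lemma has_charge_unique:
  assumes "has_charge a \<psi> q" "has_charge a \<psi> q'" "a > 0"
  shows "q = q'"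
proof (rule ccontr)
  assume "q \<noteq> q'"
  have "(\<lambda>x. (\<psi> x - q' * green a x) - (\<psi> x - q * green a x)) \<in> H1"
    by (rule H1_diff[OF assms(2)[unfolded has_charge_def] assms(1)[unfolded has_charge_def]])
  then have "(\<lambda>x. 1 / (q - q') * ((\<psi> x - q' * green a x) - (\<psi> x - q * green a x))) \<in> H1"
    by (rule H1_cmult)
  also have "(\<lambda>x. 1 / (q - q') * ((\<psi> x - q' * green a x) - (\<psi> x - q * green a x))) = green a"
    using \<open>q \<noteq> q'\<close> by (auto simp: fun_eq_iff field_simps)
  finally show False using green_not_H1[OF assms(3)] by simp
qed

lemma charge_eq: "has_charge a \<psi> q \<Longrightarrow> a > 0 \<Longrightarrow> charge a \<psi> = q"
  unfolding charge_def using has_charge_unique by (intro the_equality) (auto simp: has_charge_def)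

lemma energy_space_iff: "a > 0 \<Longrightarrow> \<psi> \<in> energy_space a \<longleftrightarrow> (\<exists>q. has_charge a \<psi> q)"
  unfolding energy_space_def using has_charge_L2 by (auto simp: has_charge_def)

subsection \<open>Properties of the form\<close>

lemma form_eqI:
  assumes "f \<in> L2" "F \<in> L2" "has_weak_grad f F" "g \<in> L2" "G \<in> L2" "has_weak_grad g G"
    "\<And>x. \<psi> x - q * green a x = f x" "\<And>x. \<psi>' x - q' * green a x = g x"
  shows "form a \<psi> q \<psi>' q' = herm_vec F G + a * herm f g - a * herm \<psi> \<psi>'"
proof -
  have eq: "(\<lambda>x. \<psi> x - q * green a x) = f" "(\<lambda>x. \<psi>' x - q' * green a x) = g"
    using assms(7,8) by auto
  have "herm_vec (weak_grad f) (weak_grad g) = herm_vec F G"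
    using weak_grad_eq[OF assms(3,2)] weak_grad_eq[OF assms(6,5)] assms by (intro herm_vec_cong_AE)
  then show ?thesis by (simp add: form_def eq)
qed

lemma form_cnj: "cnj (form a \<psi> q \<psi>' q') = form a \<psi>' q' \<psi> q"
  by (simp add: form_def herm_cnj herm_vec_cnj)

lemma form_cmult_right:
  assumes "has_charge a \<psi> q" "has_charge a \<psi>' q'"
  shows "form a \<psi> q (\<lambda>x. c * \<psi>' x) (c * q') = c * form a \<psi> q \<psi>' q'"
proof -
  note f = H1_weak_grad[OF assms(1)[unfolded has_charge_def]]
  note g = H1_weak_grad[OF assms(2)[unfolded has_charge_def]]
  have "form a \<psi> q (\<lambda>x. c * \<psi>' x) (c * q') =
     herm_vec (weak_grad (\<lambda>x. \<psi> x - q * green a x)) (\<lambda>x. c *s weak_grad (\<lambda>x. \<psi>' x - q' * green a x) x)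
     + a * herm (\<lambda>x. \<psi> x - q * green a x) (\<lambda>x. c * (\<psi>' x - q' * green a x)) - a * herm \<psi> (\<lambda>x. c * \<psi>' x)"
    by (rule form_eqI[OF f L2_cmult[OF g(1)] L2_cmult_vec[OF g(2)] has_weak_grad_cmult[OF g(3)]])
      (auto simp: algebra_simps)
  also have "\<dots> = c * form a \<psi> q \<psi>' q'"
    unfolding form_def herm_vec_cmult_right herm_cmult_right
    by (simp only: right_diff_distrib distrib_left mult.left_commute)
  finally show ?thesis .
qed

text \<open>
  A change of the spectral parameter moves a multiple of \<open>G\<^sub>a - G\<^sub>b\<close> into the regular parts. By the
  weak equation all terms containing the regular parts cancel, and what remains is a multiple of the
  product of the charges. This is the mechanism behind the independence of the equation of
  the spectral parameter: the constant equals the change of the logarithm in \<^const>\<open>theta\<close>.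
\<close>

lemma form_change:
  assumes "has_charge a \<psi> q" "has_charge a \<psi>' q'" and a: "a > 0" and b: "b > 0"
  shows "form b \<psi> q \<psi>' q' = form a \<psi> q \<psi>' q' - of_real (ln (b / a) / (4 * pi)) * cnj q * q'"
proof -
  define f where "f x = \<psi> x - q * green a x" for x
  define g where "g x = \<psi>' x - q' * green a x" for x
  define F where "F = weak_grad f"
  define G where "G = weak_grad g"
  define D where "D x = green a x - green b x" for x
  define P where "P = green_diff_grad a b"
  have f: "f \<in> L2" "F \<in> L2" "has_weak_grad f F"
    using H1_weak_grad[OF assms(1)[unfolded has_charge_def]] by (auto simp: f_def[abs_def] F_def)
  have g: "g \<in> L2" "G \<in> L2" "has_weak_grad g G"
    using H1_weak_grad[OF assms(2)[unfolded has_charge_def]] by (auto simp: g_def[abs_def] G_def)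
  have A: "green a \<in> L2" "green b \<in> L2" using green_L2 a b by auto
  have D: "D \<in> L2" "P \<in> L2" "has_weak_grad D P"
    unfolding D_def P_def using a b
    by (auto intro!: L2_diff green_L2 green_diff_grad_L2 has_weak_grad_green_diff)
  have qD: "(\<lambda>x. c * D x) \<in> L2" "(\<lambda>x. c *s P x) \<in> L2" for c
    using D by (auto intro: L2_cmult L2_cmult_vec)
  have 0: "form b \<psi> q \<psi>' q' = herm_vec (\<lambda>x. F x + q *s P x) (\<lambda>x. G x + q' *s P x)
      + b * herm (\<lambda>x. f x + q * D x) (\<lambda>x. g x + q' * D x) - b * herm \<psi> \<psi>'"
    by (rule form_eqI[OF L2_add[OF f(1) qD(1)] L2_add[OF f(2) qD(2)]
          has_weak_grad_add[OF f(3) has_weak_grad_cmult[OF D(3)] f(1) qD(1) f(2) qD(2)]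
          L2_add[OF g(1) qD(1)] L2_add[OF g(2) qD(2)]
          has_weak_grad_add[OF g(3) has_weak_grad_cmult[OF D(3)] g(1) qD(1) g(2) qD(2)]])
      (auto simp: f_def g_def D_def algebra_simps)
  have hp: "herm \<psi> \<psi>' = herm (\<lambda>x. f x + q * green a x) (\<lambda>x. g x + q' * green a x)"
    by (simp add: f_def g_def)
  have 1: "form b \<psi> q \<psi>' q' = herm_vec (\<lambda>x. F x + q *s P x) (\<lambda>x. G x + q' *s P x)
      + b * herm (\<lambda>x. f x + q * D x) (\<lambda>x. g x + q' * D x)
      - b * herm (\<lambda>x. f x + q * green a x) (\<lambda>x. g x + q' * green a x)"
    unfolding 0 hp ..
  have 2: "form a \<psi> q \<psi>' q' = herm_vec F G + a * herm f g
      - a * herm (\<lambda>x. f x + q * green a x) (\<lambda>x. g x + q' * green a x)"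
    unfolding hp[symmetric] by (rule form_eqI[OF f g]) (auto simp: f_def g_def)
  define p where "p = complex_of_real (green_pairing b a)"
  have hab: "herm (green a) (green b) = p" "herm (green b) (green a) = p"
    using herm_cnj[of "green b" "green a"] herm_green_green[OF b a] by (auto simp: p_def)
  have fD: "herm f D = herm f (green a) - herm f (green b)" "herm D g = herm (green a) g - herm (green b) g"
    unfolding D_def[abs_def] using f g A by (simp_all add: herm_diff_right herm_diff_left)
  have AD: "herm (green a) D = herm (green a) (green a) - p" "herm (green b) D = p - herm (green b) (green b)"
    "herm D (green a) = herm (green a) (green a) - p" "herm D (green b) = p - herm (green b) (green b)"
    unfolding D_def[abs_def] using A by (simp_all add: herm_diff_right herm_diff_left hab)
  have DD: "herm D D = herm D (green a) - herm D (green b)"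
    using herm_diff_right[OF D(1) A] by (simp add: D_def[abs_def])
  have PG: "herm_vec P G = b * herm (green b) g - a * herm (green a) g"
    unfolding P_def by (rule green_diff_grad_weak_equation[OF a b g])
  have FP: "herm_vec F P = b * herm f (green b) - a * herm f (green a)"
    using arg_cong[OF green_diff_grad_weak_equation[OF a b f], of cnj]
    by (simp add: P_def herm_vec_cnj herm_cnj)
  have PP: "herm_vec P P = b * herm (green b) D - a * herm (green a) D"
    unfolding P_def by (rule green_diff_grad_weak_equation[OF a b D(1) D(2,3)[unfolded P_def]])
  have pe: "of_real (ln (b / a) / (4 * pi)) = (of_real b - of_real a) * p"
    unfolding p_def green_pairing_eq[OF b a, symmetric] by simp
  show ?thesis
    unfolding 1 2 pe
    using f g A D qD L2_cmult[OF A(1)]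
    by (simp add: herm_vec_add_right herm_vec_add_left herm_vec_cmult_left herm_vec_cmult_right
        herm_add_right herm_add_left herm_cmult_left herm_cmult_right L2_add
        PG FP PP fD DD AD algebra_simps)
qed

subsection \<open>Dilations\<close>

lemma integral_dilate:
  fixes f :: "real^2 \<Rightarrow> complex"
  assumes "s > 0" and [measurable]: "f \<in> borel_measurable borel"
  shows "(\<integral>x. f (s *\<^sub>R x) \<partial>lborel) = (1 / s\<^sup>2) *\<^sub>R (\<integral>x. f x \<partial>lborel)"
proof -
  have "(\<integral>x. f x \<partial>lborel) = (\<integral>x. f x \<partial>(density (distr lborel borel (\<lambda>x::real^2. 0 + s *\<^sub>R x)) (\<lambda>_. ennreal (s\<^sup>2))))"
    using lborel_affine[of s "0::real^2"] assms(1) by (simp add: ennreal_power)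
  also have "\<dots> = s\<^sup>2 *\<^sub>R (\<integral>x. f (s *\<^sub>R x) \<partial>lborel)"
    by (subst integral_density) (simp_all add: integral_distr)
  finally show ?thesis using assms(1) by simp
qed

lemma L2_dilate:
  fixes f :: "real^2 \<Rightarrow> 'b::{banach, second_countable_topology}"
  assumes "f \<in> L2" "s > 0" shows "(\<lambda>x. f (s *\<^sub>R x)) \<in> L2"
proof -
  have m [measurable]: "f \<in> borel_measurable borel" using assms by (simp add: L2_measurable)
  have "integrable (density (distr lborel borel (\<lambda>x::real^2. 0 + s *\<^sub>R x)) (\<lambda>_. ennreal (s\<^sup>2))) (\<lambda>x. (norm (f x))\<^sup>2)"
    using lborel_affine[of s "0::real^2"] assms by (simp add: ennreal_power L2_integrable)
  then have "integrable lborel (\<lambda>x. s\<^sup>2 *\<^sub>R (norm (f (s *\<^sub>R x)))\<^sup>2)"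
    by (subst (asm) integrable_density) (simp_all add: integrable_distr_eq)
  then show ?thesis using assms(2) by (simp add: L2_def)
qed

lemma herm_dilate:
  assumes "f \<in> L2" "g \<in> L2" "s > 0"
  shows "herm (\<lambda>x. f (s *\<^sub>R x)) (\<lambda>x. g (s *\<^sub>R x)) = (1 / s\<^sup>2) *\<^sub>R herm f g"
  unfolding herm_def using assms
  by (intro integral_dilate[where f="\<lambda>x. cnj (f x) * g x"] borel_measurable_times borel_measurable_cnj L2_measurable)

lemma has_weak_grad_dilate:
  assumes "has_weak_grad f F" "f \<in> L2" "F \<in> L2" "s > 0"
  shows "has_weak_grad (\<lambda>x. f (s *\<^sub>R x)) (\<lambda>x. of_real s *s F (s *\<^sub>R x))"
  unfolding has_weak_grad_def
proof (intro allI impI)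
  fix \<phi> :: "real^2 \<Rightarrow> real" and i :: 2 assume \<phi>: "test_function \<phi>"
  define \<phi>' where "\<phi>' x = \<phi> ((1 / s) *\<^sub>R x)" for x
  have \<phi>': "test_function \<phi>'"
    unfolding \<phi>'_def[abs_def] using \<phi> assms(4) by (intro test_function_dilate) auto
  have pd: "partial_deriv i \<phi>' (s *\<^sub>R x) = (1 / s) * partial_deriv i \<phi> x" for x
    unfolding \<phi>'_def[abs_def] using partial_deriv_dilate[of \<phi> i "1 / s" "s *\<^sub>R x"] \<phi> assms(4)
    by (simp add: test_function_iff)
  have m: "(\<lambda>x. partial_deriv i \<phi>' x *\<^sub>R f x) \<in> borel_measurable borel" "(\<lambda>x. \<phi>' x *\<^sub>R (F x $ i)) \<in> borel_measurable borel"
    by (rule borel_measurable_scaleR[OF L2_measurable[OF test_function_L2[OF test_function_partial_deriv[OF \<phi>']]] L2_measurable[OF assms(2)]])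
      (rule borel_measurable_scaleR[OF L2_measurable[OF test_function_L2[OF \<phi>']] L2_measurable[OF L2_vec_nth[OF assms(3)]]])
  have "(\<integral>x. partial_deriv i \<phi> x *\<^sub>R f (s *\<^sub>R x) \<partial>lborel) = (\<integral>x. s *\<^sub>R (partial_deriv i \<phi>' (s *\<^sub>R x) *\<^sub>R f (s *\<^sub>R x)) \<partial>lborel)"
    using assms(4) by (simp add: pd)
  also have "\<dots> = s *\<^sub>R ((1 / s\<^sup>2) *\<^sub>R (\<integral>x. partial_deriv i \<phi>' x *\<^sub>R f x \<partial>lborel))"
    by (simp only: integral_scaleR_right integral_dilate[OF assms(4) m(1)])
  also have "\<dots> = - (s *\<^sub>R ((1 / s\<^sup>2) *\<^sub>R (\<integral>x. \<phi>' x *\<^sub>R (F x $ i) \<partial>lborel)))"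
    using has_weak_gradD[OF assms(1) \<phi>', of i] by simp
  also have "(1 / s\<^sup>2) *\<^sub>R (\<integral>x. \<phi>' x *\<^sub>R (F x $ i) \<partial>lborel) = (\<integral>x. \<phi>' (s *\<^sub>R x) *\<^sub>R (F (s *\<^sub>R x) $ i) \<partial>lborel)"
    using integral_dilate[OF assms(4) m(2)] by simp
  also have "- (s *\<^sub>R (\<integral>x. \<phi>' (s *\<^sub>R x) *\<^sub>R (F (s *\<^sub>R x) $ i) \<partial>lborel)) = - (\<integral>x. \<phi> x *\<^sub>R ((of_real s *s F (s *\<^sub>R x)) $ i) \<partial>lborel)"
  proof -
    have "s *\<^sub>R (\<phi> x *\<^sub>R z) = \<phi> x *\<^sub>R (of_real s * z)" for x and z :: complex
      by (simp add: scaleR_conv_of_real)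
    moreover have "\<phi>' (s *\<^sub>R x) = \<phi> x" for x
      using assms(4) by (simp add: \<phi>'_def)
    ultimately show ?thesis
      by (simp only: integral_scaleR_right[symmetric] vector_smult_component)
  qed
  finally show "(\<integral>x. partial_deriv i \<phi> x *\<^sub>R f (s *\<^sub>R x) \<partial>lborel) = - (\<integral>x. \<phi> x *\<^sub>R ((of_real s *s F (s *\<^sub>R x)) $ i) \<partial>lborel)" .
qed

text \<open>
  A dilation by \<open>s\<close> preserves charges and multiplies the spectral parameter by \<open>s\<^sup>2\<close>. The form is
  invariant because the Dirichlet integral is scale invariant in two dimensions.
\<close>

lemma green_dilate: "s > 0 \<Longrightarrow> green a (s *\<^sub>R x) = green (a * s\<^sup>2) x"
  by (simp add: green_def real_sqrt_mult mult.assoc)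

lemma has_charge_dilate:
  assumes "has_charge a \<psi> q" "s > 0"
  shows "has_charge (a * s\<^sup>2) (\<lambda>x. \<psi> (s *\<^sub>R x)) q"
proof -
  note f = H1_weak_grad[OF assms(1)[unfolded has_charge_def]]
  have "(\<lambda>x. \<psi> (s *\<^sub>R x) - q * green a (s *\<^sub>R x)) \<in> H1"
    using f assms(2)
    by (intro H1_I[OF L2_dilate[OF f(1)] _ has_weak_grad_dilate[OF f(3)]] L2_cmult_vec L2_dilate)
  then show ?thesis using assms(2) by (simp add: has_charge_def green_dilate)
qed

lemma form_dilate:
  assumes "has_charge a \<psi> q" "has_charge a \<psi>' q'" "s > 0" "a > 0"
  shows "form (a * s\<^sup>2) (\<lambda>x. \<psi> (s *\<^sub>R x)) q (\<lambda>x. \<psi>' (s *\<^sub>R x)) q' = form a \<psi> q \<psi>' q'"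
proof -
  define f where "f x = \<psi> x - q * green a x" for x
  define g where "g x = \<psi>' x - q' * green a x" for x
  define F where "F = weak_grad f"
  define G where "G = weak_grad g"
  have f: "f \<in> L2" "F \<in> L2" "has_weak_grad f F"
    using H1_weak_grad[OF assms(1)[unfolded has_charge_def]] by (auto simp: f_def[abs_def] F_def)
  have g: "g \<in> L2" "G \<in> L2" "has_weak_grad g G"
    using H1_weak_grad[OF assms(2)[unfolded has_charge_def]] by (auto simp: g_def[abs_def] G_def)
  have \<psi>: "\<psi> \<in> L2" "\<psi>' \<in> L2" using has_charge_L2 assms by blast+
  have "form (a * s\<^sup>2) (\<lambda>x. \<psi> (s *\<^sub>R x)) q (\<lambda>x. \<psi>' (s *\<^sub>R x)) q' =
      herm_vec (\<lambda>x. of_real s *s F (s *\<^sub>R x)) (\<lambda>x. of_real s *s G (s *\<^sub>R x))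
      + of_real (a * s\<^sup>2) * herm (\<lambda>x. f (s *\<^sub>R x)) (\<lambda>x. g (s *\<^sub>R x))
      - of_real (a * s\<^sup>2) * herm (\<lambda>x. \<psi> (s *\<^sub>R x)) (\<lambda>x. \<psi>' (s *\<^sub>R x))"
    by (rule form_eqI[OF L2_dilate[OF f(1) assms(3)] L2_cmult_vec[OF L2_dilate[OF f(2) assms(3)]]
          has_weak_grad_dilate[OF f(3,1,2) assms(3)]
          L2_dilate[OF g(1) assms(3)] L2_cmult_vec[OF L2_dilate[OF g(2) assms(3)]]
          has_weak_grad_dilate[OF g(3,1,2) assms(3)]])
      (auto simp: green_dilate[OF assms(3), symmetric] f_def g_def)
  also have "herm_vec (\<lambda>x. of_real s *s F (s *\<^sub>R x)) (\<lambda>x. of_real s *s G (s *\<^sub>R x)) = of_real (s\<^sup>2) * herm_vec (\<lambda>x. F (s *\<^sub>R x)) (\<lambda>x. G (s *\<^sub>R x))"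
    by (simp add: herm_vec_cmult_left herm_vec_cmult_right power2_eq_square)
  also have "herm_vec (\<lambda>x. F (s *\<^sub>R x)) (\<lambda>x. G (s *\<^sub>R x)) = (1 / s\<^sup>2) *\<^sub>R herm_vec F G"
    unfolding herm_vec_def scaleR_sum_right
    using f g assms(3) by (intro sum.cong refl herm_dilate[where f="\<lambda>x. F x $ _" and g="\<lambda>x. G x $ _"] L2_vec_nth)
  finally show ?thesis
    unfolding herm_dilate[OF f(1) g(1) assms(3)] herm_dilate[OF \<psi> assms(3)]
    using assms(3) by (simp add: form_def F_def G_def f_def[abs_def] g_def[abs_def] scaleR_conv_of_real power2_eq_square)
qed

section \<open>Stationary states\<close>

text \<open>
  The linear equation for the profile of a standing wave: the coupling constant \<open>\<tau>\<close> stands for the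
  value of \<^const>\<open>theta\<close> at the modulus of the charge.
\<close>

definition stationary :: "real \<Rightarrow> real \<Rightarrow> real \<Rightarrow> (real^2 \<Rightarrow> complex) \<Rightarrow> complex \<Rightarrow> bool" where
  "stationary a \<omega> \<tau> u q \<longleftrightarrow> has_charge a u q \<and>
     (\<forall>\<xi> p. has_charge a \<xi> p \<longrightarrow> - \<omega> * herm \<xi> u = form a \<xi> p u q + \<tau> * cnj p * q)"

lemma stationary_change:
  assumes "stationary a \<omega> \<tau> u q" "a > 0" "b > 0"
  shows "stationary b \<omega> (\<tau> + ln (b / a) / (4 * pi)) u q"
proof -
  have u: "has_charge a u q" using assms by (simp add: stationary_def)
  have "- \<omega> * herm \<xi> u = form b \<xi> p u q + of_real (\<tau> + ln (b / a) / (4 * pi)) * cnj p * q"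
    if "has_charge b \<xi> p" for \<xi> p
  proof -
    have \<xi>: "has_charge a \<xi> p" by (rule has_charge_change[OF that assms(3,2)])
    have "- \<omega> * herm \<xi> u = form a \<xi> p u q + \<tau> * cnj p * q"
      using assms(1) \<xi> by (simp add: stationary_def)
    then show ?thesis
      unfolding form_change[OF \<xi> u assms(2,3)] by (simp add: algebra_simps)
  qed
  then show ?thesis
    using has_charge_change[OF u assms(2,3)] by (simp add: stationary_def)
qed

lemma form_green_right:
  assumes "has_charge a \<xi> p" "a > 0"
  shows "form a \<xi> p (\<lambda>x. q * green a x) q = - a * herm \<xi> (\<lambda>x. q * green a x)"
proof -
  note f = H1_weak_grad[OF assms(1)[unfolded has_charge_def]]
  have "form a \<xi> p (\<lambda>x. q * green a x) q = herm_vec (weak_grad (\<lambda>x. \<xi> x - p * green a x)) (\<lambda>x. 0)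
    + a * herm (\<lambda>x. \<xi> x - p * green a x) (\<lambda>x. 0) - a * herm \<xi> (\<lambda>x. q * green a x)"
    by (rule form_eqI[OF f]) (auto simp: L2_zero has_weak_grad_def)
  then show ?thesis by simp
qed

lemma stationary_green:
  assumes "\<omega> > 0" shows "stationary \<omega> \<omega> 0 (\<lambda>x. q * green \<omega> x) q"
  using assms by (simp add: stationary_def has_charge_green form_green_right)

text \<open>
  For positive frequency the frequency itself may serve as spectral parameter. Then the equation,
  tested with the regular part of \<open>u\<close>, says that this regular part has \<open>H\<^sup>1\<close> norm zero; tested
  with Green's function, it becomes a condition on the charge.
\<close>

lemma stationary_positive:
  assumes "stationary \<omega> \<omega> \<tau> u q" "\<omega> > 0"
  shows "AE x in lborel. u x = q * green \<omega> x" "\<tau> * q = 0"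
proof -
  define f where "f x = u x - q * green \<omega> x" for x
  have u: "has_charge \<omega> u q" using assms by (simp add: stationary_def)
  have fH: "f \<in> H1" using u by (simp add: has_charge_def f_def[abs_def])
  note f = H1_weak_grad[OF fH]
  have "- \<omega> * herm f u = form \<omega> f 0 u q"
    using assms(1)[unfolded stationary_def, THEN conjunct2, rule_format, OF has_charge_H1[OF fH]] by simp
  also have "\<dots> = herm_vec (weak_grad f) (weak_grad f) + \<omega> * herm f f - \<omega> * herm f u"
    by (rule form_eqI[OF f f]) (auto simp: f_def)
  finally have "herm_vec (weak_grad f) (weak_grad f) + \<omega> * herm f f = 0" by simp
  then have "of_real ((L2_norm (weak_grad f))\<^sup>2 + \<omega> * (\<integral>x. (norm (f x))\<^sup>2 \<partial>lborel)) = (0::complex)"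
    unfolding herm_vec_self[OF f(2)] herm_self by simp
  then have "(L2_norm (weak_grad f))\<^sup>2 + \<omega> * (\<integral>x. (norm (f x))\<^sup>2 \<partial>lborel) = 0"
    by (simp only: of_real_eq_0_iff)
  moreover have "(\<integral>x. (norm (f x))\<^sup>2 \<partial>lborel) \<ge> 0" by simp
  ultimately have "(\<integral>x. (norm (f x))\<^sup>2 \<partial>lborel) = 0"
    using assms(2) by (smt (verit) mult_pos_pos zero_le_power2)
  then have "AE x in lborel. f x = 0"
    by (intro herm_self_eq_0 f) (simp add: herm_self)
  then show "AE x in lborel. u x = q * green \<omega> x"
    by eventually_elim (simp add: f_def)
  have G: "has_charge \<omega> (green \<omega>) 1" using has_charge_green[of \<omega> 1] by simp
  have "- \<omega> * herm (green \<omega>) u = form \<omega> (green \<omega>) 1 u q + \<tau> * q"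
    using assms(1) G by (simp add: stationary_def)
  also have "form \<omega> (green \<omega>) 1 u q = - \<omega> * herm (green \<omega>) u"
    using arg_cong[OF form_green_right[OF u assms(2), of 1], of cnj] by (simp add: form_cnj herm_cnj)
  finally show "\<tau> * q = 0" by simp
qed

text \<open>
  A virial identity without derivatives. The dilate of \<open>u\<close> by \<open>s\<close> solves the equation for the
  frequency \<open>s\<^sup>2 \<omega>\<close>, with a coupling constant shifted by a logarithm of \<open>s\<close>. Since the form is
  hermitian, testing the equation for \<open>u\<close> with the dilate and the equation for the dilate with \<open>u\<close>
  leaves only the terms below.
\<close>

lemma stationary_dilate:
  assumes "stationary a \<omega> \<tau> u q" "a > 0" "s > 0"
  shows "of_real (\<omega> * (s\<^sup>2 - 1)) * herm u (\<lambda>x. u (s *\<^sub>R x)) = of_real (ln s / (2 * pi) * (cmod q)\<^sup>2)"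
proof -
  define v where "v x = u (s *\<^sub>R x)" for x
  \<comment> \<open>Dilating the pair \<open>w\<close>, \<open>u\<close> by \<open>s\<close> gives \<open>u\<close>, \<open>v\<close>: testing with \<open>w\<close> amounts to the equation for \<open>v\<close> tested with \<open>u\<close>.\<close>
  define w where "w x = u ((1 / s) *\<^sub>R x)" for x
  have u: "has_charge a u q" using assms by (simp add: stationary_def)
  have uL: "u \<in> L2" using has_charge_L2 u assms by blast
  have as: "a * s\<^sup>2 > 0" and as': "a / s\<^sup>2 > 0" using assms by auto
  have v': "has_charge (a * s\<^sup>2) v q" unfolding v_def[abs_def] by (rule has_charge_dilate[OF u assms(3)])
  have v: "has_charge a v q" by (rule has_charge_change[OF v' as assms(2)])
  have w': "has_charge (a * (1 / s)\<^sup>2) w q" unfolding w_def[abs_def] using assms(3) by (intro has_charge_dilate[OF u]) simp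
  have w: "has_charge a w q" by (rule has_charge_change[OF w']) (use assms in auto)
  have wv: "(\<lambda>x. w (s *\<^sub>R x)) = u" using assms(3) by (auto simp: w_def)
  have wL: "w \<in> L2" using has_charge_L2 w assms by blast
  have qq: "cnj q * q = of_real ((cmod q)\<^sup>2)"
    using complex_norm_square[of q] by (simp add: mult.commute)
  have 1: "- \<omega> * herm u v = form a u q v q + \<tau> * of_real ((cmod q)\<^sup>2)"
  proof -
    have "- \<omega> * herm v u = form a v q u q + \<tau> * cnj q * q"
      using assms(1) v by (simp add: stationary_def)
    from arg_cong[OF this, of cnj] show ?thesis
      by (simp add: form_cnj herm_cnj mult.assoc qq mult.commute[of q])
  qed
  have 2: "- \<omega> * s\<^sup>2 * herm u v = form a u q v q - of_real (ln (s\<^sup>2) / (4 * pi)) * of_real ((cmod q)\<^sup>2) + \<tau> * of_real ((cmod q)\<^sup>2)"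
  proof -
    have "- \<omega> * herm w u = form a w q u q + \<tau> * of_real ((cmod q)\<^sup>2)"
      using assms(1) w by (simp add: stationary_def mult.assoc qq)
    also have "form a w q u q = form (a * s\<^sup>2) u q v q"
      using form_dilate[OF w u assms(3,2)] by (simp add: wv v_def[abs_def])
    also have "\<dots> = form a u q v q - of_real (ln (s\<^sup>2) / (4 * pi)) * of_real ((cmod q)\<^sup>2)"
      using form_change[OF u v assms(2) as] assms(2) by (simp add: mult.assoc qq)
    also have "herm w u = of_real (s\<^sup>2) * herm u v"
      using herm_dilate[OF wL uL assms(3)] assms(3)
      unfolding wv v_def[abs_def, symmetric] by (simp add: scaleR_conv_of_real)
    finally show ?thesis by (simp add: algebra_simps)
  qed
  have "ln (s\<^sup>2) = 2 * ln s" using assms(3) by (simp add: ln_realpow)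
  then have "of_real (ln (s\<^sup>2) / (4 * pi)) * of_real ((cmod q)\<^sup>2) = complex_of_real (ln s / (2 * pi) * (cmod q)\<^sup>2)"
    by simp
  note ls = this
  have "complex_of_real (\<omega> * (s\<^sup>2 - 1)) * herm u v
      = complex_of_real (- \<omega>) * herm u v - complex_of_real (- \<omega> * s\<^sup>2) * herm u v"
    by (simp add: algebra_simps)
  also have "\<dots> = of_real (ln s / (2 * pi) * (cmod q)\<^sup>2)"
    unfolding 1 2 ls by simp
  finally show ?thesis
    unfolding v_def[abs_def] .
qed

subsection \<open>Functions with vanishing weak gradient\<close>

lemma bump_differentiable:
  assumes "c > 0"
  obtains D where "\<And>t. (bump c a b has_real_derivative D t) (at t)"
proof -
  have "\<exists>D. (bump c a b has_real_derivative D) (at t)" for t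
  proof -
    have 1: "((\<lambda>t. flat c 0 (t - a)) has_real_derivative
        (c * flat c (0 + 2) (t - a) - real 0 * flat c (0 + 1) (t - a)) * 1) (at t)"
      by (rule DERIV_chain2[OF flat_has_derivative[OF assms]]) (auto intro!: derivative_eq_intros)
    have 2: "((\<lambda>t. flat c 0 (b - t)) has_real_derivative
        (c * flat c (0 + 2) (b - t) - real 0 * flat c (0 + 1) (b - t)) * (- 1)) (at t)"
      by (rule DERIV_chain2[OF flat_has_derivative[OF assms]]) (auto intro!: derivative_eq_intros)
    show ?thesis
      using DERIV_mult[OF 1 2] unfolding bump_def[abs_def] by blast
  qed
  then show thesis using that by metis
qed

lemma smooth_bump_scaled: "c > 0 \<Longrightarrow> k \<noteq> 0 \<Longrightarrow> smooth (\<lambda>x. bump c a b (k * x $ i))"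
  unfolding bump_def using smooth_flat[of c k 0 "-a" i] smooth_flat[of c "-k" 0 b i]
  by (intro smooth_mult) (simp_all add: algebra_simps)

lemma constant_where_derivative_zero:
  assumes "\<And>t. (H has_real_derivative h t) (at t)" "\<And>t. \<bar>t\<bar> \<ge> M \<Longrightarrow> h t = 0" "M > 0" "T \<ge> 1" "\<bar>t\<bar> \<ge> M * T"
  shows "H t = H (t / T)"
proof -
  have *: "H x = H y" if "x \<le> y" "x \<ge> M \<or> y \<le> - M" for x y
  proof (cases "x = y")
    case False
    then have "x < y" using that by simp
    from MVT2[OF this, of H h] assms(1) obtain z where z: "x < z" "z < y" "H y - H x = (y - x) * h z" by blast
    have "h z = 0" using z that by (intro assms(2)) auto
    then show ?thesis using z by simp
  qed simp
  show ?thesis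
  proof (cases "t \<ge> 0")
    case True
    have "t / T \<ge> M" using assms True by (simp add: pos_le_divide_eq)
    moreover have "t / T \<le> t" using assms True by (simp add: divide_le_eq mult_le_cancel_left1)
    ultimately show ?thesis using *[of "t / T" t] by simp
  next
    case False
    have "t / T \<le> - M" using assms False by (simp add: divide_le_eq)
    moreover have "t \<le> t / T" using assms False by (simp add: le_divide_eq mult_le_cancel_left2)
    ultimately show ?thesis using *[of t "t / T"] by simp
  qed
qed

text \<open>
  A bump \<open>h\<close> in the first coordinate and its spread out copy \<open>t \<mapsto> h (t / T) / T\<close> have the same integral,
  so that their difference is the derivative of a function with compact support. A function with
  vanishing weak gradient therefore has the same integral against both, and against the copy this
  integral is small by the Cauchy-Schwarz inequality. The choice \<open>T = n\<^sup>2\<close>, \<open>\<epsilon> = 1 / n\<close> makes both terms of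
  the weighted inequality of order \<open>1 / n\<close>.
\<close>

lemma weak_grad_zero_imp_zero:
  assumes f: "f \<in> L2" and grad: "has_weak_grad f (\<lambda>x. 0)"
  shows "AE x in lborel. f x = 0"
proof (rule fundamental_lemma[OF f])
  fix c :: real and a b :: "real^2" assume c: "c > 0"
  define h1 where "h1 = bump c (a $ 1) (b $ 1)"
  define h2 where "h2 = bump c (a $ 2) (b $ 2)"
  obtain D1 where D1: "\<And>t. (h1 has_real_derivative D1 t) (at t)"
    unfolding h1_def using bump_differentiable[OF c, of "a $ 1" "b $ 1"] by blast
  obtain D2 where D2: "\<And>t. (h2 has_real_derivative D2 t) (at t)"
    unfolding h2_def using bump_differentiable[OF c, of "a $ 2" "b $ 2"] by blast
  have "\<exists>H. \<forall>x::real. - \<infinity> < ereal x \<longrightarrow> ereal x < \<infinity> \<longrightarrow> (H has_vector_derivative h1 x) (at x)"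
    by (rule einterval_antiderivative) (auto intro: DERIV_isCont[OF D1])
  then obtain H where H: "\<And>t. (H has_real_derivative h1 t) (at t)"
    by (auto simp: has_real_derivative_iff_has_vector_derivative)
  define M where "M = Max {\<bar>a $ 1\<bar>, \<bar>b $ 1\<bar>, \<bar>a $ 2\<bar>, \<bar>b $ 2\<bar>} + 1"
  have M: "\<bar>a $ 1\<bar> < M" "\<bar>b $ 1\<bar> < M" "\<bar>a $ 2\<bar> < M" "\<bar>b $ 2\<bar> < M" "M > 0"
    unfolding M_def by (auto simp: less_max_iff_disj max_def)
  have h10: "h1 t = 0" "h2 t = 0" if "\<bar>t\<bar> \<ge> M" for t
    unfolding h1_def h2_def using that M by (auto intro!: bump_zero)
  have hb: "0 \<le> h1 t" "h1 t \<le> 1" "0 \<le> h2 t" "h2 t \<le> 1" for t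
    using c by (auto simp: h1_def h2_def bump_nonneg bump_le_1)
  have bb: "box_bump c a b x = h1 (x $ 1) * h2 (x $ 2)" for x
    by (simp add: box_bump_def UNIV_2 h1_def h2_def)
  have sm1: "smooth (\<lambda>x. h1 (k * x $ i))" "smooth (\<lambda>x. h2 (k * x $ i))" if "k \<noteq> 0" for k i
    unfolding h1_def h2_def using c that by (auto intro: smooth_bump_scaled)
  define W where "W = (\<integral>x. box_bump c a b x *\<^sub>R f x \<partial>lborel)"
  define N where "N = Re (herm f f)"
  have "cmod W \<le> (4 * M * M + N) / (2 * real n)" if n: "n \<ge> 1" for n
  proof -
    define T where "T = (real n)\<^sup>2"
    have T: "T \<ge> 1" using n by (simp add: T_def)
    \<comment> \<open>The two primitives agree far out, although neither has compact support.\<close>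
    define A where "A t = H t - H (t / T)" for t
    have A': "(A has_real_derivative (h1 t - h1 (1 / T * t) * (1 / T))) (at t)" for t
    proof -
      have "((\<lambda>t. t / T) has_real_derivative 1 / T) (at t)"
        using T by (auto intro!: derivative_eq_intros)
      from DERIV_diff[OF H DERIV_chain2[OF H this]] show ?thesis by (simp add: A_def[abs_def])
    qed
    have "smooth (\<lambda>x. h1 (1 * x $ 1) + (- (1 / T)) * h1 (1 / T * x $ 1))"
      using T by (intro smooth_add smooth_mult smooth_const sm1) auto
    then have sA: "smooth (\<lambda>x. A (x $ 1))"
      by (intro smooth_coordinate[OF A']) (simp add: algebra_simps)
    have sh2: "smooth (\<lambda>x. h2 (x $ 2))" using sm1(2)[of 1 2] by simp
    define \<psi> where "\<psi> x = A (x $ 1) * h2 (x $ 2)" for x :: "real^2"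
    have "test_function \<psi>"
      unfolding test_function_iff
    proof
      show "smooth \<psi>" unfolding \<psi>_def[abs_def] by (rule smooth_mult[OF sA sh2])
      have "norm x \<le> M * T + M" if "\<psi> x \<noteq> 0" for x
      proof -
        have "\<bar>x $ 1\<bar> < M * T"
          using that constant_where_derivative_zero[OF H h10(1) M(5) T, of "x $ 1"]
          by (force simp: \<psi>_def A_def)
        moreover have "\<bar>x $ 2\<bar> < M" using that h10(2)[of "x $ 2"] by (force simp: \<psi>_def)
        moreover have "norm x \<le> \<bar>x $ 1\<bar> + \<bar>x $ 2\<bar>"
          using norm_le_l1_cart[of x] by (simp add: UNIV_2)
        ultimately show ?thesis by simp
      qed
      then show "bounded {x. \<psi> x \<noteq> 0}" by (auto simp: bounded_iff)
    qed
    then have "(\<integral>x. partial_deriv 1 \<psi> x *\<^sub>R f x \<partial>lborel) = 0"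
      using has_weak_gradD[OF grad, of \<psi> 1] by simp
    moreover have "partial_deriv 1 \<psi> x = box_bump c a b x - (1 / T) * (h1 (1 / T * x $ 1) * h2 (x $ 2))" for x
    proof -
      have pd1: "partial_deriv 1 (\<lambda>x. A (x $ 1)) x = h1 (x $ 1) - h1 (1 / T * x $ 1) * (1 / T)"
        using partial_deriv_eqI[OF has_derivative_coordinate[OF A']] by simp
      have pd2: "partial_deriv 1 (\<lambda>x. h2 (x $ 2)) x = 0"
        using partial_deriv_eqI[OF has_derivative_coordinate[OF D2]] by (simp add: axis_def)
      show ?thesis
        unfolding \<psi>_def[abs_def] partial_deriv_mult[OF sA sh2] bb pd1 pd2 by (simp add: algebra_simps)
    qed
    ultimately have 0: "(\<integral>x. (box_bump c a b x - (1 / T) * (h1 (1 / T * x $ 1) * h2 (x $ 2))) *\<^sub>R f x \<partial>lborel) = 0"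
      by simp
    define g where "g x = h1 (1 / T * x $ 1) * h2 (x $ 2)" for x :: "real^2"
    have gm: "g \<in> borel_measurable borel"
      unfolding g_def[abs_def] using T by (intro smooth_measurable smooth_mult sm1 sh2) auto
    define C :: "(real^2) set" where "C = cbox (\<chi> i. if i = 1 then - (M * T) else - M) (\<chi> i. if i = 1 then M * T else M)"
    have gC: "\<bar>g x\<bar> \<le> indicator C x" for x
    proof (cases "x \<in> C")
      case True
      then show ?thesis using hb by (auto simp: g_def abs_mult intro!: mult_le_one)
    next
      case False
      then have "\<bar>1 / T * x $ 1\<bar> \<ge> M \<or> \<bar>x $ 2\<bar> \<ge> M"
        using T by (auto simp: C_def mem_box_cart forall_2 abs_mult field_simps)
      then have "g x = 0" using h10 by (auto simp: g_def)
      then show ?thesis by simp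
    qed
    have Cfin: "emeasure lborel C < \<infinity>" unfolding C_def by (rule emeasure_lborel_cbox_finite)
    have Cm: "measure lborel C = (2 * (M * T)) * (2 * M)"
    proof -
      have "C \<noteq> {}" unfolding C_def using M T by (simp add: interval_ne_empty_cart forall_2)
      then show ?thesis
        unfolding C_def by (subst content_cbox_cart) (auto simp: UNIV_2)
    qed
    have indL: "(\<lambda>x. indicator C x :: real) \<in> L2"
      using Cfin by (intro L2_indicator) (simp_all add: C_def)
    have gL: "g \<in> L2"
      by (rule L2_bound[OF indL gm, of 1]) (use gC in auto)
    have cgL: "(\<lambda>x. complex_of_real (g x)) \<in> L2"
      by (rule L2_of_real[OF gL])
    have tb: "box_bump c a b \<in> L2" by (intro test_function_L2 test_function_box_bump c)
    have i1: "integrable lborel (\<lambda>x. box_bump c a b x *\<^sub>R f x)" by (rule integrable_scaleR_L2[OF tb f])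
    have i2: "integrable lborel (\<lambda>x. (1 / T) *\<^sub>R (g x *\<^sub>R f x))"
      by (intro integrable_scaleR_right integrable_scaleR_L2[OF gL f])
    have "(\<integral>x. box_bump c a b x *\<^sub>R f x - (1 / T) *\<^sub>R (g x *\<^sub>R f x) \<partial>lborel) = 0"
      using 0 by (simp only: g_def scaleR_diff_left scaleR_scaleR)
    then have "W - (1 / T) *\<^sub>R (\<integral>x. g x *\<^sub>R f x \<partial>lborel) = 0"
      unfolding Bochner_Integration.integral_diff[OF i1 i2] integral_scaleR_right W_def .
    then have "cmod W = 1 / T * cmod (herm (\<lambda>x. complex_of_real (g x)) f)"
      using T by (simp add: herm_def scaleR_conv_of_real norm_mult norm_divide)
    also have "\<dots> \<le> 1 / T * ((1 / n * Re (herm (\<lambda>x. complex_of_real (g x)) (\<lambda>x. complex_of_real (g x))) + Re (herm f f) / (1 / n)) / 2)"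
      using T n by (intro mult_left_mono herm_bound cgL f) auto
    also have "\<dots> \<le> 1 / T * ((1 / n * (4 * M * M * T) + N / (1 / n)) / 2)"
    proof -
      have "Re (herm (\<lambda>x. complex_of_real (g x)) (\<lambda>x. complex_of_real (g x))) = (\<integral>x. (g x)\<^sup>2 \<partial>lborel)"
        by (simp add: herm_self)
      also have "\<dots> \<le> (\<integral>x. indicator C x \<partial>lborel)"
      proof (rule integral_mono)
        show "integrable lborel (\<lambda>x. (g x)\<^sup>2)" using L2_integrable[OF gL] by simp
        show "integrable lborel (\<lambda>x. indicator C x :: real)" using Cfin by (simp add: C_def)
        fix x
        have "(g x)\<^sup>2 \<le> (indicator C x)\<^sup>2" using gC[of x] by (intro abs_le_square_iff[THEN iffD1]) simp
        then show "(g x)\<^sup>2 \<le> indicator C x" by (auto simp: indicator_def split: if_splits)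
      qed
      also have "\<dots> = 4 * M * M * T" using Cm by simp
      finally show ?thesis
        using T n by (intro mult_left_mono divide_right_mono add_mono) (auto simp: N_def)
    qed
    also have "\<dots> = (4 * M * M + N) / (2 * real n)"
      using n by (simp add: T_def field_simps power2_eq_square)
    finally show ?thesis .
  qed
  moreover have "(\<lambda>n. (4 * M * M + N) / (2 * real n)) \<longlonglongrightarrow> 0" by real_asymp
  ultimately have "cmod W \<le> 0"
    by (intro tendsto_lowerbound[of _ 0 sequentially] eventually_sequentiallyI[of 1]) auto
  then show "(\<integral>x. box_bump c a b x *\<^sub>R f x \<partial>lborel) = 0" by (simp add: W_def)
qed

lemma has_weak_grad_AE_zero:
  assumes "has_weak_grad f F" "F \<in> L2" "AE x in lborel. F x = 0"
  shows "has_weak_grad f (\<lambda>x. 0)"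
  unfolding has_weak_grad_def
proof (intro allI impI)
  fix \<phi> :: "real^2 \<Rightarrow> real" and i :: 2 assume \<phi>: "test_function \<phi>"
  have "AE x in lborel. \<phi> x *\<^sub>R (F x $ i) = 0"
    using assms(3) by eventually_elim simp
  then have "(\<integral>x. \<phi> x *\<^sub>R (F x $ i) \<partial>lborel) = 0"
    by (rule integral_eq_zero_AE)
  then show "(\<integral>x. partial_deriv i \<phi> x *\<^sub>R f x \<partial>lborel) = - (\<integral>x. \<phi> x *\<^sub>R ((0 :: complex^2) $ i) \<partial>lborel)"
    using has_weak_gradD[OF assms(1) \<phi>, of i] by simp
qed

subsection \<open>Absence of stationary states with nonpositive frequency\<close>

text \<open>
  At frequency zero the virial identity forces the charge to vanish, and the equation tested with \<open>u\<close>
  itself shows that the gradient vanishes.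
\<close>

lemma stationary_zero_frequency:
  assumes "stationary a 0 \<tau> u q" "a > 0"
  shows "AE x in lborel. u x = 0"
proof -
  have "complex_of_real (ln 2 / (2 * pi) * (cmod q)\<^sup>2) = 0"
    using stationary_dilate[OF assms, of 2] by simp
  then have "ln 2 / (2 * pi) * (cmod q)\<^sup>2 = 0" by (simp only: of_real_eq_0_iff)
  then have q: "q = 0" by simp
  have u: "has_charge a u 0" using assms(1) q by (simp add: stationary_def)
  then have uH: "u \<in> H1" by (simp add: has_charge_def)
  note f = H1_weak_grad[OF uH]
  have "form a u 0 u 0 = 0"
    using assms(1)[unfolded stationary_def q, THEN conjunct2, rule_format, OF u] by simp
  then have "herm_vec (weak_grad u) (weak_grad u) = 0" by (simp add: form_def)
  then have "(L2_norm (weak_grad u))\<^sup>2 = 0"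
    unfolding herm_vec_self[OF f(2)] by (simp only: of_real_eq_0_iff)
  then have "(\<integral>x. (norm (weak_grad u x))\<^sup>2 \<partial>lborel) = 0" by (simp add: L2_norm_def)
  then have "AE x in lborel. (norm (weak_grad u x))\<^sup>2 = 0"
    using integral_nonneg_eq_0_iff_AE[OF L2_integrable[OF f(2)]] by simp
  then have "AE x in lborel. weak_grad u x = 0" by eventually_elim simp
  then show ?thesis
    using weak_grad_zero_imp_zero[OF f(1) has_weak_grad_AE_zero[OF f(3,2)]] by blast
qed

text \<open>
  For \<open>t > 0\<close> the quotient of \<open>ln t\<close> and \<open>t\<^sup>2 - 1\<close> is positive, so the virial identity with a negative
  frequency gives distinct dilates of \<open>u\<close> a nonpositive scalar product.
\<close>

lemma dilates_nonpositive:
  assumes "stationary a \<omega> \<tau> u q" "a > 0" "\<omega> < 0" "r > 0" "s > 0" "r \<noteq> s"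
  shows "Re (herm (\<lambda>x. u (r *\<^sub>R x)) (\<lambda>x. u (s *\<^sub>R x))) \<le> 0"
proof -
  define t where "t = s / r"
  have t: "t > 0" "t \<noteq> 1" using assms by (auto simp: t_def)
  have u: "u \<in> L2" using assms has_charge_L2 by (auto simp: stationary_def)
  define h where "h = Re (herm u (\<lambda>x. u (t *\<^sub>R x)))"
  have "\<omega> * (t\<^sup>2 - 1) * h = ln t / (2 * pi) * (cmod q)\<^sup>2"
    using arg_cong[OF stationary_dilate[OF assms(1,2) t(1)], of Re] by (simp add: h_def)
  then have eq: "(- \<omega>) * ((t\<^sup>2 - 1) * h) = - (ln t / (2 * pi) * (cmod q)\<^sup>2)" by simp
  have "h \<le> 0"
  proof (cases "t > 1")
    case True
    then have "(- \<omega>) * ((t\<^sup>2 - 1) * h) \<le> 0" unfolding eq by simp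
    then have "(t\<^sup>2 - 1) * h \<le> 0" using assms(3) mult_le_cancel_left_pos[of "- \<omega>" "(t\<^sup>2 - 1) * h" 0] by simp
    moreover have "t\<^sup>2 - 1 > 0" using True by simp
    ultimately show ?thesis by (simp add: mult_le_0_iff)
  next
    case False
    then have t1: "t < 1" using t by simp
    then have "ln t \<le> 0" using t by simp
    then have "(- \<omega>) * ((t\<^sup>2 - 1) * h) \<ge> 0" unfolding eq by (simp add: mult_nonpos_nonneg divide_nonpos_pos)
    then have "(t\<^sup>2 - 1) * h \<ge> 0" using assms(3) mult_le_cancel_left_pos[of "- \<omega>" 0 "(t\<^sup>2 - 1) * h"] by simp
    moreover have "t\<^sup>2 - 1 < 0" using t1 t by (simp add: power_less_one_iff)
    ultimately show ?thesis by (simp add: zero_le_mult_iff)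
  qed
  moreover have "herm (\<lambda>x. u (r *\<^sub>R x)) (\<lambda>x. u (s *\<^sub>R x)) = (1 / r\<^sup>2) *\<^sub>R herm u (\<lambda>x. u (t *\<^sub>R x))"
    using herm_dilate[OF u L2_dilate[OF u t(1)] assms(4)] assms(4) by (simp add: t_def)
  ultimately show ?thesis using assms(4) by (simp add: h_def divide_le_0_iff)
qed

text \<open>
  The dilation is moved to the bump, which is bounded and continuous; then dominated convergence
  applies without any regularity of \<open>u\<close>.
\<close>

lemma dilate_weakly_continuous:
  assumes \<phi>: "test_function \<phi>" and u: "u \<in> L2" and s: "\<And>n. 1 \<le> s n" "\<And>n. s n \<le> 2" "s \<longlonglongrightarrow> 1"
  shows "(\<lambda>n. \<integral>x. \<phi> x *\<^sub>R u (s n *\<^sub>R x) \<partial>lborel) \<longlonglongrightarrow> (\<integral>x. \<phi> x *\<^sub>R u x \<partial>lborel :: complex)"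
proof -
  obtain B R where B: "B > 0" "R > 0" "\<And>x. \<bar>\<phi> x\<bar> \<le> B" "\<And>x. norm x > R \<Longrightarrow> \<phi> x = 0"
    using test_function_bound[OF \<phi>] by blast
  have s\<phi>: "smooth \<phi>" using \<phi> by (simp add: test_function_iff)
  have [measurable]: "u \<in> borel_measurable borel" "\<phi> \<in> borel_measurable borel"
    using u s\<phi> by (auto intro: L2_measurable smooth_measurable)
  have sp: "s n > 0" for n using s(1)[of n] by simp
  have eq: "(\<integral>x. \<phi> x *\<^sub>R u (s n *\<^sub>R x) \<partial>lborel) = (1 / (s n)\<^sup>2) *\<^sub>R (\<integral>x. \<phi> ((1 / s n) *\<^sub>R x) *\<^sub>R u x \<partial>lborel)" for n
  proof -
    have "\<phi> ((1 / s n) *\<^sub>R (s n *\<^sub>R x)) = \<phi> x" for x using sp[of n] by simp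
    then show ?thesis
      using integral_dilate[OF sp[of n], of "\<lambda>x. \<phi> ((1 / s n) *\<^sub>R x) *\<^sub>R u x"] by simp
  qed
  have "(\<lambda>n. \<integral>x. \<phi> ((1 / s n) *\<^sub>R x) *\<^sub>R u x \<partial>lborel) \<longlonglongrightarrow> (\<integral>x. \<phi> x *\<^sub>R u x \<partial>lborel)"
  proof (rule integral_dominated_convergence)
    have "(\<lambda>x. indicator (cball 0 (2 * R)) x :: real) \<in> L2"
      by (intro L2_indicator emeasure_compact_finite) auto
    from integrable_scaleR_L2[OF this u]
    show "integrable lborel (\<lambda>x. B * norm (indicator (cball 0 (2 * R)) x *\<^sub>R u x))"
      by (intro integrable_mult_right integrable_norm)
    show "AE x in lborel. (\<lambda>n. \<phi> ((1 / s n) *\<^sub>R x) *\<^sub>R u x) \<longlonglongrightarrow> \<phi> x *\<^sub>R u x"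
    proof (intro AE_I2 tendsto_intros)
      fix x
      have "isCont \<phi> x" using smooth_continuous_on[OF s\<phi>, of UNIV] by (simp add: continuous_on_eq_continuous_at)
      moreover have "(\<lambda>n. (1 / s n) *\<^sub>R x) \<longlonglongrightarrow> (1 / 1) *\<^sub>R x" by (intro tendsto_intros s(3)) simp
      ultimately show "(\<lambda>n. \<phi> ((1 / s n) *\<^sub>R x)) \<longlonglongrightarrow> \<phi> x"
        using isCont_tendsto_compose by fastforce
    qed
    show "AE x in lborel. norm (\<phi> ((1 / s n) *\<^sub>R x) *\<^sub>R u x) \<le> B * norm (indicator (cball 0 (2 * R)) x *\<^sub>R u x)" for n
    proof (intro AE_I2)
      fix x
      show "norm (\<phi> ((1 / s n) *\<^sub>R x) *\<^sub>R u x) \<le> B * norm (indicator (cball 0 (2 * R)) x *\<^sub>R u x)"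
      proof (cases "norm x \<le> 2 * R")
        case True
        then show ?thesis using B(3) by (simp add: mult_right_mono)
      next
        case False
        have "R * s n \<le> R * 2" using B(2) s(2)[of n] by (intro mult_left_mono) auto
        then have "norm ((1 / s n) *\<^sub>R x) > R"
          using False sp[of n] by (simp add: less_divide_eq)
        then show ?thesis using B by simp
      qed
    qed
  qed measurable
  moreover have "(\<lambda>n. 1 / (s n)\<^sup>2) \<longlonglongrightarrow> 1 / 1\<^sup>2" by (intro tendsto_intros s(3)) simp
  ultimately have "(\<lambda>n. (1 / (s n)\<^sup>2) *\<^sub>R (\<integral>x. \<phi> ((1 / s n) *\<^sub>R x) *\<^sub>R u x \<partial>lborel)) \<longlonglongrightarrow> (1 / 1\<^sup>2) *\<^sub>R (\<integral>x. \<phi> x *\<^sub>R u x \<partial>lborel)"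
    by (intro tendsto_scaleR)
  then show ?thesis by (simp add: eq)
qed

text \<open>
  Let \<open>S\<close> be the sum of \<open>N\<close> distinct dilates of \<open>u\<close>. As their mixed scalar products are nonpositive,
  the square of the norm of \<open>S\<close> grows at most like \<open>N\<close>. On the other hand, if \<open>u\<close> is not zero, some
  bump has a nonzero scalar product with \<open>u\<close>, hence, by continuity, nearly the same one with each
  dilate by a factor close to one. So its scalar product with \<open>S\<close> grows like \<open>N\<close>, which contradicts the
  Cauchy-Schwarz inequality for large \<open>N\<close>.
\<close>

lemma stationary_negative_frequency:
  assumes "stationary a \<omega> \<tau> u q" "a > 0" "\<omega> < 0"
  shows "AE x in lborel. u x = 0"
proof (rule ccontr)
  assume nz: "\<not> ?thesis"
  have u: "u \<in> L2" using assms has_charge_L2 by (auto simp: stationary_def)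
  obtain c :: real and x1 x2 where c: "c > 0" and W0: "(\<integral>x. box_bump c x1 x2 x *\<^sub>R u x \<partial>lborel) \<noteq> 0"
    using fundamental_lemma[OF u] nz by blast
  define \<phi> where "\<phi> = box_bump c x1 x2"
  define W where "W = (\<integral>x. \<phi> x *\<^sub>R u x \<partial>lborel)"
  have \<phi>: "test_function \<phi>" unfolding \<phi>_def by (rule test_function_box_bump[OF c])
  have W: "cmod W > 0" using W0 by (simp add: W_def \<phi>_def)
  define \<Phi> where "\<Phi> x = complex_of_real (\<phi> x)" for x
  have \<Phi>L: "\<Phi> \<in> L2"
    unfolding \<Phi>_def[abs_def] by (rule L2_of_real[OF test_function_L2[OF \<phi>]])
  define s where "s n = 1 + inverse (real (Suc n))" for n
  have s: "1 < s n" "s n \<le> 2" for n by (auto simp: s_def inverse_le_1_iff simp del: of_nat_Suc)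
  have sinj: "s m \<noteq> s n" if "m \<noteq> n" for m n using that by (simp add: s_def)
  have s1: "s \<longlonglongrightarrow> 1"
    using tendsto_add[OF tendsto_const[of 1] LIMSEQ_inverse_real_of_nat] by (simp add: s_def[abs_def])
  define v where "v n x = u (s n *\<^sub>R x)" for n x
  have v: "v n \<in> L2" for n unfolding v_def[abs_def] using s(1)[of n] by (intro L2_dilate u) simp
  have hv: "herm \<Phi> (v n) = (\<integral>x. \<phi> x *\<^sub>R u (s n *\<^sub>R x) \<partial>lborel)" for n
    by (simp add: herm_def \<Phi>_def v_def scaleR_conv_of_real)
  have "(\<lambda>n. herm \<Phi> (v n)) \<longlonglongrightarrow> W"
    unfolding hv W_def by (rule dilate_weakly_continuous[OF \<phi> u less_imp_le[OF s(1)] s(2) s1])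
  then have "(\<lambda>n. Re (cnj W * herm \<Phi> (v n))) \<longlonglongrightarrow> Re (cnj W * W)"
    by (intro tendsto_intros)
  moreover have "Re (cnj W * W) = (cmod W)\<^sup>2"
    by (simp add: cmod_power2) (simp add: power2_eq_square)
  ultimately have "\<forall>\<^sub>F n in sequentially. Re (cnj W * herm \<Phi> (v n)) > (cmod W)\<^sup>2 / 2"
    using W by (intro order_tendstoD(1)) auto
  then obtain n0 where n0: "\<And>n. n \<ge> n0 \<Longrightarrow> Re (cnj W * herm \<Phi> (v n)) > (cmod W)\<^sup>2 / 2"
    by (auto simp: eventually_sequentially)
  define U where "U = Re (herm u u)"
  have U: "U \<ge> 0" by (simp add: U_def herm_self)
  \<comment> \<open>The weight makes the contribution of the norm of the sum of dilates at most half of the lower bound.\<close>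
  define \<epsilon> where "\<epsilon> = cmod W / (2 * (U + 1))"
  have \<epsilon>: "\<epsilon> > 0" "\<epsilon> * U \<le> cmod W / 2"
    using W U by (auto simp: \<epsilon>_def field_simps)
  define K where "K = Re (herm \<Phi> \<Phi>) / \<epsilon>"
  have "real N * cmod W / 4 \<le> K / 2" for N
  proof -
    define I where "I = {n0..<n0 + N}"
    define S where "S x = (\<Sum>n\<in>I. v n x)" for x
    have SL: "S \<in> L2" unfolding S_def[abs_def] by (intro L2_sum v) (simp add: I_def)
    have fin: "finite I" and cardI: "card I = N" by (auto simp: I_def)
    have "Re (herm S S) = (\<Sum>m\<in>I. \<Sum>n\<in>I. Re (herm (v m) (v n)))"
      unfolding S_def[abs_def] by (simp add: herm_sum_left herm_sum_right fin v L2_sum)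
    also have "\<dots> \<le> (\<Sum>m\<in>I. \<Sum>n\<in>I. if m = n then U else 0)"
    proof (intro sum_mono)
      fix m n
      show "Re (herm (v m) (v n)) \<le> (if m = n then U else 0)"
      proof (cases "m = n")
        case True
        have "Re (herm (v n) (v n)) = U / (s n)\<^sup>2"
          using herm_dilate[OF u u, of "s n"] s(1)[of n] by (simp add: v_def[abs_def] U_def)
        also have "\<dots> \<le> U / 1" using s(1)[of n] U by (intro divide_left_mono) (auto simp: one_le_power)
        finally show ?thesis using True by simp
      next
        case False
        have "0 < s m" "0 < s n" using s(1)[of m] s(1)[of n] by auto
        then show ?thesis
          using dilates_nonpositive[OF assms, of "s m" "s n"] sinj[OF False] False by (simp add: v_def[abs_def])
      qed
    qed
    also have "\<dots> = N * U" using fin cardI by simp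
    finally have SS: "Re (herm S S) \<le> N * U" .
    have "real N * ((cmod W)\<^sup>2 / 2) = (\<Sum>n\<in>I. (cmod W)\<^sup>2 / 2)" by (simp add: cardI)
    also have "\<dots> \<le> (\<Sum>n\<in>I. Re (cnj W * herm \<Phi> (v n)))"
      by (intro sum_mono less_imp_le[OF n0]) (simp add: I_def)
    also have "\<dots> = Re (cnj W * herm \<Phi> S)"
      unfolding S_def[abs_def] by (simp only: herm_sum_right[OF fin v \<Phi>L] sum_distrib_left Re_sum)
    also have "\<dots> \<le> cmod (cnj W * herm \<Phi> S)" by (rule complex_Re_le_cmod)
    also have "\<dots> = cmod W * cmod (herm S \<Phi>)"
      using herm_cnj[of S \<Phi>] by (metis complex_mod_cnj norm_mult)
    finally have "real N * cmod W / 2 \<le> cmod (herm S \<Phi>)"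
      using W by (simp add: power2_eq_square)
    also have "\<dots> \<le> (\<epsilon> * Re (herm S S) + Re (herm \<Phi> \<Phi>) / \<epsilon>) / 2"
      by (rule herm_bound[OF SL \<Phi>L \<epsilon>(1)])
    also have "\<dots> \<le> (real N * (cmod W / 2) + K) / 2"
    proof -
      have "\<epsilon> * Re (herm S S) \<le> \<epsilon> * (N * U)" using SS \<epsilon>(1) by (intro mult_left_mono) auto
      also have "\<dots> = N * (\<epsilon> * U)" by simp
      also have "\<dots> \<le> N * (cmod W / 2)" using \<epsilon>(2) by (intro mult_left_mono) auto
      finally show ?thesis by (simp add: K_def)
    qed
    finally show ?thesis by (simp add: field_simps)
  qed
  moreover obtain N where "real N > 2 * K / cmod W" using reals_Archimedean2 by blast
  then have "2 * K < real N * cmod W" using W by (simp add: pos_divide_less_eq)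
  ultimately have "real N * cmod W / 4 \<le> K / 2" "2 * K < real N * cmod W" by blast+
  then show False by simp
qed

section \<open>Standing waves\<close>

lemma herm_rotating: "herm \<xi> (rotating \<omega> u t) = exp (\<i> * \<omega> * t) * herm \<xi> u"
  by (simp add: rotating_def[abs_def] herm_cmult_right)

lemma has_charge_rotating: "has_charge a u q \<Longrightarrow> has_charge a (rotating \<omega> u t) (exp (\<i> * \<omega> * t) * q)"
  by (simp add: rotating_def[abs_def] has_charge_cmult)

lemma cmod_exp_i: "cmod (exp (\<i> * \<omega> * t)) = 1" for \<omega> t :: real
  by (simp add: norm_exp_eq_Re)

lemma herm_rotating_derivative:
  "((\<lambda>s. herm \<xi> (rotating \<omega> u s)) has_vector_derivative \<i> * \<omega> * herm \<xi> (rotating \<omega> u t)) (at t)"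
proof -
  have "((\<lambda>s. exp (\<i> * \<omega> * complex_of_real s) * herm \<xi> u) has_vector_derivative
      (\<i> * \<omega>) * exp (\<i> * \<omega> * t) * herm \<xi> u) (at t)"
  proof -
    have "((\<lambda>z. exp (\<i> * \<omega> * z) * herm \<xi> u) has_field_derivative (\<i> * \<omega>) * exp (\<i> * \<omega> * of_real t) * herm \<xi> u) (at (of_real t))"
      by (auto intro!: derivative_eq_intros)
    from has_vector_derivative_real_field[OF this] show ?thesis by (simp add: o_def)
  qed
  then show ?thesis by (simp add: herm_rotating mult_ac)
qed

text \<open>
  Along \<open>exp (i \<omega> t) u\<close> both sides of the evolution equation carry the same phase factor, since
  \<^const>\<open>theta\<close> depends on the modulus of the charge only. Hence the equation at one time implies
  the equation at all times.
\<close>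

lemma NLS_solution_rotating_iff:
  assumes "has_charge a u q" "a > 0"
  shows "NLS_solution \<beta> \<sigma> a u (rotating \<omega> u) \<longleftrightarrow> stationary a \<omega> (theta \<beta> \<sigma> a (cmod q)) u q"
proof -
  define \<theta> where "\<theta> = theta \<beta> \<sigma> a (cmod q)"
  let ?R = "\<lambda>\<xi> t. herm_vec (weak_grad (regular_part a \<xi>)) (weak_grad (regular_part a (rotating \<omega> u t)))
              + a * herm (regular_part a \<xi>) (regular_part a (rotating \<omega> u t))
              - a * herm \<xi> (rotating \<omega> u t)
              + theta \<beta> \<sigma> a (cmod (charge a (rotating \<omega> u t))) * cnj (charge a \<xi>) * charge a (rotating \<omega> u t)"
  have rhs: "?R \<xi> t
        = exp (\<i> * \<omega> * t) * (form a \<xi> p u q + \<theta> * cnj p * q)"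
    if "has_charge a \<xi> p" for \<xi> p t
  proof -
    have c: "charge a \<xi> = p" "charge a (rotating \<omega> u t) = exp (\<i> * \<omega> * t) * q"
      using charge_eq[OF that assms(2)] charge_eq[OF has_charge_rotating[OF assms(1)] assms(2)] by auto
    have "form a \<xi> p (rotating \<omega> u t) (exp (\<i> * \<omega> * t) * q) = exp (\<i> * \<omega> * t) * form a \<xi> p u q"
      using form_cmult_right[OF that assms(1)] by (simp add: rotating_def[abs_def])
    then show ?thesis
      by (simp add: form_def regular_part_def c norm_mult cmod_exp_i \<theta>_def algebra_simps)
  qed
  show ?thesis
  proof
    assume sol: "NLS_solution \<beta> \<sigma> a u (rotating \<omega> u)"
    have "- \<omega> * herm \<xi> u = form a \<xi> p u q + \<theta> * cnj p * q" if \<xi>: "has_charge a \<xi> p" for \<xi> p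
    proof -
      have "\<xi> \<in> energy_space a" using \<xi> assms(2) by (auto simp: energy_space_iff)
      then obtain D where D: "((\<lambda>s. herm \<xi> (rotating \<omega> u s)) has_vector_derivative D) (at 0)"
        and eq: "\<i> * D = exp (\<i> * \<omega> * (0::real)) * (form a \<xi> p u q + \<theta> * cnj p * q)"
        using sol unfolding NLS_solution_def rhs[OF \<xi>, symmetric] by blast
      have "D = \<i> * \<omega> * herm \<xi> (rotating \<omega> u 0)"
        by (rule vector_derivative_unique_at[OF D herm_rotating_derivative])
      then show ?thesis using eq by (simp add: herm_rotating flip: mult.assoc)
    qed
    then show "stationary a \<omega> (theta \<beta> \<sigma> a (cmod q)) u q"
      using assms(1) by (simp add: stationary_def \<theta>_def)
  next
    assume st: "stationary a \<omega> (theta \<beta> \<sigma> a (cmod q)) u q"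
    show "NLS_solution \<beta> \<sigma> a u (rotating \<omega> u)"
      unfolding NLS_solution_def
    proof (intro conjI allI ballI)
      show "rotating \<omega> u t \<in> energy_space a" for t
        using has_charge_rotating[OF assms(1)] assms(2) by (auto simp: energy_space_iff)
      show "AE x in lborel. rotating \<omega> u 0 x = u x" by (simp add: rotating_def)
      fix \<xi> t assume "\<xi> \<in> energy_space a"
      then obtain p where \<xi>: "has_charge a \<xi> p" using assms(2) by (auto simp: energy_space_iff)
      have "- \<omega> * herm \<xi> u = form a \<xi> p u q + \<theta> * cnj p * q"
        using st \<xi> by (simp add: stationary_def \<theta>_def)
      then have "\<i> * (\<i> * \<omega> * herm \<xi> (rotating \<omega> u t)) = exp (\<i> * \<omega> * t) * (form a \<xi> p u q + \<theta> * cnj p * q)"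
        by (metis (no_types, opaque_lifting) herm_rotating complex_i_mult_minus i_squared mult.assoc mult.left_commute mult_minus1 mult_minus_left of_real_minus)
      then show "\<exists>D. ((\<lambda>s. herm \<xi> (rotating \<omega> u s)) has_vector_derivative D) (at t) \<and>
        \<i> * D = ?R \<xi> t"
        unfolding rhs[OF \<xi>] using herm_rotating_derivative by blast
    qed
  qed
qed

lemma theta_change:
  assumes "a > 0" "b > 0"
  shows "theta \<beta> \<sigma> b s = theta \<beta> \<sigma> a s + ln (b / a) / (4 * pi)"
proof -
  have eqs: "ln (sqrt b / 2) = ln b / 2 - ln 2" "ln (sqrt a / 2) = ln a / 2 - ln 2" "ln (b / a) = ln b - ln a"
    using assms by (auto simp: ln_div ln_sqrt)
  have "1 / (2 * pi) * (ln b / 2 - ln 2) = 1 / (2 * pi) * (ln a / 2 - ln 2) + (ln b - ln a) / (4 * pi)"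
    by (simp add: field_simps)
  then show ?thesis
    unfolding theta_def eqs by simp
qed

lemma frequencies_iff:
  assumes "\<omega> > 0"
  shows "\<omega> \<in> frequencies \<longleftrightarrow> ln (sqrt \<omega> / 2) + euler_mascheroni > 0"
proof -
  have "\<omega> \<in> frequencies \<longleftrightarrow> exp (- 2 * euler_mascheroni) < \<omega> / 4"
    by (auto simp: frequencies_def)
  also have "\<dots> \<longleftrightarrow> - 2 * euler_mascheroni < ln (\<omega> / 4)"
  proof -
    have "\<omega> / 4 = exp (ln (\<omega> / 4))" using assms by simp
    then show ?thesis by (metis exp_less_cancel_iff)
  qed
  also have "ln (\<omega> / 4) = 2 * ln (sqrt \<omega> / 2)"
  proof -
    have "ln (4::real) = 2 * ln 2" using ln_realpow[of 2 2] by simp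
    then show ?thesis using assms by (simp add: ln_div ln_sqrt)
  qed
  finally show ?thesis by auto
qed

lemma frequencies_pos: "\<omega> \<in> frequencies \<Longrightarrow> \<omega> > 0"
  unfolding frequencies_def using less_trans[of 0 "4 * exp (- 2 * euler_mascheroni)" \<omega>] by auto

text \<open>
  The condition that the charge of a standing wave has to satisfy. It has a positive solution exactly
  for the frequencies in \<^const>\<open>frequencies\<close>, and then only one.
\<close>

lemma theta_eq_0_iff:
  assumes "\<beta> > 0" "\<sigma> > 0" "\<omega> > 0" "s > 0"
  shows "theta \<beta> \<sigma> \<omega> s = 0 \<longleftrightarrow> \<omega> \<in> frequencies \<and> s = Q \<beta> \<sigma> \<omega>"
proof -
  define L where "L = (ln (sqrt \<omega> / 2) + euler_mascheroni) / (2 * pi * \<beta>)"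
  have "theta \<beta> \<sigma> \<omega> s = \<beta> * (L - s powr (2 * \<sigma>))"
    using assms by (simp add: theta_def L_def field_simps)
  then have 1: "theta \<beta> \<sigma> \<omega> s = 0 \<longleftrightarrow> L = s powr (2 * \<sigma>)"
    using assms by simp
  have 2: "\<omega> \<in> frequencies \<longleftrightarrow> L > 0"
  proof -
    have "2 * pi * \<beta> > 0" using assms by simp
    then show ?thesis
      unfolding frequencies_iff[OF assms(3)] L_def by (smt (verit) zero_less_divide_iff)
  qed
  have 3: "Q \<beta> \<sigma> \<omega> = L powr (1 / (2 * \<sigma>))" by (simp add: Q_def L_def)
  show ?thesis
  proof
    assume "theta \<beta> \<sigma> \<omega> s = 0"
    then have L: "L = s powr (2 * \<sigma>)" using 1 by simp
    then show "\<omega> \<in> frequencies \<and> s = Q \<beta> \<sigma> \<omega>"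
      using assms by (simp add: 2 3 powr_powr)
  next
    assume "\<omega> \<in> frequencies \<and> s = Q \<beta> \<sigma> \<omega>"
    then have "L > 0" "s = L powr (1 / (2 * \<sigma>))" by (simp_all add: 2 3)
    then have "L = s powr (2 * \<sigma>)" using assms by (simp add: powr_powr)
    then show "theta \<beta> \<sigma> \<omega> s = 0" using 1 by simp
  qed
qed

lemma Q_pos:
  assumes "\<beta> > 0" "\<omega> \<in> frequencies" shows "Q \<beta> \<sigma> \<omega> > 0"
proof -
  have "ln (sqrt \<omega> / 2) + euler_mascheroni > 0"
    using frequencies_iff[OF frequencies_pos[OF assms(2)]] assms(2) by simp
  then have "(ln (sqrt \<omega> / 2) + euler_mascheroni) / (2 * pi * \<beta>) > 0"
    using assms(1) by (intro divide_pos_pos) auto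
  then show ?thesis unfolding Q_def by (simp only: powr_gt_zero)
qed

text \<open>
  The coupling constant changes with the spectral parameter as \<^const>\<open>theta\<close> does. Changing the parameter
  to \<open>\<omega>\<close> therefore turns the equation into the one with coupling constant \<open>theta \<beta> \<sigma> \<omega> \<bar>q\<bar>\<close>, which
  has to vanish because the charge does not.
\<close>

lemma standing_wave_imp_profile:
  assumes "\<beta> > 0" "\<sigma> > 0" "lam > 0" and sw: "standing_wave \<beta> \<sigma> lam \<omega> u"
  shows "\<omega> \<in> frequencies \<and> (\<exists>\<eta>::real. AE x in lborel. u x = profile \<beta> \<sigma> \<omega> \<eta> x)"
proof -
  obtain q where q: "has_charge lam u q"
    using sw assms(3) by (auto simp: standing_wave_def energy_space_iff)
  define \<theta> where "\<theta> = theta \<beta> \<sigma> lam (cmod q)"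
  have st: "stationary lam \<omega> \<theta> u q"
    using sw NLS_solution_rotating_iff[OF q assms(3)] by (simp add: standing_wave_def \<theta>_def)
  have nz: "\<not> (AE x in lborel. u x = 0)" using sw by (simp add: standing_wave_def)
  have \<omega>: "\<omega> > 0"
    using stationary_negative_frequency[OF st assms(3)] stationary_zero_frequency[of lam \<theta> u q] st assms(3) nz
    by (cases \<omega> "0::real" rule: linorder_cases) auto
  have "stationary \<omega> \<omega> (theta \<beta> \<sigma> \<omega> (cmod q)) u q"
    using stationary_change[OF st assms(3) \<omega>] theta_change[OF assms(3) \<omega>] by (simp add: \<theta>_def)
  note p = stationary_positive[OF this \<omega>]
  have "q \<noteq> 0"
  proof
    assume "q = 0"
    then have "AE x in lborel. u x = 0" using p(1) by simp
    then show False using nz by simp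
  qed
  then have "theta \<beta> \<sigma> \<omega> (cmod q) = 0" using p(2) by simp
  then have "\<omega> \<in> frequencies" and Q: "cmod q = Q \<beta> \<sigma> \<omega>"
    using theta_eq_0_iff[OF assms(1,2) \<omega>, of "cmod q"] \<open>q \<noteq> 0\<close> by auto
  have "q = Q \<beta> \<sigma> \<omega> * exp (\<i> * Arg q)"
    using Arg_eq[OF \<open>q \<noteq> 0\<close>] Q by simp
  then have "u x = profile \<beta> \<sigma> \<omega> (Arg q) x" if "u x = q * green \<omega> x" for x
    using that by (simp add: profile_def)
  then have "AE x in lborel. u x = profile \<beta> \<sigma> \<omega> (Arg q) x"
    using p(1) by (auto elim: eventually_mono)
  then show ?thesis using \<open>\<omega> \<in> frequencies\<close> by blast
qed

lemma profile_eq: "profile \<beta> \<sigma> \<omega> \<eta> = (\<lambda>x. (Q \<beta> \<sigma> \<omega> * exp (\<i> * \<eta>)) * green \<omega> x)"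
  by (simp add: profile_def[abs_def])

lemma green_not_AE_zero:
  assumes "\<omega> > 0" shows "\<not> (AE x in lborel. green \<omega> x = 0)"
proof
  assume "AE x in lborel. green \<omega> x = 0"
  then have "AE x in lborel. cnj (green \<omega> x) * green \<omega> x = 0" by eventually_elim simp
  then have "herm (green \<omega>) (green \<omega>) = 0"
    unfolding herm_def by (rule integral_eq_zero_AE)
  then show False
    using green_pairing_pos[OF assms assms] by (simp add: herm_green_green assms)
qed

lemma profile_standing_wave:
  assumes "\<beta> > 0" "\<sigma> > 0" "lam > 0" "\<omega> \<in> frequencies"
  shows "standing_wave \<beta> \<sigma> lam \<omega> (profile \<beta> \<sigma> \<omega> \<eta>)"
proof -
  have \<omega>: "\<omega> > 0" by (rule frequencies_pos[OF assms(4)])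
  define q where "q = Q \<beta> \<sigma> \<omega> * exp (\<i> * complex_of_real \<eta>)"
  have Q: "Q \<beta> \<sigma> \<omega> > 0" by (rule Q_pos[OF assms(1,4)])
  have cq: "cmod q = Q \<beta> \<sigma> \<omega>" using Q by (simp add: q_def norm_mult)
  have pr: "profile \<beta> \<sigma> \<omega> \<eta> = (\<lambda>x. q * green \<omega> x)" by (simp add: profile_eq q_def)
  have hq: "has_charge lam (\<lambda>x. q * green \<omega> x) q"
    by (rule has_charge_change[OF has_charge_green \<omega> assms(3)])
  have "theta \<beta> \<sigma> \<omega> (cmod q) = 0"
    using theta_eq_0_iff[OF assms(1,2) \<omega>, of "cmod q"] Q cq assms(4) by simp
  then have "theta \<beta> \<sigma> lam (cmod q) = 0 + ln (lam / \<omega>) / (4 * pi)"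
    using theta_change[OF \<omega> assms(3)] by simp
  then have "stationary lam \<omega> (theta \<beta> \<sigma> lam (cmod q)) (\<lambda>x. q * green \<omega> x) q"
    using stationary_change[OF stationary_green[OF \<omega>] \<omega> assms(3)] by simp
  then have "NLS_solution \<beta> \<sigma> lam (\<lambda>x. q * green \<omega> x) (rotating \<omega> (\<lambda>x. q * green \<omega> x))"
    using NLS_solution_rotating_iff[OF hq assms(3)] by simp
  moreover have "\<not> (AE x in lborel. q * green \<omega> x = 0)"
  proof -
    have "q \<noteq> 0" using cq Q by auto
    then show ?thesis using green_not_AE_zero[OF \<omega>] by simp
  qed
  ultimately show ?thesis
    unfolding standing_wave_def pr using hq assms(3) by (auto simp: energy_space_iff)
qed

section \<open>The energy of the standing waves\<close>

lemma energy_eq_form: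
  assumes "has_charge a \<psi> q" "a > 0"
  shows "energy \<beta> \<sigma> a \<psi> = Re (form a \<psi> q \<psi> q) + theta \<beta> \<sigma> a (cmod q) * (cmod q)\<^sup>2
     + \<sigma> * \<beta> / (\<sigma> + 1) * cmod q powr (2 * \<sigma> + 2)"
proof -
  note f = H1_weak_grad[OF assms(1)[unfolded has_charge_def]]
  have n: "Re (herm g g) = (L2_norm g)\<^sup>2" for g :: "real^2 \<Rightarrow> complex"
    by (simp add: herm_self L2_norm_def)
  show ?thesis
    unfolding energy_def Let_def charge_eq[OF assms] regular_part_def form_def
    by (simp add: n herm_vec_self[OF f(2)] algebra_simps)
qed

text \<open>
  At the spectral parameter \<open>\<omega>\<close> the regular part of the profile vanishes, and the value of the form is
  \<open>- \<omega>\<close> times the square of the norm of the profile, that is \<open>- Q\<^sup>2 / (4 \<pi>)\<close>. The logarithms from the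
  return to the parameter \<open>lam\<close> cancel against those in \<^const>\<open>theta\<close>.
\<close>

lemma energy_profile:
  assumes "\<beta> > 0" "\<sigma> > 0" "lam > 0" "\<omega> \<in> frequencies"
  shows "energy \<beta> \<sigma> lam (rotating \<omega> (profile \<beta> \<sigma> \<omega> \<eta>) t)
     = \<sigma> * \<beta> / (\<sigma> + 1) * Q \<beta> \<sigma> \<omega> powr (2 * \<sigma> + 2) - (Q \<beta> \<sigma> \<omega>)\<^sup>2 / (4 * pi)"
proof -
  have \<omega>: "\<omega> > 0" by (rule frequencies_pos[OF assms(4)])
  have Q: "Q \<beta> \<sigma> \<omega> > 0" by (rule Q_pos[OF assms(1,4)])
  define q where "q = exp (\<i> * complex_of_real \<omega> * t) * (Q \<beta> \<sigma> \<omega> * exp (\<i> * complex_of_real \<eta>))"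
  define \<psi> where "\<psi> x = q * green \<omega> x" for x
  have pr: "rotating \<omega> (profile \<beta> \<sigma> \<omega> \<eta>) t = \<psi>"
    by (auto simp: rotating_def profile_eq q_def \<psi>_def mult_ac)
  have cq: "cmod q = Q \<beta> \<sigma> \<omega>" using Q by (simp add: q_def norm_mult cmod_exp_i)
  have h: "has_charge \<omega> \<psi> q" unfolding \<psi>_def[abs_def] by (rule has_charge_green)
  have h': "has_charge lam \<psi> q" by (rule has_charge_change[OF h \<omega> assms(3)])
  have qq: "cnj q * q = of_real ((cmod q)\<^sup>2)"
    using complex_norm_square[of q] by (simp add: mult.commute)
  have "form \<omega> \<psi> q \<psi> q = - \<omega> * herm \<psi> \<psi>"
    using form_green_right[OF h \<omega>, of q] by (simp add: \<psi>_def[abs_def])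
  also have "herm \<psi> \<psi> = cnj q * q * of_real (green_pairing \<omega> \<omega>)"
    unfolding \<psi>_def[abs_def] herm_cmult_left herm_cmult_right herm_green_green[OF \<omega> \<omega>] by simp
  finally have "form \<omega> \<psi> q \<psi> q = of_real (- (cmod q)\<^sup>2 / (4 * pi))"
    using \<omega> unfolding qq green_pairing_def by simp
  then have F: "form lam \<psi> q \<psi> q = of_real (- (cmod q)\<^sup>2 / (4 * pi) - ln (lam / \<omega>) / (4 * pi) * (cmod q)\<^sup>2)"
    unfolding form_change[OF h h \<omega> assms(3)] mult.assoc qq by (simp only: of_real_diff of_real_mult)
  have th: "theta \<beta> \<sigma> lam (cmod q) = ln (lam / \<omega>) / (4 * pi)"
    using theta_eq_0_iff[OF assms(1,2) \<omega>, of "cmod q"] theta_change[OF \<omega> assms(3), of \<beta> \<sigma> "cmod q"] Q cq assms(4) by simp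
  show ?thesis
    unfolding pr energy_eq_form[OF h' assms(3)] F th Re_complex_of_real by (simp add: cq)
qed

text \<open>
  With \<open>u = ln z\<close> the bound \<open>1 + y \<le> exp y\<close> is used twice, for \<open>y = - u\<close> and for \<open>y = (p - 1) u\<close>.
\<close>

lemma bernoulli_powr:
  assumes "z > 0" "p \<ge> 1"
  shows "1 + p * (z - 1) \<le> z powr (p::real)"
proof -
  define u where "u = ln z"
  have z: "z = exp u" using assms by (simp add: u_def)
  have "1 - u \<le> exp (- u)" using exp_ge_add_one_self[of "- u"] by simp
  then have "exp u * (1 - u) \<le> exp u * exp (- u)" by (intro mult_left_mono) auto
  then have "exp u * (1 - u) \<le> 1" by (simp flip: exp_add)
  then have "(p - 1) * (exp u * (1 - u)) \<le> (p - 1) * 1" using assms by (intro mult_left_mono) auto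
  then have "1 + p * (exp u - 1) \<le> exp u * (1 + (p - 1) * u)" by (simp add: algebra_simps)
  also have "\<dots> \<le> exp u * exp ((p - 1) * u)"
    using exp_ge_add_one_self[of "(p - 1) * u"] by (intro mult_left_mono) auto
  also have "\<dots> = z powr p"
  proof -
    have "exp u * exp ((p - 1) * u) = exp (p * u)" by (simp add: algebra_simps flip: exp_add)
    then show ?thesis using assms by (simp add: powr_def u_def)
  qed
  finally show ?thesis by (simp add: z)
qed

text \<open>
  In the variable \<open>z = s\<^sup>2 / y0\<close>, where \<open>y0\<close> is the critical point of the energy as a function of
  \<open>s\<^sup>2\<close>, the energy is a multiple of \<open>z powr (\<sigma> + 1) / (\<sigma> + 1) - z\<close>, and Bernoulli's inequality gives
  the minimum at \<open>z = 1\<close>.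
\<close>

lemma energy_function_bound:
  assumes "\<beta> > 0" "\<sigma> > 0" "s > 0"
  shows "min_energy \<beta> \<sigma> \<le> \<sigma> * \<beta> / (\<sigma> + 1) * s powr (2 * \<sigma> + 2) - s\<^sup>2 / (4 * pi)"
    and "s = (1 / (4 * pi * \<sigma> * \<beta>)) powr (1 / (2 * \<sigma>)) \<Longrightarrow>
      \<sigma> * \<beta> / (\<sigma> + 1) * s powr (2 * \<sigma> + 2) - s\<^sup>2 / (4 * pi) = min_energy \<beta> \<sigma>"
proof -
  define k where "k = 4 * pi * \<sigma> * \<beta>"
  define y0 where "y0 = (1 / k) powr (1 / \<sigma>)"
  define z where "z = s\<^sup>2 / y0"
  have k: "k > 0" using assms by (simp add: k_def)
  have y0: "y0 > 0" using k by (simp add: y0_def)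
  have z: "z > 0" using y0 assms by (simp add: z_def)
  have s2: "s\<^sup>2 = y0 * z" using y0 by (simp add: z_def)
  have "s powr (2 * \<sigma> + 2) = (s\<^sup>2) powr (\<sigma> + 1)"
    using assms by (simp add: powr_powr algebra_simps flip: powr_numeral)
  also have "\<dots> = y0 powr \<sigma> * y0 * z powr (\<sigma> + 1)"
    unfolding s2 using y0 z by (simp add: powr_mult powr_add)
  also have "y0 powr \<sigma> = 1 / k"
    using k assms by (simp add: y0_def powr_powr)
  finally have sp: "s powr (2 * \<sigma> + 2) = y0 / k * z powr (\<sigma> + 1)" by simp
  have E: "\<sigma> * \<beta> / (\<sigma> + 1) * s powr (2 * \<sigma> + 2) - s\<^sup>2 / (4 * pi)
      = y0 / (4 * pi) * (z powr (\<sigma> + 1) / (\<sigma> + 1) - z)"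
  proof -
    have "\<sigma> * \<beta> / k = 1 / (4 * pi)" using assms by (simp add: k_def)
    moreover have "\<sigma> * \<beta> / (\<sigma> + 1) * (y0 / k * z powr (\<sigma> + 1)) = (\<sigma> * \<beta> / k) * (y0 * (z powr (\<sigma> + 1) / (\<sigma> + 1)))"
      by simp
    ultimately show ?thesis
      unfolding sp s2 by (simp add: right_diff_distrib)
  qed
  have M: "min_energy \<beta> \<sigma> = y0 / (4 * pi) * (1 / (\<sigma> + 1) - 1)"
  proof -
    have "1 / (\<sigma> + 1) - 1 = - \<sigma> / (\<sigma> + 1)" using assms by (simp add: field_simps)
    moreover have "y0 = 1 / k powr (1 / \<sigma>)"
      using k by (simp add: y0_def powr_divide)
    ultimately show ?thesis by (simp add: min_energy_def k_def)
  qed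
  have "1 + (\<sigma> + 1) * (z - 1) \<le> z powr (\<sigma> + 1)"
    using z assms by (intro bernoulli_powr) auto
  then have "(1 + (\<sigma> + 1) * (z - 1)) / (\<sigma> + 1) \<le> z powr (\<sigma> + 1) / (\<sigma> + 1)"
    using assms by (intro divide_right_mono) auto
  then have "1 / (\<sigma> + 1) - 1 \<le> z powr (\<sigma> + 1) / (\<sigma> + 1) - z"
    using assms by (simp add: add_divide_distrib)
  then show "min_energy \<beta> \<sigma> \<le> \<sigma> * \<beta> / (\<sigma> + 1) * s powr (2 * \<sigma> + 2) - s\<^sup>2 / (4 * pi)"
    unfolding E M using y0 by (intro mult_left_mono) auto
  assume "s = (1 / (4 * pi * \<sigma> * \<beta>)) powr (1 / (2 * \<sigma>))"
  then have "s\<^sup>2 = y0"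
    using assms k by (simp add: y0_def powr_powr k_def flip: powr_numeral)
  then have "z = 1" using y0 by (simp add: z_def)
  then show "\<sigma> * \<beta> / (\<sigma> + 1) * s powr (2 * \<sigma> + 2) - s\<^sup>2 / (4 * pi) = min_energy \<beta> \<sigma>"
    unfolding E M by simp
qed

lemma min_energy_negative:
  assumes "\<beta> > 0" "\<sigma> > 0" shows "min_energy \<beta> \<sigma> < 0"
  unfolding min_energy_def using assms by (intro divide_neg_pos mult_pos_pos) auto

text \<open>The frequency is the solution of \<open>Q\<^sup>2 = (4 \<pi> \<sigma> \<beta>) powr (- 1 / \<sigma>)\<close>, the critical point of the energy.\<close>

lemma optimal_frequency:
  assumes "\<beta> > 0" "\<sigma> > 0"
  defines "\<omega> \<equiv> 4 * exp (1 / \<sigma> - 2 * euler_mascheroni)"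
  shows "\<omega> \<in> frequencies" "Q \<beta> \<sigma> \<omega> = (1 / (4 * pi * \<sigma> * \<beta>)) powr (1 / (2 * \<sigma>))"
proof -
  show "\<omega> \<in> frequencies" using assms by (simp add: frequencies_def)
  have \<omega>: "\<omega> > 0" by (simp add: \<omega>_def)
  have "ln (4::real) = 2 * ln 2" using ln_realpow[of 2 2] by simp
  then have "ln (sqrt \<omega> / 2) = 1 / (2 * \<sigma>) - euler_mascheroni"
    using \<omega> by (simp add: ln_div ln_sqrt) (simp add: \<omega>_def ln_mult field_simps)
  then have "(ln (sqrt \<omega> / 2) + euler_mascheroni) / (2 * pi * \<beta>) = 1 / (4 * pi * \<sigma> * \<beta>)"
    by simp
  then show "Q \<beta> \<sigma> \<omega> = (1 / (4 * pi * \<sigma> * \<beta>)) powr (1 / (2 * \<sigma>))"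
    by (simp add: Q_def)
qed

lemma energy_minimum:
  fixes \<eta> t :: real
  assumes "\<beta> > 0" "\<sigma> > 0" "lam > 0"
  defines "E \<equiv> (\<lambda>\<omega>. energy \<beta> \<sigma> lam (rotating \<omega> (profile \<beta> \<sigma> \<omega> \<eta>) t))"
  shows "min_energy \<beta> \<sigma> \<in> E ` frequencies" "\<forall>e\<in>E ` frequencies. min_energy \<beta> \<sigma> \<le> e"
proof -
  note opt = optimal_frequency[OF assms(1,2)]
  show "min_energy \<beta> \<sigma> \<in> E ` frequencies"
    using energy_function_bound(2)[OF assms(1,2) Q_pos[OF assms(1) opt(1)] opt(2)]
      energy_profile[OF assms(1-3) opt(1), of \<eta> t] opt(1)
    by (intro image_eqI[where x="4 * exp (1 / \<sigma> - 2 * euler_mascheroni)"]) (auto simp: E_def)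
  show "\<forall>e\<in>E ` frequencies. min_energy \<beta> \<sigma> \<le> e"
    using energy_function_bound(1)[OF assms(1,2) Q_pos[OF assms(1)]]
    by (auto simp: E_def energy_profile[OF assms(1-3)])
qed

theorem theorem2p2:
  fixes \<beta> \<sigma> lam :: real
  assumes "\<beta> > 0" and "\<sigma> > 0" and "lam > 0"
  shows "(\<forall>\<omega> u. standing_wave \<beta> \<sigma> lam \<omega> u \<longrightarrow>
            \<omega> \<in> frequencies \<and> (\<exists>\<eta>::real. AE x in lborel. u x = profile \<beta> \<sigma> \<omega> \<eta> x))
       \<and> (\<forall>\<omega>\<in>frequencies. \<forall>\<eta>. standing_wave \<beta> \<sigma> lam \<omega> (profile \<beta> \<sigma> \<omega> \<eta>))
       \<and> (\<forall>\<eta> t. let energies =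
              (\<lambda>\<omega>. energy \<beta> \<sigma> lam (rotating \<omega> (profile \<beta> \<sigma> \<omega> \<eta>) t)) ` frequencies
            in min_energy \<beta> \<sigma> \<in> energies \<and> (\<forall>e\<in>energies. min_energy \<beta> \<sigma> \<le> e))
       \<and> min_energy \<beta> \<sigma> < 0"
  using standing_wave_imp_profile[OF assms] profile_standing_wave[OF assms]
    energy_minimum[OF assms] min_energy_negative[OF assms(1,2)]
  unfolding Let_def by blast

end
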